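(* For estimating the Shannon entropy $\mathrm{H}(P)=-\sum_{i=1}^d p_i\ln p_i$ of an unknown distribution $P$ on $\{1,\dots,d\}$ to within additive error $\varepsilon$, the quantum query complexity (in the purified quantum query access model) is $\Omega\!\left(\frac{\sqrt{d}}{\sqrt{\varepsilon\log d}}+\frac{\log d}{\varepsilon}\right)$.
   Context: Purified quantum query access to a distribution $P=(p_1,\dots,p_d)$: a unitary $U$ on two registers $\mathsf{A},\mathsf{B}$ with $U\ket{0}_{\mathsf A}\ket{0}_{\mathsf B}=\sum_{i=1}^d\sqrt{p_i}\ket{i}_{\mathsf A}\ket{\psi_i}_{\mathsf B}$ for some orthonormal set $\{\ket{\psi_i}\}$; one query means one application of $U$, $U^\dagger$, controlled-$U$ or controlled-$U^\dagger$. The query complexity is the minimum number of queries of a quantum algorithm that outputs an $\varepsilon$-accurate estimate with probability at least $2/3$ for every input distribution. *)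

theory Defs
  imports "HOL-Analysis.Analysis" "Jordan_Normal_Form.Matrix"
begin

definition cadj :: "complex mat \<Rightarrow> complex mat" where
  "cadj A = mat (dim_col A) (dim_row A) (\<lambda>(i,j). cnj (A $$ (j,i)))"

definition is_unitary :: "nat \<Rightarrow> complex mat \<Rightarrow> bool" where
  "is_unitary n A \<longleftrightarrow> A \<in> carrier_mat n n \<and> cadj A * A = 1\<^sub>m n \<and> A * cadj A = 1\<^sub>m n"

text \<open>Kronecker product (tensor product) of square matrices; basis index of
 |i>|j> is i * b + j, where b is the dimension of the second factor.\<close>
definition kron :: "complex mat \<Rightarrow> complex mat \<Rightarrow> complex mat" where
  "kron A B = mat (dim_row A * dim_row B) (dim_col A * dim_col B)
     (\<lambda>(i,j). A $$ (i div dim_row B, j div dim_col B) * B $$ (i mod dim_row B, j mod dim_col B))"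

definition cinner :: "complex vec \<Rightarrow> complex vec \<Rightarrow> complex" where
  "cinner u v = (\<Sum>k<dim_vec v. cnj (u $ k) * v $ k)"

definition is_distribution :: "nat \<Rightarrow> (nat \<Rightarrow> real) \<Rightarrow> bool" where
  "is_distribution d p \<longleftrightarrow> (\<forall>i<d. 0 \<le> p i) \<and> (\<Sum>i<d. p i) = 1"

definition shannon_entropy :: "nat \<Rightarrow> (nat \<Rightarrow> real) \<Rightarrow> real" where
  "shannon_entropy d p = - (\<Sum>i<d. p i * ln (p i))"

text \<open>Purified quantum query access: U on A (dim d) tensor B (dim m) with
 U|0>|0> = sum_i sqrt(p_i) |i>|psi_i>, psi_i orthonormal.\<close>
definition purified_oracle :: "nat \<Rightarrow> nat \<Rightarrow> (nat \<Rightarrow> real) \<Rightarrow> complex mat \<Rightarrow> bool" where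
  "purified_oracle d m p U \<longleftrightarrow> is_unitary (d * m) U \<and>
     (\<exists>\<psi> :: nat \<Rightarrow> complex vec.
        (\<forall>i<d. dim_vec (\<psi> i) = m) \<and>
        (\<forall>i<d. \<forall>j<d. cinner (\<psi> i) (\<psi> j) = (if i = j then 1 else 0)) \<and>
        U *\<^sub>v unit_vec (d * m) 0 =
          vec (d * m) (\<lambda>k. complex_of_real (sqrt (p (k div m))) * (\<psi> (k div m) $ (k mod m))))"

text \<open>Full register: control qubit C (dim 2) tensor AB (dim d*m) tensor workspace W (dim w).
 Query types: 0 = U, 1 = U^dagger, 2 = controlled-U, 3 = controlled-U^dagger.\<close>
definition proj0 :: "complex mat" where "proj0 = mat 2 2 (\<lambda>(i,j). if i = 0 \<and> j = 0 then 1 else 0)"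
definition proj1 :: "complex mat" where "proj1 = mat 2 2 (\<lambda>(i,j). if i = 1 \<and> j = 1 then 1 else 0)"

definition query_op :: "nat \<Rightarrow> nat \<Rightarrow> complex mat \<Rightarrow> nat \<Rightarrow> complex mat" where
  "query_op dm w U t =
    (let W = (if t = 0 \<or> t = 2 then U else cadj U) in
     if t \<le> 1 then kron (1\<^sub>m 2) (kron W (1\<^sub>m w))
     else kron proj0 (1\<^sub>m (dm * w)) + kron proj1 (kron W (1\<^sub>m w)))"

text \<open>A T-query algorithm: unitaries V 0, ..., V T on the full space, query types
 qt 1, ..., qt T, and an output map from measurement outcomes to reals.
 State after k queries (starting from the all-zero basis state):\<close>
fun alg_state :: "nat \<Rightarrow> nat \<Rightarrow> (nat \<Rightarrow> complex mat) \<Rightarrow> (nat \<Rightarrow> nat) \<Rightarrow> complex mat \<Rightarrow> nat \<Rightarrow> complex vec" where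
  "alg_state dm w V qt U 0 = V 0 *\<^sub>v unit_vec (2 * dm * w) 0"
| "alg_state dm w V qt U (Suc k) = V (Suc k) *\<^sub>v (query_op dm w U (qt (Suc k)) *\<^sub>v alg_state dm w V qt U k)"

definition valid_algorithm :: "nat \<Rightarrow> nat \<Rightarrow> nat \<Rightarrow> (nat \<Rightarrow> complex mat) \<Rightarrow> (nat \<Rightarrow> nat) \<Rightarrow> bool" where
  "valid_algorithm dm w T V qt \<longleftrightarrow> 0 < w \<and> (\<forall>k\<le>T. is_unitary (2 * dm * w) (V k)) \<and> (\<forall>k\<in>{1..T}. qt k < 4)"

definition success_prob :: "nat \<Rightarrow> nat \<Rightarrow> nat \<Rightarrow> (nat \<Rightarrow> complex mat) \<Rightarrow> (nat \<Rightarrow> nat) \<Rightarrow> (nat \<Rightarrow> real)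
   \<Rightarrow> complex mat \<Rightarrow> (real \<Rightarrow> bool) \<Rightarrow> real" where
  "success_prob dm w T V qt out U S =
     (\<Sum>x<2 * dm * w. if S (out x) then (cmod (alg_state dm w V qt U T $ x))\<^sup>2 else 0)"

end

theory Submission
  imports Defs "HOL-Real_Asymp.Real_Asymp"
begin

text \<open>
  The oracle is a product of real plane rotations, the \<open>k\<close>-th one moving amplitude \<open>s\<^sub>k\<close>
  from the basis state \<open>00\<close> to \<open>kk\<close>. The resulting distribution is obtained by stick breaking with
  fractions \<open>u\<^sub>k = s\<^sub>k\<^sup>2\<close>, and by the chain rule its entropy satisfies
  \<open>H\<^sub>k\<^sub>+\<^sub>1 = h(u\<^sub>k) + (1 - u\<^sub>k) H\<^sub>k\<close> with the binary entropy \<open>h\<close>.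

  For the term \<open>\<surd>d / \<surd>(\<epsilon> ln d)\<close> the fractions are drawn independently from one of two laws on
  \<open>[0, b]\<close>, \<open>b \<approx> \<epsilon> ln\<^sup>2 d / d\<close>, that share about \<open>2 ln d\<close> moments but differ in the mean of \<open>u ln u\<close> by a
  constant multiple of the mean of \<open>u\<close>; so the entropies, which concentrate, differ by more than
  \<open>4\<epsilon>\<close>. Averaged over the signs of \<open>c\<^sub>k\<close> and \<open>s\<^sub>k\<close>, the success probability is a polynomial \<open>P\<close> in
  each single \<open>u\<^sub>k\<close>. A rotation by a complex angle has norm at most
  \<open>exp \<surd>\<bar>u\<bar>\<close>, so \<open>\<bar>P u\<bar> \<le> exp (2 T \<surd>\<bar>u\<bar>)\<close> for complex \<open>u\<close>; Cauchy's estimate makes the coefficients beyond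
  the matched moments negligible unless \<open>T \<ge> c \<surd>(d/\<epsilon>)\<close>, and the two laws can be exchanged one
  coordinate at a time. This works when \<open>\<epsilon> d \<ge> ln\<^sup>3 d\<close>; otherwise the second term dominates.

  The term \<open>ln d / \<epsilon>\<close> is a hybrid argument: perturbing the last rotation by \<open>\<delta>\<close> changes the entropy by
  about \<open>\<delta> ln d\<close>.
\<close>

text \<open>The constraint that shapes the two laws is that the stick is finite: \<open>k\<close>
  times the mean of the fractions must stay below 1/2, otherwise later breaks wipe out the gap
  collected earlier. So the gap has to be comparable to the mean of \<open>u\<close>, not to its
  maximum \<open>b\<close>, and the laws must concentrate near \<open>u = 0\<close>. With
  \<open>n\<close> about ln d matched moments (up to a factor 2), mean and gap are both of order b /
  n^2; asking that k b / n^2 be of order \<epsilon> fixes \<open>b\<close>. The choice of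
  \<open>n\<close> comes from the exchange: one coordinate costs at most exp (- 2 n) and there are
  at most exp n of them. On a circle of radius proportional to \<open>b\<close> the polynomial may
  grow to exp n, so T can be as large as a constant times n / sqrt b, where \<open>n\<close> cancels
  and sqrt (d / \<epsilon>) remains. The leading term of the variance is of order \<epsilon> sqrt b
  and must be small against \<epsilon>^2, that is, ln^2 d must be small against \<epsilon> d.
  Requiring ln^3 d <= \<epsilon> d gives this with room for constants, and it is exactly the
  threshold at which the two terms of the bound are equal.\<close>

unbundle no vec_syntax and no inner_syntax

section \<open>Product expectations\<close>

primrec prod_expect :: "'a set \<Rightarrow> ('a \<Rightarrow> real) \<Rightarrow> nat \<Rightarrow> ((nat \<Rightarrow> 'a) \<Rightarrow> real) \<Rightarrow> real" where
  "prod_expect A w 0 F = F (\<lambda>_. undefined)"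
| "prod_expect A w (Suc n) F = (\<Sum>a\<in>A. w a * prod_expect A w n (\<lambda>x. F (x(n := a))))"

definition prob_weight :: "'a set \<Rightarrow> ('a \<Rightarrow> real) \<Rightarrow> bool" where
  "prob_weight A w \<longleftrightarrow> finite A \<and> (\<forall>a\<in>A. 0 \<le> w a) \<and> sum w A = 1"

lemma prod_expect_add:
  "prod_expect A w n (\<lambda>x. F x + G x) = prod_expect A w n F + prod_expect A w n G"
  by (induction n arbitrary: F G) (simp_all add: sum.distrib distrib_left)

lemma prod_expect_cmult:
  "prod_expect A w n (\<lambda>x. c * F x) = c * prod_expect A w n F"
  by (induction n arbitrary: F) (simp_all add: sum_distrib_left mult.left_commute)

lemma prod_expect_diff:
  "prod_expect A w n (\<lambda>x. F x - G x) = prod_expect A w n F - prod_expect A w n G"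
  using prod_expect_add[of A w n F "\<lambda>x. (-1) * G x"] prod_expect_cmult[of A w n "-1" G] by simp

lemma prod_expect_sum:
  "prod_expect A w n (\<lambda>x. \<Sum>i\<in>I. F i x) = (\<Sum>i\<in>I. prod_expect A w n (F i))"
  by (induction n arbitrary: F) (simp_all add: sum_distrib_left sum.swap[of _ _ A])

lemma prod_expect_mono:
  assumes "\<And>a. a \<in> A \<Longrightarrow> 0 \<le> w a" "\<And>x. (\<forall>i<n. x i \<in> A) \<Longrightarrow> F x \<le> G x"
  shows "prod_expect A w n F \<le> prod_expect A w n G"
  using assms(2)
proof (induction n arbitrary: F G)
  case 0 then show ?case by simp
next
  case (Suc n)
  have "prod_expect A w n (\<lambda>x. F (x(n := a))) \<le> prod_expect A w n (\<lambda>x. G (x(n := a)))"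
    if "a \<in> A" for a
    by (rule Suc.IH, rule Suc.prems) (use that in \<open>auto simp: less_Suc_eq\<close>)
  then show ?case
    by (auto intro!: sum_mono mult_left_mono assms(1))
qed

lemma prod_expect_const:
  assumes "prob_weight A w"
  shows "prod_expect A w n (\<lambda>x. c) = c"
  using assms by (induction n) (simp_all add: prob_weight_def flip: sum_distrib_right)

lemma prod_expect_abs_le:
  assumes w: "prob_weight A w" and le: "\<And>x. (\<forall>i<n. x i \<in> A) \<Longrightarrow> \<bar>F x\<bar> \<le> c"
  shows "\<bar>prod_expect A w n F\<bar> \<le> c"
proof -
  have pos: "\<And>a. a \<in> A \<Longrightarrow> 0 \<le> w a"
    using w by (simp add: prob_weight_def)
  have "prod_expect A w n F \<le> prod_expect A w n (\<lambda>x. c)"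
    by (rule prod_expect_mono[OF pos]) (use le in \<open>auto dest: abs_le_D1\<close>)
  moreover have "prod_expect A w n (\<lambda>x. - c) \<le> prod_expect A w n F"
  proof (rule prod_expect_mono[OF pos])
    show "- c \<le> F x" if "\<forall>i<n. x i \<in> A" for x
      using le[OF that] by linarith
  qed
  ultimately show ?thesis
    by (simp add: prod_expect_const[OF w] abs_le_iff)
qed

lemma prod_expect_cong:
  assumes "\<And>x. (\<forall>i<n. x i \<in> A) \<Longrightarrow> F x = G x"
  shows "prod_expect A w n F = prod_expect A w n G"
  using assms
proof (induction n arbitrary: F G)
  case (Suc n)
  have "prod_expect A w n (\<lambda>x. F (x(n := a))) = prod_expect A w n (\<lambda>x. G (x(n := a)))"
    if "a \<in> A" for a
    by (rule Suc.IH, rule Suc.prems) (use that in \<open>auto simp: less_Suc_eq\<close>)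
  then show ?case by simp
qed simp

text \<open>Lindeberg replacement: the coordinates are exchanged one at a time.\<close>

lemma prod_expect_replace:
  assumes v: "prob_weight A v" and w: "prob_weight A w"
    and "\<And>i x. i < n \<Longrightarrow> (\<forall>j<n. x j \<in> A) \<Longrightarrow> \<bar>\<Sum>a\<in>A. (v a - w a) * F (x(i := a))\<bar> \<le> \<eta>"
  shows "\<bar>prod_expect A v n F - prod_expect A w n F\<bar> \<le> n * \<eta>"
  using assms(3)
proof (induction n arbitrary: F)
  case 0 then show ?case by simp
next
  case (Suc n)
  define G where "G = (\<lambda>x. \<Sum>a\<in>A. w a * F (x(n := a)))"
  have wsum: "(\<Sum>a\<in>A. w a) = 1" and wpos: "\<And>a. a \<in> A \<Longrightarrow> 0 \<le> w a" and fin: "finite A"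
    using w by (auto simp: prob_weight_def)
  have A0: "A \<noteq> {}" using wsum by auto
  have E: "prod_expect A u (Suc n) F = prod_expect A u n (\<lambda>x. \<Sum>a\<in>A. u a * F (x(n := a)))" for u
    by (simp add: prod_expect_sum prod_expect_cmult)
  \<comment> \<open>Coordinate \<open>n\<close> is exchanged while the others still follow
    \<open>v\<close>; what remains is the same problem for \<open>G\<close>, in which coordinate
    \<open>n\<close> is already averaged under \<open>w\<close>.\<close>
  have "prod_expect A v (Suc n) F - prod_expect A w (Suc n) F
      = prod_expect A v n (\<lambda>x. \<Sum>a\<in>A. (v a - w a) * F (x(n := a)))
        + (prod_expect A v n G - prod_expect A w n G)"
    unfolding E G_def
    by (simp add: left_diff_distrib sum_subtractf prod_expect_diff)
  moreover have "\<bar>prod_expect A v n (\<lambda>x. \<Sum>a\<in>A. (v a - w a) * F (x(n := a)))\<bar> \<le> \<eta>"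
  proof (rule prod_expect_abs_le[OF v])
    fix x :: "nat \<Rightarrow> 'a" assume *: "\<forall>i<n. x i \<in> A"
    \<comment> \<open>The hypothesis speaks of points with all \<open>Suc n\<close> coordinates in
      \<open>A\<close>; the dummy value \<open>a0\<close> at coordinate \<open>n\<close> is
      overwritten by the update.\<close>
    obtain a0 where a0: "a0 \<in> A" using A0 by auto
    have "\<bar>\<Sum>a\<in>A. (v a - w a) * F ((x(n := a0))(n := a))\<bar> \<le> \<eta>"
      by (rule Suc.prems) (use * a0 in \<open>auto simp: less_Suc_eq\<close>)
    then show "\<bar>\<Sum>a\<in>A. (v a - w a) * F (x(n := a))\<bar> \<le> \<eta>" by simp
  qed
  moreover have "\<bar>prod_expect A v n G - prod_expect A w n G\<bar> \<le> n * \<eta>"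
  proof (rule Suc.IH)
    fix i and x :: "nat \<Rightarrow> 'a" assume i: "i < n" and *: "\<forall>j<n. x j \<in> A"
    have "(\<Sum>a\<in>A. (v a - w a) * G (x(i := a)))
        = (\<Sum>c\<in>A. w c * (\<Sum>a\<in>A. (v a - w a) * F ((x(n := c))(i := a))))"
      unfolding G_def sum_distrib_left
      by (subst sum.swap) (use i in \<open>auto intro!: sum.cong simp: fun_upd_twist[of i n]\<close>)
    also have "\<bar>\<dots>\<bar> \<le> (\<Sum>c\<in>A. w c * \<eta>)"
    proof (rule order.trans[OF sum_abs sum_mono])
      fix c assume c: "c \<in> A"
      have "\<bar>\<Sum>a\<in>A. (v a - w a) * F ((x(n := c))(i := a))\<bar> \<le> \<eta>"
        by (rule Suc.prems) (use i * c in \<open>auto simp: less_Suc_eq\<close>)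
      then show "\<bar>w c * (\<Sum>a\<in>A. (v a - w a) * F ((x(n := c))(i := a)))\<bar> \<le> w c * \<eta>"
        using wpos[OF c] by (simp add: abs_mult mult_left_mono)
    qed
    also have "\<dots> = \<eta>" using wsum by (simp flip: sum_distrib_right)
    finally show "\<bar>\<Sum>a\<in>A. (v a - w a) * G (x(i := a))\<bar> \<le> \<eta>" .
  qed
  ultimately show ?case by (simp add: algebra_simps)
qed

section \<open>Alternating sums on a trigonometric grid\<close>

lemma sum_cis_roots_of_unity:
  fixes q :: int
  assumes "M > 0"
  shows "(\<Sum>j<M. cis (2 * pi * of_int q * real j / real M)) = (if int M dvd q then of_nat M else 0)"
proof -
  define z where "z = cis (2 * pi * of_int q / real M)"
  have pow: "cis (2 * pi * of_int q * real j / real M) = z ^ j" for j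
    unfolding z_def Complex.DeMoivre by (simp add: mult_ac)
  have zM: "z ^ M = 1"
    unfolding z_def Complex.DeMoivre using assms cis_multiple_2pi[of "of_int q"] by (simp add: mult_ac)
  show ?thesis
  proof (cases "int M dvd q")
    case True
    then obtain r where "q = int M * r" by (auto simp: dvd_def)
    then have "z = 1" unfolding z_def
      using assms cis_multiple_2pi[of "of_int r"] by (simp add: mult_ac)
    with True show ?thesis by (simp add: pow)
  next
    case False
    have "z \<noteq> 1"
    proof
      assume "z = 1"
      then have "cos (2 * pi * of_int q / real M) = 1"
        by (simp add: z_def complex_eq_iff)
      then obtain r :: int where "2 * pi * of_int q / real M = of_int r * 2 * pi"
        using cos_one_2pi_int by auto
      then have "real_of_int q = of_int (r * int M)"
        using assms by (simp add: field_simps)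
      then have "q = r * int M" by (simp only: of_int_eq_iff)
      with False show False by simp
    qed
    then show ?thesis
      unfolding pow using False zM by (simp add: sum_gp_strict flip: lessThan_atLeast0)
  qed
qed

text \<open>The sign \<open>(-1) ^ j\<close> is the wave of frequency N sampled at the nodes. Hence
  the sum sees only frequencies congruent to N modulo 2 N and annihilates trigonometric polynomials
  of degree below N. The even nodes will carry one law and the odd nodes the other.\<close>

definition alt_sum :: "nat \<Rightarrow> (real \<Rightarrow> real) \<Rightarrow> real" where
  "alt_sum N f = (\<Sum>j<2 * N. (-1) ^ j * f (pi * real j / real N))"

lemma alt_sum_cos:
  fixes q :: int
  assumes "N > 0"
  shows "alt_sum N (\<lambda>t. cos (of_int q * t)) = (if int (2 * N) dvd q + int N then 2 * real N else 0)"
proof -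
  have "(-1) ^ j * cos (of_int q * (pi * real j / real N))
      = Re (cis (2 * pi * of_int (q + int N) * real j / real (2 * N)))" for j
  proof -
    have "2 * pi * of_int (q + int N) * real j / real (2 * N)
        = of_int q * (pi * real j / real N) + real j * pi"
      using assms by (simp add: field_simps)
    then show ?thesis
      by (simp only: cis.sel cos_add cos_npi sin_npi) (simp add: mult.commute)
  qed
  then have "alt_sum N (\<lambda>t. cos (of_int q * t))
      = Re (\<Sum>j<2 * N. cis (2 * pi * of_int (q + int N) * real j / real (2 * N)))"
    by (simp add: alt_sum_def)
  also have "\<dots> = (if int (2 * N) dvd q + int N then 2 * real N else 0)"
    using sum_cis_roots_of_unity[of "2 * N" "q + int N"] assms by simp
  finally show ?thesis .
qed

lemma alt_sum_add: "alt_sum N (\<lambda>t. f t + g t) = alt_sum N f + alt_sum N g"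
  by (simp add: alt_sum_def distrib_left sum.distrib)

lemma alt_sum_diff: "alt_sum N (\<lambda>t. f t - g t) = alt_sum N f - alt_sum N g"
  by (simp add: alt_sum_def right_diff_distrib sum_subtractf)

lemma alt_sum_cmult: "alt_sum N (\<lambda>t. c * f t) = c * alt_sum N f"
  by (simp add: alt_sum_def sum_distrib_left mult.left_commute)

lemma alt_sum_sum: "alt_sum N (\<lambda>t. \<Sum>i\<in>I. f i t) = (\<Sum>i\<in>I. alt_sum N (f i))"
  by (simp add: alt_sum_def sum_distrib_left sum.swap[of _ _ I])

lemma cos_mult_one_minus_cos:
  fixes t :: real
  shows "cos (of_int q * t) * (1 - cos t)
       = cos (of_int q * t) - cos (of_int (q + 1) * t) / 2 - cos (of_int (q - 1) * t) / 2"
  by (simp add: distrib_right left_diff_distrib cos_add cos_diff field_simps)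

text \<open>Each factor \<open>1 - cos t\<close> moves a frequency by at most 1, so all frequencies
  stay strictly between - N and N.\<close>

lemma alt_sum_low_degree:
  fixes q :: int
  assumes "\<bar>q\<bar> + int k < int N"
  shows "alt_sum N (\<lambda>t. cos (of_int q * t) * (1 - cos t) ^ k) = 0"
  using assms
proof (induction k arbitrary: q)
  case 0
  have "\<not> int (2 * N) dvd q + int N"
  proof
    assume "int (2 * N) dvd q + int N"
    then have "int (2 * N) \<le> q + int N" using 0 by (intro zdvd_imp_le) auto
    with 0 show False by simp
  qed
  with 0 show ?case by (simp add: alt_sum_cos)
next
  case (Suc k)
  have "alt_sum N (\<lambda>t. cos (of_int q * t) * (1 - cos t) ^ Suc k)
      = alt_sum N (\<lambda>t. cos (of_int q * t) * (1 - cos t) ^ k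
          - (1/2) * (cos (of_int (q + 1) * t) * (1 - cos t) ^ k)
          - (1/2) * (cos (of_int (q - 1) * t) * (1 - cos t) ^ k))"
    unfolding power_Suc mult.assoc[symmetric] cos_mult_one_minus_cos
    by (simp add: algebra_simps)
  also have "\<dots> = 0"
    unfolding alt_sum_diff alt_sum_cmult
    using Suc.IH[of q] Suc.IH[of "q + 1"] Suc.IH[of "q - 1"] Suc.prems by simp
  finally show ?case .
qed

section \<open>The Fejer kernel: frequencies, size, and sums over the grid\<close>

definition fejer :: "nat \<Rightarrow> real \<Rightarrow> real" where
  "fejer n t = (cmod (\<Sum>a<n. cis (real a * t)))^2"

lemma fejer_nonneg: "0 \<le> fejer n t"
  by (simp add: fejer_def)

lemma fejer_eq_sum: "fejer n t = (\<Sum>a<n. \<Sum>c<n. cos (of_int (int a - int c) * t))"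
proof -
  define D where "D = (\<Sum>a<n. cis (real a * t))"
  have "complex_of_real (fejer n t) = D * cnj D"
    unfolding fejer_def D_def by (rule complex_norm_square)
  also have "\<dots> = (\<Sum>a<n. \<Sum>c<n. cis (of_int (int a - int c) * t))"
    by (simp add: D_def sum_product cis_cnj cis_mult algebra_simps)
  finally have "Re (complex_of_real (fejer n t)) = Re (\<Sum>a<n. \<Sum>c<n. cis (of_int (int a - int c) * t))"
    by simp
  then show ?thesis by simp
qed

lemma fejer_power2_eq_sum:
  "(fejer n t)^2 = (\<Sum>a<n. \<Sum>b<n. \<Sum>c<n. \<Sum>e<n. cos (of_int (int a + int b - int c - int e) * t))"
proof -
  let ?E = "(\<Sum>a<n. \<Sum>b<n. \<Sum>c<n. \<Sum>e<n. cis (of_int (int a + int b - int c - int e) * t))"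
  define D where "D = (\<Sum>a<n. cis (real a * t))"
  let ?D = "(\<Sum>a<n. \<Sum>b<n. cis ((real a + real b) * t))"
  let ?F = "(\<Sum>c<n. \<Sum>e<n. cis (- (real c + real e) * t))"
  have "complex_of_real (fejer n t) = D * cnj D"
    unfolding fejer_def D_def by (rule complex_norm_square)
  then have "complex_of_real ((fejer n t)^2) = (D * D) * (cnj D * cnj D)"
    by (simp add: power2_eq_square)
  also have "D * D = ?D"
    by (simp add: D_def sum_product cis_mult algebra_simps)
  also have "cnj D * cnj D = ?F"
    by (simp add: D_def sum_product cis_mult cis_cnj algebra_simps)
  also have "?D * ?F
      = (\<Sum>a<n. \<Sum>b<n. cis ((real a + real b) * t) * ?F)"
    by (simp only: sum_distrib_right)
  also have "\<dots> = ?E"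
    unfolding sum_distrib_left cis_mult
    by (intro sum.cong refl arg_cong[where f = cis]) (simp add: algebra_simps)
  finally have "Re (complex_of_real ((fejer n t)^2)) =
      Re ?E"
    by simp
  then show ?thesis by simp
qed

lemma fejer_le: "fejer n t \<le> (real n)^2"
proof -
  have "cmod (\<Sum>a<n. cis (real a * t)) \<le> (\<Sum>a<n. cmod (cis (real a * t)))"
    by (rule norm_sum)
  then show ?thesis by (simp add: fejer_def power_mono)
qed

lemma fejer_0: "fejer n 0 = (real n)^2"
  by (simp add: fejer_def)

lemma norm_one_minus_cis: "(cmod (1 - cis t))^2 = 2 * (1 - cos t)"
proof -
  have "(cmod (1 - cis t))^2 = (1 - cos t)^2 + (sin t)^2"
    by (simp add: cmod_power2)
  also have "\<dots> = 2 * (1 - cos t)"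
    using sin_cos_squared_add[of t] unfolding power2_diff by simp
  finally show ?thesis .
qed

text \<open>The geometric sum times \<open>1 - cis t\<close> is \<open>1 - cis t ^ n\<close>, of
  modulus at most 2. In the squared kernel one factor is spent against \<open>1 - cos t\<close> in
  this way while the other is summed exactly by \<open>sum_fejer\<close>.\<close>

lemma fejer_mult_le: "fejer n t * (1 - cos t) \<le> 2"
proof -
  have "1 - cis t ^ n = (1 - cis t) * (\<Sum>a<n. cis (real a * t))"
    using one_diff_power_eq[of "cis t" n] unfolding Complex.DeMoivre .
  then have "cmod (1 - cis t) * cmod (\<Sum>a<n. cis (real a * t)) = cmod (1 - cis t ^ n)"
    by (simp only: norm_mult)
  also have "\<dots> \<le> 2"
    using norm_triangle_ineq4[of 1 "cis t ^ n"] by (simp add: norm_power)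
  finally have "cmod (\<Sum>a<n. cis (real a * t)) * cmod (1 - cis t) \<le> 2"
    by (simp only: mult.commute)
  then have "(cmod (\<Sum>a<n. cis (real a * t)) * cmod (1 - cis t))^2 \<le> 2^2"
    by (intro power_mono) auto
  then show ?thesis
    unfolding power_mult_distrib norm_one_minus_cis by (simp add: fejer_def algebra_simps)
qed

lemma sum_fejer:
  assumes "n \<le> M" "M > 0"
  shows "(\<Sum>j<M. fejer n (2 * pi * real j / real M)) = real M * real n"
proof -
  have dvd: "int M dvd int a - int c \<longleftrightarrow> a = c" if "a < n" "c < n" for a c
  proof
    assume d: "int M dvd int a - int c"
    show "a = c"
    proof (rule ccontr)
      assume "a \<noteq> c"
      then have "\<bar>int M\<bar> \<le> \<bar>int a - int c\<bar>" using d by (intro dvd_imp_le_int) auto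
      with that assms show False by linarith
    qed
  qed simp
  have "(\<Sum>j<M. fejer n (2 * pi * real j / real M))
      = (\<Sum>a<n. \<Sum>c<n. Re (\<Sum>j<M. cis (2 * pi * of_int (int a - int c) * real j / real M)))"
    unfolding fejer_eq_sum
    by (simp only: sum.swap[where A = "{..<M}"] Re_sum cis.sel) (simp add: mult_ac)
  also have "\<dots> = (\<Sum>a<n. \<Sum>c<n. if a = c then real M else 0)"
    using dvd by (intro sum.cong refl) (simp add: sum_cis_roots_of_unity[OF assms(2)] del: of_int_diff)
  also have "\<dots> = real M * real n" by simp
  finally show ?thesis .
qed

section \<open>Alternating sums of a logarithm, by Abel summation\<close>

lemma ln_norm_one_minus_cis_sums:
  assumes "0 < r" "r < 1"
  shows "(\<lambda>k. - 2 * (r ^ k / real k) * cos (real k * t)) sums ln ((cmod (1 - of_real r * cis t))^2)"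
proof -
  define z where "z = - (of_real r * cis t)"
  have nz: "norm z < 1" using assms by (simp add: z_def norm_mult)
  have ne: "1 + z \<noteq> 0" using nz by (metis add.inverse_inverse add_eq_0_iff norm_minus_cancel norm_one less_irrefl)
  have "(\<lambda>k. Re ((-1) ^ Suc k / of_nat k * z ^ k)) sums Re (Ln (1 + z))"
    by (rule sums_Re[OF Ln_series[OF nz]])
  also have "(\<lambda>k. Re ((-1) ^ Suc k / of_nat k * z ^ k)) = (\<lambda>k. - ((r ^ k / real k) * cos (real k * t)))"
  proof
    fix k
    have "(-1) ^ Suc k / of_nat k * z ^ k = - of_real (r ^ k / real k) * cis (real k * t)"
      unfolding z_def power_minus[of "of_real r * cis t"]
      using Complex.DeMoivre[of t k] by (simp add: power_mult_distrib)
    then show "Re ((-1) ^ Suc k / of_nat k * z ^ k) = - ((r ^ k / real k) * cos (real k * t))"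
      by (simp only:) simp
  qed
  finally have "(\<lambda>k. 2 * - ((r ^ k / real k) * cos (real k * t))) sums (2 * Re (Ln (1 + z)))"
    by (rule sums_mult)
  moreover have "2 * Re (Ln (1 + z)) = ln ((cmod (1 - of_real r * cis t))^2)"
    using ne by (simp add: z_def ln_realpow)
  ultimately show ?thesis by (simp add: mult_ac)
qed

lemma tendsto_ln_norm_one_minus_cis:
  assumes "cos t \<noteq> 1"
  shows "((\<lambda>r. ln ((cmod (1 - of_real r * cis t))^2)) \<longlongrightarrow> ln (2 * (1 - cos t))) (at_left 1)"
proof -
  have "((\<lambda>r. (cmod (1 - of_real r * cis t))^2) \<longlongrightarrow> (cmod (1 - of_real 1 * cis t))^2) (at_left 1)"
    by (intro tendsto_intros)
  then have "((\<lambda>r. (cmod (1 - of_real r * cis t))^2) \<longlongrightarrow> 2 * (1 - cos t)) (at_left 1)"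
    by (simp add: norm_one_minus_cis)
  then show ?thesis using assms by (intro tendsto_ln) auto
qed

text \<open>Summation by parts: the second difference is moved from \<^term>\<open>f\<close> to \<^term>\<open>a\<close>.\<close>

lemma sums_second_difference_ge:
  fixes a f :: "nat \<Rightarrow> real"
  assumes a: "summable (\<lambda>k. \<bar>a k\<bar>)" "a 0 = 0"
    and f: "\<And>k. 0 \<le> f k" "\<And>k. f k \<le> B" "f 0 = 0" "f 1 = 0"
    and convex: "\<And>k. 2 \<le> k \<Longrightarrow> 2 * a k \<le> a (k - 1) + a (k + 1)"
    and S: "(\<lambda>k. - 2 * a k * f k + a k * f (k + 1) + a k * f (k - 1)) sums s"
    and k0: "2 \<le> k0"
  shows "f k0 * (a (k0 - 1) + a (k0 + 1) - 2 * a k0) \<le> s"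
proof -
  have summ: "summable (\<lambda>k. a k * g k)" if "\<And>k. 0 \<le> g k" "\<And>k. g k \<le> B" for g :: "nat \<Rightarrow> real"
  proof (rule summable_comparison_test'[where N = 0])
    show "summable (\<lambda>k. \<bar>a k\<bar> * B)" by (rule summable_mult2[OF a(1)])
    show "norm (a k * g k) \<le> \<bar>a k\<bar> * B" for k
      using that[of k] by (simp add: abs_mult mult_left_mono)
  qed
  have s1: "(\<lambda>k. a k * f k) sums (\<Sum>k. a k * f k)"
    by (rule summable_sums[OF summ]) (use f in auto)
  have s2: "(\<lambda>k. a k * f (k + 1)) sums (\<Sum>k. a k * f (k + 1))"
    by (rule summable_sums[OF summ]) (use f in auto)
  have s3: "(\<lambda>k. a k * f (k - 1)) sums (\<Sum>k. a k * f (k - 1))"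
    by (rule summable_sums[OF summ]) (use f in auto)
  have "(\<lambda>k. - 2 * (a k * f k) + a k * f (k + 1) + a k * f (k - 1)) sums
      (- 2 * (\<Sum>k. a k * f k) + (\<Sum>k. a k * f (k + 1)) + (\<Sum>k. a k * f (k - 1)))"
    by (intro sums_add sums_mult s1 s2 s3)
  then have s: "s = - 2 * (\<Sum>k. a k * f k) + (\<Sum>k. a k * f (k + 1)) + (\<Sum>k. a k * f (k - 1))"
    using S sums_unique2 by (simp add: mult.assoc) blast
  have t2: "(\<lambda>k. a (k - 1) * f k) sums (\<Sum>k. a k * f (k + 1))"
    using s2 sums_Suc_iff[of "\<lambda>k. a (k - 1) * f k" "\<Sum>k. a k * f (k + 1)"] f(3) by simp
  have t3: "(\<lambda>k. a (k + 1) * f k) sums (\<Sum>k. a k * f (k - 1))"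
    using s3 sums_Suc_iff[of "\<lambda>k. a k * f (k - 1)" "\<Sum>k. a k * f (k - 1)"] a(2) by simp
  have "(\<lambda>k. - 2 * (a k * f k) + a (k - 1) * f k + a (k + 1) * f k) sums s"
    unfolding s by (intro sums_add sums_mult s1 t2 t3)
  then have T: "(\<lambda>k. f k * (a (k - 1) + a (k + 1) - 2 * a k)) sums s"
    by (simp add: algebra_simps)
  have "f k * (a (k - 1) + a (k + 1) - 2 * a k) \<ge> 0" for k
  proof (cases "k \<ge> 2")
    case True
    then show ?thesis using convex[of k] f(1)[of k] by simp
  next
    case False
    \<comment> \<open>Convexity is assumed only from index 2 on. For \<open>r ^ k / real k\<close>
      it fails at index 1, because the value at 0 is 0; there \<open>f\<close> vanishes.\<close>
    then have "k = 0 \<or> k = 1" by auto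
    then show ?thesis using f(3,4) by auto
  qed
  \<comment> \<open>All terms being nonnegative, the single term at \<open>k0\<close> is a lower
    bound for the series.\<close>
  then have "(\<Sum>k\<in>{k0}. f k * (a (k - 1) + a (k + 1) - 2 * a k)) \<le> s"
    using sum_le_suminf[OF sums_summable[OF T], of "{k0}"] sums_unique[OF T] by simp
  then show ?thesis by simp
qed

lemma power_div_convex:
  assumes "0 < r" "2 \<le> (k::nat)"
  shows "2 * (r ^ k / real k) \<le> r ^ (k - 1) / real (k - 1) + r ^ (k + 1) / real (k + 1)"
proof -
  obtain l where k: "k = Suc l" "l > 0" using assms(2) by (cases k) auto
  let ?q = "((real l + 1) * ((real l + 2) + r^2 * real l) - 2 * r * (real l * (real l + 2)))"
  have "0 \<le> (real l + 1) * ((real l + 2) + r^2 * real l) - 2 * r * (real l * (real l + 2))"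
  proof -
    \<comment> \<open>The factor \<open>l + 1\<close> makes it possible to complete the square in
      \<open>r\<close>.\<close>
    have "(real l + 1) * ?q
        = real l * ((real l + 1) * r - (real l + 2))^2 + (real l + 2)"
      by (simp add: algebra_simps power2_eq_square)
    also have "\<dots> \<ge> 0" by simp
    finally show ?thesis by (simp add: zero_le_mult_iff)
  qed
  then have "0 \<le> r ^ l * ?q"
    using assms(1) by simp
  then have "0 \<le> r ^ l * ?q / (real l * (real l + 1) * (real l + 2))"
    by simp
  also have "\<dots> = r ^ l / real l + r ^ l * r^2 / (real l + 2) - 2 * (r ^ l * r / (real l + 1))"
  proof -
    have frac: "P * ((x + 1) * ((x + 2) + r^2 * x) - 2 * r * (x * (x + 2))) / (x * (x + 1) * (x + 2))
        = P / x + P * r^2 / (x + 2) - 2 * (P * r / (x + 1))" if "x > 0" for P x :: real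
    proof -
      have "x \<noteq> 0" "x + 1 \<noteq> 0" "x + 2 \<noteq> 0" using that by auto
      then show ?thesis by (simp add: divide_simps) (simp add: algebra_simps power2_eq_square)
    qed
    show ?thesis by (rule frac) (use k(2) in simp)
  qed
  finally show ?thesis by (simp add: k power_add power2_eq_square ac_simps)
qed

lemma alt_sum_sums:
  assumes "\<And>t. (\<lambda>k. f k t) sums g t"
  shows "(\<lambda>k. alt_sum N (f k)) sums alt_sum N g"
  unfolding alt_sum_def by (intro sums_sum sums_mult assms)

text \<open>In the logarithm series, the alternating sum of the k-th product of cosines is
  \<open>f k\<close>, which is nonzero only if k + m or k - m is an odd multiple of N; the factor
  \<open>1 - cos t\<close> turns \<open>f\<close> into its second difference, up to a constant.
  Summation by parts leaves the convex sequence r^k / k. The first index seen is k = N - |m|, and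
  its term alone gives the bound.\<close>

lemma alt_sum_abel_ge:
  fixes m :: int
  assumes m: "\<bar>m\<bar> + 1 < int N" and r: "0 < r" "r < 1"
  shows "N * (r ^ (N - nat \<bar>m\<bar> - 1) / real (N - nat \<bar>m\<bar> - 1) + r ^ (N - nat \<bar>m\<bar> + 1) / real (N - nat \<bar>m\<bar> + 1)
            - 2 * (r ^ (N - nat \<bar>m\<bar>) / real (N - nat \<bar>m\<bar>)))
     \<le> alt_sum N (\<lambda>t. cos (of_int m * t) * (1 - cos t) * ln ((cmod (1 - of_real r * cis t))^2))"
proof -
  let ?g = "(\<lambda>t. cos (of_int m * t) * (1 - cos t) * ln ((cmod (1 - of_real r * cis t))^2))"
  define \<delta> where "\<delta> q = alt_sum N (\<lambda>t. cos (of_int q * t))" for q :: int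
  have N: "N > 0" using m by auto
  have \<delta>: "\<delta> q = (if int (2 * N) dvd q + int N then 2 * real N else 0)" for q
    unfolding \<delta>_def by (rule alt_sum_cos[OF N])
  have \<delta>0: "\<delta> q = 0" if "\<bar>q\<bar> < int N" for q
    using alt_sum_low_degree[of q 0 N] that by (simp add: \<delta>_def)
  define f where "f k = (\<delta> (int k + m) + \<delta> (int k - m)) / 2" for k
  define a where "a k = r ^ k / real k" for k
  define k0 where "k0 = N - nat \<bar>m\<bar>"
  have term_eq: "alt_sum N (\<lambda>t. cos (of_int m * t) * (1 - cos t) * (- 2 * (r ^ k / real k) * cos (real k * t)))
      = - 2 * a k * f k + a k * f (k + 1) + a k * f (k - 1)" for k
  \<comment> \<open>At k = 0 the natural-number difference \<open>k - 1\<close> truncates, but there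
    \<open>a 0\<close> is 1 / 0 = 0.\<close>
  proof (cases "k = 0")
    case True
    then show ?thesis by (simp add: a_def alt_sum_def)
  next
    case False
    have pr: "cos (of_int m * t) * (1 - cos t) * cos (real k * t)
        = (1/2) * (cos (of_int (int k + m) * t) * (1 - cos t) + cos (of_int (int k - m) * t) * (1 - cos t))" for t
      by (simp add: distrib_right left_diff_distrib cos_add cos_diff field_simps)
    have d: "alt_sum N (\<lambda>t. cos (of_int q * t) * (1 - cos t)) = \<delta> q - (1/2) * \<delta> (q + 1) - (1/2) * \<delta> (q - 1)" for q
      using alt_sum_diff[of N "\<lambda>t. cos (of_int q * t) - (1/2) * cos (of_int (q + 1) * t)"
          "\<lambda>t. (1/2) * cos (of_int (q - 1) * t)"]
        alt_sum_diff[of N "\<lambda>t. cos (of_int q * t)" "\<lambda>t. (1/2) * cos (of_int (q + 1) * t)"]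
      unfolding alt_sum_cmult \<delta>_def cos_mult_one_minus_cos by simp
    have "alt_sum N (\<lambda>t. cos (of_int m * t) * (1 - cos t) * (- 2 * (r ^ k / real k) * cos (real k * t)))
        = alt_sum N (\<lambda>t. (- a k) * (cos (of_int (int k + m) * t) * (1 - cos t) + cos (of_int (int k - m) * t) * (1 - cos t)))"
    proof (rule arg_cong[where f = "alt_sum N"], rule ext)
      fix t
      have "cos (of_int m * t) * (1 - cos t) * (- 2 * (r ^ k / real k) * cos (real k * t))
          = (- 2 * a k) * (cos (of_int m * t) * (1 - cos t) * cos (real k * t))"
        by (simp add: a_def)
      then show "cos (of_int m * t) * (1 - cos t) * (- 2 * (r ^ k / real k) * cos (real k * t))
          = (- a k) * (cos (of_int (int k + m) * t) * (1 - cos t) + cos (of_int (int k - m) * t) * (1 - cos t))"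
        unfolding pr by simp
    qed
    also have "\<dots> = - a k * (\<delta> (int k + m) - (1/2) * \<delta> (int k + m + 1) - (1/2) * \<delta> (int k + m - 1)
          + (\<delta> (int k - m) - (1/2) * \<delta> (int k - m + 1) - (1/2) * \<delta> (int k - m - 1)))"
      unfolding alt_sum_cmult alt_sum_add d ..
    also have "\<dots> = - 2 * a k * f k + a k * f (k + 1) + a k * f (k - 1)"
    proof -
      have "f (k + 1) = (\<delta> (int k + m + 1) + \<delta> (int k - m + 1)) / 2"
        unfolding f_def by (simp add: algebra_simps)
      moreover have "f (k - 1) = (\<delta> (int k + m - 1) + \<delta> (int k - m - 1)) / 2"
        unfolding f_def using False by (simp add: of_nat_diff algebra_simps)
      ultimately show ?thesis unfolding f_def[of k] by (simp only:) (simp add: field_simps)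
    qed
    finally show ?thesis .
  qed
  have S: "(\<lambda>k. - 2 * a k * f k + a k * f (k + 1) + a k * f (k - 1)) sums
      alt_sum N ?g"
    unfolding term_eq[symmetric]
    by (rule alt_sum_sums) (intro sums_mult ln_norm_one_minus_cis_sums r)
  have "f k0 * (a (k0 - 1) + a (k0 + 1) - 2 * a k0)
      \<le> alt_sum N ?g"
  proof (rule sums_second_difference_ge[OF _ _ _ _ _ _ _ S])
    have "summable (\<lambda>k. r ^ k)" using r by (intro summable_geometric) auto
    moreover have "norm \<bar>a k\<bar> \<le> r ^ k" for k
    proof -
      have "r ^ k / real k \<le> r ^ k"
      proof (cases k)
        case (Suc l)
        have "0 \<le> r ^ k * real l" using r by simp
        then show ?thesis by (simp add: Suc divide_le_eq algebra_simps)
      qed (use r in simp)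
      then show ?thesis using r by (simp add: a_def)
    qed
    ultimately show "summable (\<lambda>k. \<bar>a k\<bar>)"
      by (rule summable_comparison_test'[where N = 0])
    show "f k \<le> 2 * N" "0 \<le> f k" for k by (auto simp: f_def \<delta>)
    show "f 0 = 0" unfolding f_def using m by (subst \<delta>0, simp)+ simp
    show "f 1 = 0" unfolding f_def using m by (subst \<delta>0, simp)+ simp
    show "2 * a k \<le> a (k - 1) + a (k + 1)" if "2 \<le> k" for k
      unfolding a_def using power_div_convex[OF r(1) that] .
  qed (use m in \<open>auto simp: a_def k0_def\<close>)
  moreover have "real N \<le> f k0"
  proof -
    have "\<delta> (int k0 + m) = 2 * N \<or> \<delta> (int k0 - m) = 2 * N"
      unfolding \<delta> k0_def using m by (cases "m \<ge> 0") auto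
    then show ?thesis by (auto simp: f_def \<delta>)
  qed
  moreover have "0 \<le> a (k0 - 1) + a (k0 + 1) - 2 * a k0"
    using power_div_convex[OF r(1), of k0] m by (simp add: a_def k0_def)
  ultimately have "N * (a (k0 - 1) + a (k0 + 1) - 2 * a k0)
      \<le> alt_sum N ?g"
    by (meson mult_right_mono order_trans)
  then show ?thesis unfolding a_def k0_def .
qed

text \<open>Limit r -> 1 of the previous bound; the radius below 1 was there to make the
  coefficients absolutely summable. The second difference of 1 / k at N - |m| is at least 2 / N^3.
  What matters is that the bound is positive and the same for every \<open>m\<close>: it can be
  added up over all frequencies of the squared kernel without cancellation.\<close>

lemma alt_sum_cos_ln_ge:
  fixes m :: int
  assumes m: "\<bar>m\<bar> + 1 < int N"
  shows "2 / (real N)^2 \<le> alt_sum N (\<lambda>t. cos (of_int m * t) * (1 - cos t) * ln (2 * (1 - cos t)))"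
proof -
  let ?g = "(\<lambda>t. cos (of_int m * t) * (1 - cos t) * ln (2 * (1 - cos t)))"
  define k0 where "k0 = N - nat \<bar>m\<bar>"
  have k0: "2 \<le> k0" "k0 \<le> N" using m by (auto simp: k0_def)
  let ?c = "\<lambda>r. N * (r ^ (k0 - 1) / real (k0 - 1) + r ^ (k0 + 1) / real (k0 + 1) - 2 * (r ^ k0 / real k0))"
  have "?c 1 \<le> alt_sum N ?g"
  proof (rule tendsto_le)
    show "at_left (1::real) \<noteq> bot" by simp
    show "(?c \<longlongrightarrow> ?c 1) (at_left 1)" using k0(1) by (intro tendsto_intros) auto
    show "((\<lambda>r. alt_sum N (\<lambda>t. cos (of_int m * t) * (1 - cos t) * ln ((cmod (1 - of_real r * cis t))^2)))
        \<longlongrightarrow> alt_sum N ?g) (at_left 1)"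
      unfolding alt_sum_def
    proof (rule tendsto_sum, rule tendsto_mult[OF tendsto_const])
      fix j
      define t where "t = pi * real j / real N"
      have "((\<lambda>r. cos (of_int m * t) * (1 - cos t) * ln ((cmod (1 - of_real r * cis t))^2))
          \<longlongrightarrow> cos (of_int m * t) * (1 - cos t) * ln (2 * (1 - cos t))) (at_left 1)"
      proof (cases "cos t = 1")
        case False
        then show ?thesis
          by (intro tendsto_mult_left tendsto_ln_norm_one_minus_cis)
      qed simp
      then show "((\<lambda>r. cos (of_int m * (pi * real j / real N)) * (1 - cos (pi * real j / real N))
            * ln ((cmod (1 - of_real r * cis (pi * real j / real N)))^2))
          \<longlongrightarrow> cos (of_int m * (pi * real j / real N)) * (1 - cos (pi * real j / real N))
            * ln (2 * (1 - cos (pi * real j / real N)))) (at_left 1)"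
        unfolding t_def .
    qed
    have "eventually (\<lambda>r. r \<in> {0<..<1}) (at_left (1::real))"
      by (rule eventually_at_left_real) simp
    then show "\<forall>\<^sub>F r in at_left 1. ?c r
        \<le> alt_sum N (\<lambda>t. cos (of_int m * t) * (1 - cos t) * ln ((cmod (1 - of_real r * cis t))^2))"
      by eventually_elim (use alt_sum_abel_ge[OF m] in \<open>simp add: k0_def\<close>)
  qed
  moreover have "2 / (real N)^2 \<le> ?c 1"
  proof -
    obtain l where l: "k0 = Suc l" "l \<ge> 1" using k0 by (cases k0) auto
    have "1 / real l + 1 / (real l + 2) - 2 / (real l + 1) = 2 / (real l * (real l + 1) * (real l + 2))"
    proof -
      have "real l \<noteq> 0" "real l + 1 \<noteq> 0" "real l + 2 \<noteq> 0" using l by auto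
      then show ?thesis by (simp add: divide_simps) (simp add: algebra_simps)
    qed
    also have "\<dots> \<ge> 2 / (real N) ^ 3"
    proof -
      have "real l * (real l + 2) \<le> (real l + 1)^2" by (simp add: power2_eq_square algebra_simps)
      then have "real l * (real l + 2) * (real l + 1) \<le> (real l + 1)^2 * (real l + 1)"
        by (intro mult_right_mono) auto
      also have "\<dots> = real k0 ^ 3" by (simp add: l power2_eq_square power3_eq_cube algebra_simps)
      also have "\<dots> \<le> real N ^ 3" using k0 by (intro power_mono) auto
      finally have "real l * (real l + 1) * (real l + 2) \<le> real N ^ 3" by (simp add: mult_ac)
      then show ?thesis using l k0 by (intro divide_left_mono mult_pos_pos) (auto simp: add_pos_pos)
    qed
    finally have "N * (2 / (real N) ^ 3) \<le> N * (1 / real l + 1 / (real l + 2) - 2 / (real l + 1))"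
      by (intro mult_left_mono) auto
    moreover have "N * (2 / (real N) ^ 3) = 2 / (real N)^2"
      using k0 by (simp add: power2_eq_square power3_eq_cube)
    ultimately show ?thesis by (simp add: l add.commute)
  qed
  ultimately show ?thesis by linarith
qed

section \<open>Moment matching\<close>

lemma alt_sum_fejer_power2_mult:
  "alt_sum N (\<lambda>t. (fejer n t)^2 * f t) = (\<Sum>a<n. \<Sum>b<n. \<Sum>c<n. \<Sum>e<n.
      alt_sum N (\<lambda>t. cos (of_int (int a + int b - int c - int e) * t) * f t))"
  unfolding fejer_power2_eq_sum sum_distrib_right alt_sum_sum ..

text \<open>The squared kernel has frequencies up to 2 n - 2, so the total degree 2 n - 2 + k stays
  below N.\<close>

lemma alt_sum_fejer_low_degree:
  assumes "2 * n + k < N + 2"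
  shows "alt_sum N (\<lambda>t. (fejer n t)^2 * (1 - cos t) ^ k) = 0"
  unfolding alt_sum_fejer_power2_mult
  by (intro sum.neutral ballI alt_sum_low_degree) (use assms in auto)

lemma alt_sum_fejer_ln_ge:
  assumes "2 * n < N + 1"
  shows "2 * real n ^ 4 / (real N)^2 \<le> alt_sum N (\<lambda>t. (fejer n t)^2 * ((1 - cos t) * ln (2 * (1 - cos t))))"
proof -
  have "(\<Sum>a<n. \<Sum>b<n. \<Sum>c<n. \<Sum>e<n. 2 / (real N)^2)
      \<le> (\<Sum>a<n. \<Sum>b<n. \<Sum>c<n. \<Sum>e<n.
          alt_sum N (\<lambda>t. cos (of_int (int a + int b - int c - int e) * t) * ((1 - cos t) * ln (2 * (1 - cos t)))))"
    unfolding mult.assoc[symmetric]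
    by (intro sum_mono alt_sum_cos_ln_ge) (use assms in auto)
  then show ?thesis
    unfolding alt_sum_fejer_power2_mult by (simp add: power4_eq_xxxx mult_ac)
qed

text \<open>Only even nodes are counted. The odd nodes have the same mass as soon as the alternating
  sum of the squared kernel vanishes, so this one constant normalises both laws.\<close>

definition fejer_mass :: "nat \<Rightarrow> nat \<Rightarrow> real" where
  "fejer_mass n N = (\<Sum>j<2 * N. if even j then (fejer n (pi * real j / real N))^2 else 0)"

definition even_weight :: "nat \<Rightarrow> nat \<Rightarrow> nat \<Rightarrow> real" where
  "even_weight n N j = (if even j then (fejer n (pi * real j / real N))^2 / fejer_mass n N else 0)"

definition odd_weight :: "nat \<Rightarrow> nat \<Rightarrow> nat \<Rightarrow> real" where
  "odd_weight n N j = (if odd j then (fejer n (pi * real j / real N))^2 / fejer_mass n N else 0)"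

lemma weight_diff_eq_alt_sum:
  "(\<Sum>j<2 * N. even_weight n N j * f (pi * real j / real N)) - (\<Sum>j<2 * N. odd_weight n N j * f (pi * real j / real N))
   = alt_sum N (\<lambda>t. (fejer n t)^2 * f t) / fejer_mass n N"
  unfolding alt_sum_def sum_divide_distrib sum_subtractf[symmetric]
  by (rule sum.cong) (auto simp: even_weight_def odd_weight_def)

lemma sum_fejer_power2_mult_le:
  assumes "n \<le> 2 * N" "N > 0"
  shows "(\<Sum>j<2 * N. (fejer n (pi * real j / real N))^2) \<le> 2 * real N * real n ^ 3"
    and "(\<Sum>j<2 * N. (fejer n (pi * real j / real N))^2 * (1 - cos (pi * real j / real N))) \<le> 4 * real N * real n"
proof -
  let ?t = "\<lambda>j. pi * real j / real N"
  have S: "(\<Sum>j<2 * N. fejer n (?t j)) = 2 * real N * real n"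
    using sum_fejer[of n "2 * N"] assms by (simp add: mult_ac)
  have "(\<Sum>j<2 * N. (fejer n (?t j))^2) \<le> (\<Sum>j<2 * N. (real n)^2 * fejer n (?t j))"
    by (intro sum_mono) (simp add: power2_eq_square[of "fejer _ _"] mult_right_mono fejer_le fejer_nonneg)
  also have "\<dots> = 2 * real N * real n ^ 3"
    unfolding sum_distrib_left[symmetric] S by (simp add: power2_eq_square power3_eq_cube)
  finally show "(\<Sum>j<2 * N. (fejer n (?t j))^2) \<le> 2 * real N * real n ^ 3" .
  have "(\<Sum>j<2 * N. (fejer n (?t j))^2 * (1 - cos (?t j)))
      \<le> (\<Sum>j<2 * N. 2 * fejer n (?t j))"
  proof (rule sum_mono)
    fix j
    show "(fejer n (?t j))^2 * (1 - cos (?t j)) \<le> 2 * fejer n (?t j)"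
      using mult_left_mono[OF fejer_mult_le fejer_nonneg, of n "pi * real j / real N" n "pi * real j / real N"]
      by (simp add: power2_eq_square mult_ac)
  qed
  also have "\<dots> = 4 * real N * real n"
    unfolding sum_distrib_left[symmetric] S by simp
  finally show "(\<Sum>j<2 * N. (fejer n (?t j))^2 * (1 - cos (?t j))) \<le> 4 * real N * real n" .
qed

text \<open>The nodes form a Chebyshev grid; the
  concentration of the kernel at \<open>t = 0\<close> keeps the first moment of order \<open>b / n^2\<close>, which is also
  the order of the gap.\<close>

lemma moment_matching:
  assumes n: "n \<ge> 1" and b: "0 < b"
  obtains u v w :: "nat \<Rightarrow> real" where
    "prob_weight {..<8 * n} v" "prob_weight {..<8 * n} w"
    "\<And>j. 0 \<le> u j" "\<And>j. u j \<le> b"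
    "\<And>k. k \<le> 2 * n + 1 \<Longrightarrow> (\<Sum>j<8 * n. v j * u j ^ k) = (\<Sum>j<8 * n. w j * u j ^ k)"
    "(\<Sum>j<8 * n. v j * u j) \<le> 8 * b / (real n)^2"
    "b / (64 * (real n)^2) \<le> (\<Sum>j<8 * n. v j * (u j * ln (u j))) - (\<Sum>j<8 * n. w j * (u j * ln (u j)))"
proof -
  let ?h = "(\<lambda>t. (fejer n t)^2 * ((1 - cos t) * ln (2 * (1 - cos t))))"
  \<comment> \<open>With this N the degree condition 2 n + k < N + 2 reads k <= 2 n + 1, the number
    of moments claimed.\<close>
  define N where "N = 4 * n"
  let ?t = "\<lambda>j. pi * real j / real N"
  define Z where "Z = fejer_mass n N"
  define u where "u j = b * (1 - cos (?t j)) / 2" for j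
  define v where "v = even_weight n N"
  define w where "w = odd_weight n N"
  let ?V = "(\<Sum>j<8 * n. v j * (u j * ln (u j))) - (\<Sum>j<8 * n. w j * (u j * ln (u j)))"
  have N: "8 * n = 2 * N" "N > 0" "n \<le> 2 * N" using n by (auto simp: N_def)
  \<comment> \<open>The node t = 0 alone gives this; together with \<open>Zle\<close> it pins the
    mass to the order n^4, on which both the mean and the gap depend.\<close>
  have Zge: "real n ^ 4 \<le> Z"
  proof -
    have "(\<Sum>j\<in>{0}. if even j then (fejer n (?t j))^2 else 0) \<le> Z"
      unfolding Z_def fejer_mass_def by (rule sum_mono2) (use N in auto)
    then show ?thesis by (simp add: fejer_0)
  qed
  have Z0: "Z > 0" using Zge n by (smt (verit) of_nat_0_less_iff zero_less_power less_le_trans One_nat_def Suc_le_eq)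
  have diff: "(\<Sum>j<8 * n. v j * f (?t j)) - (\<Sum>j<8 * n. w j * f (?t j))
      = alt_sum N (\<lambda>t. (fejer n t)^2 * f t) / Z" for f
    using weight_diff_eq_alt_sum[of n N f] by (simp add: v_def w_def Z_def N(1))
  have moments: "(\<Sum>j<8 * n. v j * u j ^ k) = (\<Sum>j<8 * n. w j * u j ^ k)" if "k \<le> 2 * n + 1" for k
  proof -
    have "(\<Sum>j<8 * n. v j * u j ^ k) - (\<Sum>j<8 * n. w j * u j ^ k)
        = alt_sum N (\<lambda>t. (b / 2) ^ k * ((fejer n t)^2 * (1 - cos t) ^ k)) / Z"
      using diff[of "\<lambda>t. (b * (1 - cos t) / 2) ^ k"]
      by (simp add: u_def power_mult_distrib power_divide mult_ac)
    also have "\<dots> = 0"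
      unfolding alt_sum_cmult using alt_sum_fejer_low_degree[of n k N] that n by (simp add: N_def)
    finally show ?thesis by simp
  qed
  have v1: "sum v {..<8 * n} = 1"
  proof -
    have "sum v {..<8 * n} = (\<Sum>j<2 * N. if even j then (fejer n (?t j))^2 else 0) / Z"
      unfolding v_def N(1) sum_divide_distrib by (rule sum.cong) (auto simp: even_weight_def Z_def)
    then show ?thesis using Z0 by (simp add: Z_def fejer_mass_def)
  qed
  have w1: "sum w {..<8 * n} = 1"
    using moments[of 0] v1 by simp
  have nonneg: "0 \<le> v j" "0 \<le> w j" for j
    using Z0 by (auto simp: v_def w_def even_weight_def odd_weight_def Z_def)
  have mass: "v j + w j = (fejer n (?t j))^2 / Z" for j
    by (simp add: v_def w_def even_weight_def odd_weight_def Z_def)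
  have Zle: "Z \<le> 4 * real n ^ 4"
  proof -
    have "2 = (\<Sum>j<2 * N. v j + w j)"
      using v1 w1 by (simp add: sum.distrib N(1))
    also have "\<dots> = (\<Sum>j<2 * N. (fejer n (?t j))^2) / Z"
      by (simp add: mass sum_divide_distrib)
    also have "\<dots> \<le> (2 * real N * real n ^ 3) / Z"
      using sum_fejer_power2_mult_le(1)[OF N(3,2)] Z0 by (simp add: divide_right_mono)
    finally have "2 * Z \<le> 2 * real N * real n ^ 3" using Z0 by (simp add: field_simps)
    then show ?thesis by (simp add: N_def power4_eq_xxxx power3_eq_cube)
  qed
  have mu: "(\<Sum>j<8 * n. v j * u j) \<le> 8 * b / (real n)^2"
  proof -
    have "(\<Sum>j<8 * n. v j * u j) \<le> (\<Sum>j<2 * N. (fejer n (?t j))^2 / Z * u j)"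
      unfolding mass[symmetric] N(1)
      by (intro sum_mono mult_right_mono) (use nonneg b in \<open>auto simp: u_def\<close>)
    also have "\<dots> = (b / (2 * Z)) * (\<Sum>j<2 * N. (fejer n (?t j))^2 * (1 - cos (?t j)))"
      unfolding sum_distrib_left by (rule sum.cong) (auto simp: u_def mult_ac)
    also have "\<dots> \<le> (b / (2 * Z)) * (4 * real N * real n)"
      using sum_fejer_power2_mult_le(2)[OF N(3,2)] Z0 b by (intro mult_left_mono) auto
    also have "\<dots> = 8 * b * (real n)^2 / Z"
      by (simp add: N_def power2_eq_square)
    also have "\<dots> \<le> 8 * b * (real n)^2 / real n ^ 4"
      using Zge Z0 n b by (intro divide_left_mono mult_pos_pos) auto
    also have "\<dots> = 8 * b / (real n)^2"
      using n by (simp add: power2_eq_square power4_eq_xxxx)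
    finally show ?thesis .
  qed
  have gap: "b / (64 * (real n)^2) \<le> ?V"
  proof -
    \<comment> \<open>Rescaling the nodes by \<open>b\<close> only adds a multiple of
      \<open>y\<close> to \<open>y * ln (2 * y)\<close>. The matched first moments cancel it, so
      \<open>b\<close> enters the gap as a mere factor.\<close>
    have split: "x * ln x = (b / 2) * (y * ln (2 * y)) + (b / 2 * (ln b - ln 4)) * y"
      if xy: "x = b * y / 2" "0 \<le> y" for x y :: real
    proof (cases "y = 0")
      case False
      have "x = b * (2 * y) / 4" using xy by simp
      then have "ln x = ln (b * (2 * y) / 4)" by (rule arg_cong)
      also have "\<dots> = ln (b * (2 * y)) - ln 4" using xy False b by (intro ln_divide_pos) auto
      also have "ln (b * (2 * y)) = ln b + ln (2 * y)" using xy False b by (intro ln_mult_pos) auto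
      finally show ?thesis by (simp only: xy) (simp add: field_simps)
    qed (use xy in simp)
    have pos: "0 \<le> 1 - cos t" for t :: real by simp
    have "?V
        = alt_sum N (\<lambda>t. (fejer n t)^2 * (b * (1 - cos t) / 2 * ln (b * (1 - cos t) / 2))) / Z"
      using diff[of "\<lambda>t. b * (1 - cos t) / 2 * ln (b * (1 - cos t) / 2)"] by (simp add: u_def)
    also have "alt_sum N (\<lambda>t. (fejer n t)^2 * (b * (1 - cos t) / 2 * ln (b * (1 - cos t) / 2)))
        = alt_sum N (\<lambda>t. (b / 2) * ((fejer n t)^2 * ((1 - cos t) * ln (2 * (1 - cos t))))
            + (b / 2 * (ln b - ln 4)) * ((fejer n t)^2 * (1 - cos t) ^ 1))"
      by (rule arg_cong[where f = "alt_sum N"], rule ext,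
          simp only: split[OF refl pos] power_one_right distrib_left mult_ac)
    also have "\<dots> = (b / 2) * alt_sum N ?h"
      unfolding alt_sum_add alt_sum_cmult using alt_sum_fejer_low_degree[of n 1 N] n by (simp add: N_def)
    finally have eq: "?V
        = (b / 2) * alt_sum N ?h / Z" .
    have "b / (64 * (real n)^2) = (b / 2) * ((real n)^2 / 8) / (4 * real n ^ 4)"
      using n by (simp add: power2_eq_square power4_eq_xxxx)
    also have "\<dots> \<le> (b / 2) * ((real n)^2 / 8) / Z"
      using Zle Z0 b n by (intro divide_left_mono mult_pos_pos) auto
    also have "\<dots> \<le> (b / 2) * alt_sum N ?h / Z"
    proof (intro divide_right_mono mult_left_mono)
      have "(real n)^2 / 8 = 2 * real n ^ 4 / (real N)^2"
        using n by (simp add: N_def power2_eq_square power4_eq_xxxx)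
      also have "\<dots> \<le> alt_sum N ?h"
        by (rule alt_sum_fejer_ln_ge) (use n in \<open>simp add: N_def\<close>)
      finally show "(real n)^2 / 8 \<le> alt_sum N ?h" .
    qed (use b Z0 in auto)
    finally show ?thesis unfolding eq .
  qed
  show ?thesis
  proof (rule that[of v w u])
    show "prob_weight {..<8 * n} v" "prob_weight {..<8 * n} w"
      using v1 w1 nonneg by (auto simp: prob_weight_def)
    show "0 \<le> u j" "u j \<le> b" for j
    proof -
      have "- 1 \<le> cos (?t j)" by (rule cos_ge_minus_one)
      then have "b * (1 - cos (?t j)) \<le> b * 2"
        using b by (intro mult_left_mono) auto
      then show "u j \<le> b" by (simp add: u_def)
      show "0 \<le> u j" using b by (simp add: u_def)
    qed
  qed (use moments mu gap in auto)
qed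

section \<open>Entropy of stick breaking with independent fractions\<close>

definition binary_entropy :: "real \<Rightarrow> real" where
  "binary_entropy u = - (u * ln u) - (1 - u) * ln (1 - u)"

text \<open>This half of the binary entropy is \<open>u\<close> up to an error \<open>u^2\<close>,
  hence almost the same on average under two laws with equal means. The difference in entropy must
  come from \<open>u * ln u\<close>.\<close>

lemma one_minus_ln_bounds:
  fixes u :: real
  assumes "0 \<le> u" "u < 1"
  shows "u - u^2 \<le> - ((1 - u) * ln (1 - u))" "- ((1 - u) * ln (1 - u)) \<le> u"
proof -
  have "ln (1 - u) \<le> - u" using ln_le_minus_one[of "1 - u"] assms by simp
  then have "(1 - u) * ln (1 - u) \<le> (1 - u) * (- u)" using assms by (intro mult_left_mono) auto
  then show "u - u^2 \<le> - ((1 - u) * ln (1 - u))" by (simp add: power2_eq_square algebra_simps)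
  have "- ln (1 - u) = ln (1 / (1 - u))" using assms by (simp add: ln_div)
  also have "\<dots> \<le> 1 / (1 - u) - 1" using assms by (intro ln_le_minus_one) auto
  also have "\<dots> = u / (1 - u)" using assms by (simp add: field_simps)
  finally have "(1 - u) * (- ln (1 - u)) \<le> (1 - u) * (u / (1 - u))"
    using assms by (intro mult_left_mono) auto
  then show "- ((1 - u) * ln (1 - u)) \<le> u" using assms by simp
qed

lemma binary_entropy_nonneg:
  assumes "0 \<le> u" "u < 1"
  shows "0 \<le> binary_entropy u"
proof -
  have "u * ln u \<le> 0" using assms by (cases "u = 0") (auto simp: mult_le_0_iff)
  moreover have "(1 - u) * ln (1 - u) \<le> 0" using assms by (intro mult_nonneg_nonpos) auto
  ultimately show ?thesis by (simp add: binary_entropy_def)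
qed

text \<open>Writing u = x^4, the logarithm costs a single factor x and the entropy is at most 5 x^3.
  The form \<open>u * sqrt u\<close> matters later: under a law on [0, b] the second moment of the
  entropy is then at most a multiple of sqrt b times the mean of \<open>u\<close>, which carries the
  factor 1 / n^2.\<close>

lemma binary_entropy_power2_le:
  assumes "0 \<le> u" "u < 1"
  shows "(binary_entropy u)^2 \<le> 25 * (u * sqrt u)"
proof (cases "u = 0")
  case False
  define x where "x = sqrt (sqrt u)"
  have x: "0 < x" "x \<le> 1" using False assms by (auto simp: x_def)
  have ux: "u = x ^ 4" using assms power_mult[of x 2 2] by (simp add: x_def)
  have "- ln u = 4 * ln (1 / x)" using x by (simp add: ux ln_realpow ln_div)
  also have "\<dots> \<le> 4 * (1 / x)" using ln_le_minus_one[of "1 / x"] x by simp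
  finally have "u * (- ln u) \<le> u * (4 * (1 / x))" using assms by (intro mult_left_mono) auto
  also have "\<dots> = 4 * x ^ 3" using x by (simp add: ux power4_eq_xxxx power3_eq_cube)
  finally have 1: "- (u * ln u) \<le> 4 * x ^ 3" by simp
  have "- ((1 - u) * ln (1 - u)) \<le> u" by (rule one_minus_ln_bounds) fact+
  also have "\<dots> \<le> x ^ 3" unfolding ux using x by (intro power_decreasing) auto
  finally have "binary_entropy u \<le> 5 * x ^ 3" using 1 by (simp add: binary_entropy_def)
  then have "(binary_entropy u)^2 \<le> (5 * x ^ 3)^2"
    using binary_entropy_nonneg[OF assms] by (intro power_mono) auto
  also have "\<dots> = 25 * (u * x^2)"
    by (simp add: ux power_mult_distrib power2_eq_square power3_eq_cube power4_eq_xxxx)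
  also have "x^2 = sqrt u" using assms by (simp add: x_def)
  finally show ?thesis .
qed (simp add: binary_entropy_def)

primrec chain_entropy :: "(nat \<Rightarrow> real) \<Rightarrow> nat \<Rightarrow> real" where
  "chain_entropy u 0 = 0"
| "chain_entropy u (Suc n) = binary_entropy (u n) + (1 - u n) * chain_entropy u n"

lemma chain_entropy_cong:
  "(\<And>i. i < n \<Longrightarrow> u i = v i) \<Longrightarrow> chain_entropy u n = chain_entropy v n"
  by (induction n) auto

lemma chain_entropy_upd:
  "chain_entropy (\<lambda>i. g (if i = n then a else x i)) n = chain_entropy (\<lambda>i. g (x i)) n"
  by (rule chain_entropy_cong) auto

definition chain_mean :: "'a set \<Rightarrow> ('a \<Rightarrow> real) \<Rightarrow> ('a \<Rightarrow> real) \<Rightarrow> nat \<Rightarrow> real" where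
  "chain_mean A w g n = prod_expect A w n (\<lambda>x. chain_entropy (\<lambda>i. g (x i)) n)"

lemma chain_mean_Suc:
  assumes "prob_weight A w"
  shows "chain_mean A w g (Suc n)
    = (\<Sum>a\<in>A. w a * binary_entropy (g a)) + (1 - (\<Sum>a\<in>A. w a * g a)) * chain_mean A w g n"
proof -
  have "chain_mean A w g (Suc n) = (\<Sum>a\<in>A. w a * (binary_entropy (g a) + (1 - g a) * chain_mean A w g n))"
    by (simp add: chain_mean_def chain_entropy_upd prod_expect_add prod_expect_cmult prod_expect_const[OF assms] distrib_left sum.distrib)
  also have "\<dots> = (\<Sum>a\<in>A. w a * binary_entropy (g a)) + ((\<Sum>a\<in>A. w a) - (\<Sum>a\<in>A. w a * g a)) * chain_mean A w g n"
    by (simp add: algebra_simps sum.distrib sum_subtractf sum_distrib_left sum_distrib_right)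
  finally show ?thesis using assms by (simp add: prob_weight_def)
qed

lemma chain_mean_0: "chain_mean A w g 0 = 0"
  by (simp add: chain_mean_def)

text \<open>Both means obey the same affine recursion with slope 1 - \<mu>. Every step contributes a
  fresh \<delta> and shrinks what was collected before by 1 - \<mu>.\<close>

lemma chain_mean_gap:
  assumes v: "prob_weight A v" and w: "prob_weight A w"
    and \<mu>: "(\<Sum>a\<in>A. v a * g a) = \<mu>" "(\<Sum>a\<in>A. w a * g a) = \<mu>" "0 \<le> \<mu>" "\<mu> \<le> 1"
    and gap: "\<delta> \<le> (\<Sum>a\<in>A. w a * binary_entropy (g a)) - (\<Sum>a\<in>A. v a * binary_entropy (g a))" "0 \<le> \<delta>"
  shows "n * \<delta> * (1 - \<mu>) ^ n \<le> chain_mean A w g n - chain_mean A v g n"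
proof (induction n)
  case (Suc n)
  have "real (Suc n) * \<delta> * (1 - \<mu>) ^ Suc n = (1 - \<mu>) * (n * \<delta> * (1 - \<mu>) ^ n) + \<delta> * (1 - \<mu>) ^ Suc n"
    by (simp add: algebra_simps)
  also have "\<dots> \<le> (1 - \<mu>) * (chain_mean A w g n - chain_mean A v g n) + \<delta> * 1"
    using Suc \<mu> gap(2) by (intro add_mono mult_left_mono power_le_one) auto
  also have "\<dots> \<le> chain_mean A w g (Suc n) - chain_mean A v g (Suc n)"
    unfolding chain_mean_Suc[OF v] chain_mean_Suc[OF w] \<mu> using gap(1) by (simp add: algebra_simps)
  finally show ?case .
qed (simp add: chain_mean_0)

lemma weighted_mean_power2_le:
  assumes "prob_weight A w"
  shows "(\<Sum>a\<in>A. w a * f a)^2 \<le> (\<Sum>a\<in>A. w a * (f a)^2)"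
    and "(\<Sum>a\<in>A. w a * (f a - (\<Sum>a\<in>A. w a * f a))^2) \<le> (\<Sum>a\<in>A. w a * (f a)^2)"
proof -
  let ?S = "(\<Sum>a\<in>A. w a * (f a)^2)"
  define m where "m = (\<Sum>a\<in>A. w a * f a)"
  let ?V = "(\<Sum>a\<in>A. w a * (f a - m)^2)"
  have w: "sum w A = 1" "\<And>a. a \<in> A \<Longrightarrow> 0 \<le> w a" using assms by (auto simp: prob_weight_def)
  have "?V = (\<Sum>a\<in>A. w a * (f a)^2 - 2 * m * (w a * f a) + m^2 * w a)"
    by (rule sum.cong) (auto simp: power2_eq_square algebra_simps)
  also have "\<dots> = ?S - m^2"
    unfolding sum.distrib sum_subtractf sum_distrib_left[symmetric] w m_def[symmetric]
    by (simp add: power2_eq_square)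
  finally have eq: "?V = ?S - m^2" .
  moreover have "0 \<le> ?V" using w by (intro sum_nonneg) auto
  ultimately show "(\<Sum>a\<in>A. w a * f a)^2 \<le> ?S" by (simp add: m_def)
  show "(\<Sum>a\<in>A. w a * (f a - (\<Sum>a\<in>A. w a * f a))^2) \<le> ?S"
    using eq by (simp add: m_def)
qed

lemma chain_mean_bounds:
  assumes w: "prob_weight A w" and g: "\<And>a. a \<in> A \<Longrightarrow> 0 \<le> g a" "\<And>a. a \<in> A \<Longrightarrow> g a < 1"
  shows "0 \<le> chain_mean A w g n" "chain_mean A w g n \<le> n * (\<Sum>a\<in>A. w a * binary_entropy (g a))"
proof -
  have w1: "\<And>a. a \<in> A \<Longrightarrow> 0 \<le> w a" "sum w A = 1" using w by (auto simp: prob_weight_def)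
  have mu0: "0 \<le> (\<Sum>a\<in>A. w a * g a)" using w1 g by (intro sum_nonneg mult_nonneg_nonneg) auto
  have mu1: "(\<Sum>a\<in>A. w a * g a) \<le> 1"
    unfolding w1(2)[symmetric] using w1 g by (intro sum_mono) (simp add: mult_left_le less_imp_le)
  have h0: "0 \<le> (\<Sum>a\<in>A. w a * binary_entropy (g a))"
    using w1 g binary_entropy_nonneg by (intro sum_nonneg mult_nonneg_nonneg) auto
  show 0: "0 \<le> chain_mean A w g n" for n
    by (induction n) (use mu1 h0 in \<open>auto simp: chain_mean_0 chain_mean_Suc[OF w]\<close>)
  show "chain_mean A w g n \<le> n * (\<Sum>a\<in>A. w a * binary_entropy (g a))"
  proof (induction n)
    case (Suc n)
    have "(1 - (\<Sum>a\<in>A. w a * g a)) * chain_mean A w g n \<le> 1 * chain_mean A w g n"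
      using mu0 0 by (intro mult_right_mono) auto
    with Suc show ?case by (simp add: chain_mean_Suc[OF w] algebra_simps)
  qed (simp add: chain_mean_0)
qed

text \<open>Given the new fraction \<open>a\<close>, the deviation is a constant \<open>X a\<close>
  plus (1 - g a) times the old centred deviation, so the cross term vanishes. The variance therefore
  grows by at most the variance of \<open>binary_entropy (g a) - g a * M\<close>, where the mean M
  satisfies M^2 <= m^2 s. The bound \<open>m\<close> is separate from \<open>n\<close> so that the
  increment stays fixed during the induction.\<close>

lemma chain_entropy_variance:
  assumes w: "prob_weight A w" and g: "\<And>a. a \<in> A \<Longrightarrow> 0 \<le> g a" "\<And>a. a \<in> A \<Longrightarrow> g a < 1"
    and s: "(\<Sum>a\<in>A. w a * (binary_entropy (g a))^2) \<le> s" and q: "(\<Sum>a\<in>A. w a * (g a)^2) \<le> q"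
    and nm: "n \<le> m"
  shows "prod_expect A w n (\<lambda>x. (chain_entropy (\<lambda>i. g (x i)) n - chain_mean A w g n)^2)
    \<le> n * (2 * s * (1 + q * (real m)^2))"
  using nm
proof (induction n)
  case 0
  then show ?case by (simp add: chain_mean_0)
next
  case (Suc n)
  define M where "M = chain_mean A w g n"
  define M' where "M' = chain_mean A w g (Suc n)"
  define H where "H = (\<lambda>x. chain_entropy (\<lambda>i. g (x i)) n)"
  define V where "V = prod_expect A w n (\<lambda>x. (H x - M)^2)"
  define X where "X a = binary_entropy (g a) + (1 - g a) * M - M'" for a
  define K where "K = 2 * s * (1 + q * (real m)^2)"
  have w1: "\<And>a. a \<in> A \<Longrightarrow> 0 \<le> w a" "sum w A = 1" using w by (auto simp: prob_weight_def)
  have V0: "0 \<le> V"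
    using prod_expect_mono[where F = "\<lambda>_. 0" and G = "\<lambda>x. (H x - M)^2" and A = A and w = w and n = n] w1
    by (simp add: V_def prod_expect_const[OF w])
  have step: "prod_expect A w n (\<lambda>x. (binary_entropy (g a) + (1 - g a) * H x - M')^2) = (X a)^2 + (1 - g a)^2 * V" for a
  proof -
    have "prod_expect A w n (\<lambda>x. (binary_entropy (g a) + (1 - g a) * H x - M')^2)
        = prod_expect A w n (\<lambda>x. (X a)^2 + 2 * X a * (1 - g a) * (H x - M) + (1 - g a)^2 * (H x - M)^2)"
      by (rule prod_expect_cong) (simp add: X_def power2_eq_square algebra_simps)
    also have "\<dots> = (X a)^2 + 2 * X a * (1 - g a) * (prod_expect A w n H - M) + (1 - g a)^2 * V"
      by (simp add: prod_expect_add prod_expect_cmult prod_expect_diff prod_expect_const[OF w] V_def)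
    also have "prod_expect A w n H = M" by (simp add: M_def chain_mean_def H_def)
    finally show ?thesis by simp
  qed
  have "prod_expect A w (Suc n) (\<lambda>x. (chain_entropy (\<lambda>i. g (x i)) (Suc n) - chain_mean A w g (Suc n))^2)
      = (\<Sum>a\<in>A. w a * ((X a)^2 + (1 - g a)^2 * V))"
    using step by (simp add: chain_entropy_upd H_def M'_def)
  also have "\<dots> \<le> (\<Sum>a\<in>A. w a * (X a)^2 + w a * V)"
  proof (rule sum_mono)
    fix a assume a: "a \<in> A"
    have "(1 - g a)^2 * V \<le> 1 * V"
      using g[OF a] V0 by (intro mult_right_mono power_le_one) auto
    then show "w a * ((X a)^2 + (1 - g a)^2 * V) \<le> w a * (X a)^2 + w a * V"
      using mult_left_mono[OF _ w1(1)[OF a]] by (simp add: distrib_left)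
  qed
  also have "\<dots> = (\<Sum>a\<in>A. w a * (X a)^2) + V"
    by (simp add: sum.distrib w1 flip: sum_distrib_right)
  also have "(\<Sum>a\<in>A. w a * (X a)^2) \<le> K"
  proof -
    define f where "f a = binary_entropy (g a) - g a * M" for a
    have "X a = f a - (\<Sum>a\<in>A. w a * f a)" for a
      unfolding X_def f_def M'_def chain_mean_Suc[OF w] M_def
      by (simp add: algebra_simps sum.distrib sum_subtractf sum_distrib_left)
    then have "(\<Sum>a\<in>A. w a * (X a)^2) \<le> (\<Sum>a\<in>A. w a * (f a)^2)"
      using weighted_mean_power2_le(2)[OF w, of f] by simp
    also have "\<dots> \<le> (\<Sum>a\<in>A. w a * (2 * (binary_entropy (g a))^2 + 2 * M^2 * (g a)^2))"
    proof (intro sum_mono mult_left_mono w1)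
      fix a
      have "0 \<le> (binary_entropy (g a) + g a * M)^2" by simp
      then show "(f a)^2 \<le> 2 * (binary_entropy (g a))^2 + 2 * M^2 * (g a)^2"
        by (simp add: f_def power2_eq_square algebra_simps)
    qed
    also have "\<dots> = 2 * (\<Sum>a\<in>A. w a * (binary_entropy (g a))^2) + 2 * M^2 * (\<Sum>a\<in>A. w a * (g a)^2)"
      by (simp add: distrib_left sum.distrib sum_distrib_left mult_ac)
    also have "\<dots> \<le> 2 * s + 2 * M^2 * q"
      using s q by (intro add_mono mult_left_mono) auto
    also have "\<dots> \<le> 2 * s + 2 * ((real m)^2 * s) * q"
    proof -
      have q0: "0 \<le> q" using q w1 by (smt (verit) sum_nonneg mult_nonneg_nonneg zero_le_power2)
      have s0: "0 \<le> s" using s w1 by (smt (verit) sum_nonneg mult_nonneg_nonneg zero_le_power2)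
      have "M^2 \<le> (n * (\<Sum>a\<in>A. w a * binary_entropy (g a)))^2"
        unfolding M_def using chain_mean_bounds[OF w g] by (intro power_mono) auto
      also have "\<dots> \<le> (real n)^2 * s"
        unfolding power_mult_distrib
        using weighted_mean_power2_le(1)[OF w, of "\<lambda>a. binary_entropy (g a)"] s
        by (intro mult_left_mono) auto
      also have "\<dots> \<le> (real m)^2 * s"
        using Suc.prems s0 by (intro mult_right_mono power_mono) auto
      finally show ?thesis using q0 by (simp add: mult_right_mono)
    qed
    also have "\<dots> = K" by (simp add: K_def algebra_simps)
    finally show ?thesis .
  qed
  also have "V \<le> n * K" using Suc by (simp add: V_def H_def M_def K_def)
  finally show ?case by (simp add: K_def algebra_simps)
qed

section \<open>Norm estimates for queries\<close>

definition vnorm :: "complex vec \<Rightarrow> real" where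
  "vnorm v = L2_set (\<lambda>k. cmod (v $ k)) {..<dim_vec v}"

lemma vnorm_nonneg: "0 \<le> vnorm v"
  by (simp add: vnorm_def)

lemma vnorm_power2: "(vnorm v)^2 = (\<Sum>k<dim_vec v. (cmod (v $ k))^2)"
  by (simp add: vnorm_def L2_set_def sum_nonneg)

lemma vnorm_leI:
  assumes "(\<Sum>k<dim_vec v. (cmod (v $ k))^2) \<le> c^2" "0 \<le> c"
  shows "vnorm v \<le> c"
  by (rule power2_le_imp_le) (use assms in \<open>simp_all add: vnorm_power2\<close>)

lemma vnorm_triangle:
  assumes "u \<in> carrier_vec n" "v \<in> carrier_vec n"
  shows "vnorm (u + v) \<le> vnorm u + vnorm v"
proof -
  have "vnorm (u + v) \<le> L2_set (\<lambda>k. cmod (u $ k) + cmod (v $ k)) {..<n}"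
    using assms unfolding vnorm_def by (auto intro!: L2_set_mono simp: norm_triangle_ineq)
  also have "\<dots> \<le> vnorm u + vnorm v"
    using assms L2_set_triangle_ineq[of "\<lambda>k. cmod (u $ k)" "\<lambda>k. cmod (v $ k)" "{..<n}"]
    by (simp add: vnorm_def)
  finally show ?thesis .
qed

lemma sum_lessThan_add:
  fixes f :: "nat \<Rightarrow> 'a::comm_monoid_add"
  shows "(\<Sum>k<m + b. f k) = (\<Sum>k<m. f k) + (\<Sum>j<b. f (m + j))"
  by (induction b) (simp_all add: add.assoc)

lemma sum_lessThan_mult:
  fixes f :: "nat \<Rightarrow> 'a::comm_monoid_add"
  shows "(\<Sum>k<a * b. f k) = (\<Sum>i<a. \<Sum>j<b. f (i * b + j))"
proof (induction a)
  case (Suc a)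
  have "(\<Sum>k<Suc a * b. f k) = (\<Sum>k<a * b + b. f k)" by (simp add: add.commute)
  also have "\<dots> = (\<Sum>k<a * b. f k) + (\<Sum>j<b. f (a * b + j))"
    by (rule sum_lessThan_add)
  finally show ?case using Suc by simp
qed simp

lemma mult_mat_vec_index:
  assumes "A \<in> carrier_mat a n" "v \<in> carrier_vec n" "i < a"
  shows "(A *\<^sub>v v) $ i = (\<Sum>j<n. A $$ (i, j) * v $ j)"
  using assms by (simp add: scalar_prod_def lessThan_atLeast0)

lemma add_mult_lt:
  fixes i a k b :: nat
  assumes "i < a" "k < b"
  shows "i * b + k < a * b"
proof -
  have "i * b + k < Suc i * b" using assms by simp
  also have "\<dots> \<le> a * b" using assms by (intro mult_right_mono) auto
  finally show ?thesis .
qed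

lemma kron_carrier:
  "A \<in> carrier_mat a c \<Longrightarrow> B \<in> carrier_mat b e \<Longrightarrow> kron A B \<in> carrier_mat (a * b) (c * e)"
  by (simp add: kron_def)

lemma kron_index:
  assumes "A \<in> carrier_mat a c" "B \<in> carrier_mat b e" "i < a" "k < b" "j < c" "l < e"
  shows "kron A B $$ (i * b + k, j * e + l) = A $$ (i, j) * B $$ (k, l)"
  using assms add_mult_lt[of i a k b] add_mult_lt[of j c l e] by (simp add: kron_def)

lemma kron_mult_vec_index:
  assumes "A \<in> carrier_mat a c" "B \<in> carrier_mat b e" "v \<in> carrier_vec (c * e)" "i < a" "k < b"
  shows "(kron A B *\<^sub>v v) $ (i * b + k) = (\<Sum>j<c. \<Sum>l<e. A $$ (i, j) * B $$ (k, l) * v $ (j * e + l))"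
proof -
  have "(kron A B *\<^sub>v v) $ (i * b + k) = (\<Sum>x<c * e. kron A B $$ (i * b + k, x) * v $ x)"
    by (rule mult_mat_vec_index[OF kron_carrier[OF assms(1,2)] assms(3)]) (rule add_mult_lt[OF assms(4,5)])
  also have "\<dots> = (\<Sum>j<c. \<Sum>l<e. kron A B $$ (i * b + k, j * e + l) * v $ (j * e + l))"
    by (rule sum_lessThan_mult)
  also have "\<dots> = (\<Sum>j<c. \<Sum>l<e. A $$ (i, j) * B $$ (k, l) * v $ (j * e + l))"
    using kron_index[OF assms(1,2,4,5)] by (intro sum.cong refl) auto
  finally show ?thesis .
qed

text \<open>\<open>query_op\<close> without its built-in adjoint: \<open>W\<close> is an arbitrary
  matrix. This is needed because, at a complex angle, the inverse query has to be continued as a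
  polynomial and is no longer the conjugate transpose of the forward query.\<close>

definition apply_query :: "nat \<Rightarrow> nat \<Rightarrow> complex mat \<Rightarrow> nat \<Rightarrow> complex mat" where
  "apply_query dm w W t =
     (if t \<le> 1 then kron (1\<^sub>m 2) (kron W (1\<^sub>m w))
      else kron proj0 (1\<^sub>m (dm * w)) + kron proj1 (kron W (1\<^sub>m w)))"

lemma query_op_eq:
  "query_op dm w U t = apply_query dm w (if t = 0 \<or> t = 2 then U else cadj U) t"
  by (simp add: query_op_def apply_query_def)

lemma proj_carrier: "proj0 \<in> carrier_mat 2 2" "proj1 \<in> carrier_mat 2 2"
  by (simp_all add: proj0_def proj1_def)

lemma apply_query_carrier:
  "W \<in> carrier_mat dm dm \<Longrightarrow> apply_query dm w W t \<in> carrier_mat (2 * (dm * w)) (2 * (dm * w))"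
  unfolding apply_query_def using proj_carrier
  by (auto intro!: kron_carrier add_carrier_mat one_carrier_mat)

lemma sum_lessThan_2: "(\<Sum>q<(2::nat). f q) = f 0 + f 1"
  by (simp add: numeral_2_eq_2)

definition slice :: "nat \<Rightarrow> nat \<Rightarrow> complex vec \<Rightarrow> nat \<Rightarrow> nat \<Rightarrow> complex vec" where
  "slice dm w v q y = vec dm (\<lambda>a. v $ (q * (dm * w) + (a * w + y)))"

lemma slice_carrier: "slice dm w v q y \<in> carrier_vec dm"
  by (simp add: slice_def)

lemma apply_query_index:
  assumes W: "W \<in> carrier_mat dm dm" and v: "v \<in> carrier_vec (2 * (dm * w))"
    and q: "q < 2" and a: "a < dm" and y: "y < w"
  shows "(apply_query dm w W t *\<^sub>v v) $ (q * (dm * w) + (a * w + y))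
    = (if t \<le> 1 \<or> q = 1 then (\<Sum>a'<dm. W $$ (a, a') * v $ (q * (dm * w) + (a' * w + y)))
       else v $ (q * (dm * w) + (a * w + y)))"
proof -
  let ?x = "q * (dm * w) + (a * w + y)"
  have K: "kron W (1\<^sub>m w) \<in> carrier_mat (dm * w) (dm * w)"
    using W by (intro kron_carrier) auto
  have r: "a * w + y < dm * w" using add_mult_lt[OF a y] .
  have inner: "(\<Sum>l<dm * w. kron W (1\<^sub>m w) $$ (a * w + y, l) * g l) = (\<Sum>a'<dm. W $$ (a, a') * g (a' * w + y))"
    for g :: "nat \<Rightarrow> complex"
  proof -
    have "(\<Sum>l<dm * w. kron W (1\<^sub>m w) $$ (a * w + y, l) * g l)
        = (\<Sum>a'<dm. \<Sum>y'<w. (W $$ (a, a') * 1\<^sub>m w $$ (y, y')) * g (a' * w + y'))"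
      unfolding sum_lessThan_mult
      using kron_index[OF W one_carrier_mat a y] by (intro sum.cong refl) auto
    also have "\<dots> = (\<Sum>a'<dm. \<Sum>y'<w. if y' = y then W $$ (a, a') * g (a' * w + y) else 0)"
      using y by (intro sum.cong refl) auto
    finally show ?thesis using y by simp
  qed
  have delta: "(\<Sum>l<dm * w. 1\<^sub>m (dm * w) $$ (a * w + y, l) * g l) = g (a * w + y)" for g :: "nat \<Rightarrow> complex"
  proof -
    have "(\<Sum>l<dm * w. 1\<^sub>m (dm * w) $$ (a * w + y, l) * g l)
        = (\<Sum>l<dm * w. if l = a * w + y then g (a * w + y) else 0)"
      using r by (intro sum.cong refl) auto
    then show ?thesis using r by simp
  qed
  have q01: "q = 0 \<or> q = 1" using q by auto
  show ?thesis
  proof (cases "t \<le> 1")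
    case True
    then have "(apply_query dm w W t *\<^sub>v v) $ (?x)
        = (\<Sum>j<2. \<Sum>l<dm * w. 1\<^sub>m 2 $$ (q, j) * kron W (1\<^sub>m w) $$ (a * w + y, l) * v $ (j * (dm * w) + l))"
      using kron_mult_vec_index[OF one_carrier_mat K v q r] by (simp add: apply_query_def)
    also have "\<dots> = (\<Sum>l<dm * w. kron W (1\<^sub>m w) $$ (a * w + y, l) * v $ (q * (dm * w) + l))"
      using q01 by (auto simp: sum_lessThan_2)
    finally show ?thesis using True by (simp add: inner)
  next
    case False
    have c0: "kron proj0 (1\<^sub>m (dm * w)) \<in> carrier_mat (2 * (dm * w)) (2 * (dm * w))"
      by (intro kron_carrier proj_carrier one_carrier_mat)
    have c1: "kron proj1 (kron W (1\<^sub>m w)) \<in> carrier_mat (2 * (dm * w)) (2 * (dm * w))"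
      by (intro kron_carrier proj_carrier K)
    have rr: "?x < 2 * (dm * w)" using add_mult_lt[OF q r] .
    have "(apply_query dm w W t *\<^sub>v v) $ (?x)
        = (kron proj0 (1\<^sub>m (dm * w)) *\<^sub>v v + kron proj1 (kron W (1\<^sub>m w)) *\<^sub>v v) $ (?x)"
      using False by (simp add: apply_query_def add_mult_distrib_mat_vec[OF c0 c1 v])
    also have "\<dots> = (kron proj0 (1\<^sub>m (dm * w)) *\<^sub>v v) $ (?x)
        + (kron proj1 (kron W (1\<^sub>m w)) *\<^sub>v v) $ (?x)"
      by (rule index_add_vec(1)) (use c1 rr in simp)
    also have "(kron proj0 (1\<^sub>m (dm * w)) *\<^sub>v v) $ (?x)
        = (\<Sum>j<2. proj0 $$ (q, j) * (\<Sum>l<dm * w. 1\<^sub>m (dm * w) $$ (a * w + y, l) * v $ (j * (dm * w) + l)))"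
      using kron_mult_vec_index[OF proj_carrier(1) one_carrier_mat v q r] by (simp add: sum_distrib_left mult.assoc)
    also have "\<dots> = (if q = 0 then v $ (?x) else 0)"
      using q01 unfolding delta by (auto simp: sum_lessThan_2 proj0_def)
    also have "(kron proj1 (kron W (1\<^sub>m w)) *\<^sub>v v) $ (?x)
        = (\<Sum>j<2. proj1 $$ (q, j) * (\<Sum>l<dm * w. kron W (1\<^sub>m w) $$ (a * w + y, l) * v $ (j * (dm * w) + l)))"
      using kron_mult_vec_index[OF proj_carrier(2) K v q r] by (simp add: sum_distrib_left mult.assoc)
    also have "\<dots> = (if q = 1 then (\<Sum>a'<dm. W $$ (a, a') * v $ (q * (dm * w) + (a' * w + y))) else 0)"
      using q01 unfolding inner by (auto simp: sum_lessThan_2 proj1_def)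
    finally show ?thesis using False q01 by auto
  qed
qed

lemma slice_apply_query:
  assumes W: "W \<in> carrier_mat dm dm" and v: "v \<in> carrier_vec (2 * (dm * w))"
    and q: "q < 2" and y: "y < w"
  shows "slice dm w (apply_query dm w W t *\<^sub>v v) q y
    = (if t \<le> 1 \<or> q = 1 then W *\<^sub>v slice dm w v q y else slice dm w v q y)"
proof (rule eq_vecI)
  let ?r = "(if t \<le> 1 \<or> q = 1 then W *\<^sub>v slice dm w v q y else slice dm w v q y)"
  fix a assume "a < dim_vec ?r"
  then have a: "a < dm" using W by (auto simp: slice_def split: if_splits)
  have "(W *\<^sub>v slice dm w v q y) $ a = (\<Sum>a'<dm. W $$ (a, a') * v $ (q * (dm * w) + (a' * w + y)))"
    using mult_mat_vec_index[OF W slice_carrier a] by (simp add: slice_def)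
  then show "slice dm w (apply_query dm w W t *\<^sub>v v) q y $ a
      = ?r $ a"
    using apply_query_index[OF W v q a y, of t] a by (simp add: slice_def)
qed (use W in \<open>auto simp: slice_def\<close>)

lemma vnorm_power2_slices:
  assumes "v \<in> carrier_vec (2 * (dm * w))"
  shows "(vnorm v)^2 = (\<Sum>q<2. \<Sum>y<w. (vnorm (slice dm w v q y))^2)"
proof -
  have "(vnorm v)^2 = (\<Sum>q<2. \<Sum>a<dm. \<Sum>y<w. (cmod (v $ (q * (dm * w) + (a * w + y))))^2)"
    using assms by (simp add: vnorm_power2 sum_lessThan_mult)
  also have "\<dots> = (\<Sum>q<2. \<Sum>y<w. (vnorm (slice dm w v q y))^2)"
    by (subst sum.swap) (simp add: vnorm_power2 slice_def)
  finally show ?thesis .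
qed

text \<open>Slice by slice. The condition 1 <= \<kappa> covers the slices with control value 0,
  which a controlled query leaves alone.\<close>

lemma vnorm_apply_query_le:
  assumes W: "W \<in> carrier_mat dm dm" and v: "v \<in> carrier_vec (2 * (dm * w))"
    and \<kappa>: "1 \<le> \<kappa>" "\<And>x. x \<in> carrier_vec dm \<Longrightarrow> vnorm (W *\<^sub>v x) \<le> \<kappa> * vnorm x"
  shows "vnorm (apply_query dm w W t *\<^sub>v v) \<le> \<kappa> * vnorm v"
proof (rule power2_le_imp_le)
  let ?a = "(apply_query dm w W t *\<^sub>v v)"
  have "vnorm (slice dm w ?a q y) \<le> \<kappa> * vnorm (slice dm w v q y)"
    if "q < 2" "y < w" for q y
    using slice_apply_query[OF W v that, of t] \<kappa>(2)[OF slice_carrier]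
      mult_right_mono[OF \<kappa>(1) vnorm_nonneg] by simp
  then have "(\<Sum>q<2. \<Sum>y<w. (vnorm (slice dm w ?a q y))^2)
      \<le> (\<Sum>q<2. \<Sum>y<w. (\<kappa> * vnorm (slice dm w v q y))^2)"
    by (intro sum_mono power_mono) (auto simp: vnorm_nonneg)
  also have "\<dots> = \<kappa>^2 * (\<Sum>q<2. \<Sum>y<w. (vnorm (slice dm w v q y))^2)"
    by (simp add: power_mult_distrib sum_distrib_left)
  finally show "(vnorm ?a)^2 \<le> (\<kappa> * vnorm v)^2"
    using vnorm_power2_slices[OF mult_mat_vec_carrier[OF apply_query_carrier[OF W] v]]
      vnorm_power2_slices[OF v] by (simp add: power_mult_distrib)
qed (use \<kappa>(1) vnorm_nonneg[of v] in simp)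

lemma vnorm_apply_query_diff_le:
  assumes W: "W \<in> carrier_mat dm dm" "W' \<in> carrier_mat dm dm" and v: "v \<in> carrier_vec (2 * (dm * w))"
    and \<delta>: "0 \<le> \<delta>" "\<And>x. x \<in> carrier_vec dm \<Longrightarrow> vnorm (W *\<^sub>v x - W' *\<^sub>v x) \<le> \<delta> * vnorm x"
  shows "vnorm (apply_query dm w W t *\<^sub>v v - apply_query dm w W' t *\<^sub>v v) \<le> \<delta> * vnorm v"
proof (rule power2_le_imp_le)
  let ?d = "apply_query dm w W t *\<^sub>v v - apply_query dm w W' t *\<^sub>v v"
  let ?b = "(apply_query dm w W' t *\<^sub>v v)"
  let ?a = "(apply_query dm w W t *\<^sub>v v)"
  note c = mult_mat_vec_carrier[OF apply_query_carrier[OF W(1)] v] mult_mat_vec_carrier[OF apply_query_carrier[OF W(2)] v]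
  have dc: "?d \<in> carrier_vec (2 * (dm * w))" using c by (intro minus_carrier_vec)
  have "vnorm (slice dm w ?d q y) \<le> \<delta> * vnorm (slice dm w v q y)" if qy: "q < 2" "y < w" for q y
  proof -
    define x where "x = slice dm w v q y"
    have x: "x \<in> carrier_vec dm" unfolding x_def by (rule slice_carrier)
    have "slice dm w ?d q y = slice dm w ?a q y - slice dm w ?b q y"
    proof (rule eq_vecI)
      fix a assume "a < dim_vec (slice dm w ?a q y - slice dm w ?b q y)"
      then have a: "a < dm" by (simp add: slice_def)
      have "q * (dm * w) + (a * w + y) < dim_vec ?b"
        using add_mult_lt[OF qy(1) add_mult_lt[OF a qy(2)]] unfolding carrier_vecD[OF c(2)] .
      then show "slice dm w ?d q y $ a = (slice dm w ?a q y - slice dm w ?b q y) $ a"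
        using a by (simp add: slice_def index_minus_vec(1) del: index_mult_mat_vec dim_mult_mat_vec)
    qed (simp add: slice_def)
    also have "\<dots> = (if t \<le> 1 \<or> q = 1 then W *\<^sub>v x - W' *\<^sub>v x else 0\<^sub>v dm)"
      unfolding slice_apply_query[OF W(1) v qy] slice_apply_query[OF W(2) v qy] x_def[symmetric]
      using x by simp
    finally have eq: "slice dm w ?d q y = (if t \<le> 1 \<or> q = 1 then W *\<^sub>v x - W' *\<^sub>v x else 0\<^sub>v dm)" .
    have z: "vnorm (0\<^sub>v dm) = 0" by (simp add: vnorm_def L2_set_def)
    show ?thesis
      unfolding eq x_def[symmetric] using \<delta>(2)[OF x] z \<delta>(1) vnorm_nonneg[of x] by simp
  qed
  then have "(\<Sum>q<2. \<Sum>y<w. (vnorm (slice dm w ?d q y))^2) \<le> (\<Sum>q<2. \<Sum>y<w. (\<delta> * vnorm (slice dm w v q y))^2)"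
    by (intro sum_mono power_mono) (auto simp: vnorm_nonneg)
  also have "\<dots> = \<delta>^2 * (\<Sum>q<2. \<Sum>y<w. (vnorm (slice dm w v q y))^2)"
    by (simp add: power_mult_distrib sum_distrib_left)
  finally show "(vnorm ?d)^2 \<le> (\<delta> * vnorm v)^2"
    using vnorm_power2_slices[OF dc] vnorm_power2_slices[OF v] by (simp add: power_mult_distrib)
qed (use \<delta>(1) vnorm_nonneg[of v] in simp)

section \<open>Unitary matrices: norm preservation and closure properties\<close>

lemma is_unitary_carrier: "is_unitary n A \<Longrightarrow> A \<in> carrier_mat n n"
  by (simp add: is_unitary_def)

lemma vnorm_unitary:
  assumes A: "is_unitary n A" and v: "v \<in> carrier_vec n"
  shows "vnorm (A *\<^sub>v v) = vnorm v"
proof -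
  have Ac: "A \<in> carrier_mat n n" using A by (rule is_unitary_carrier)
  have gram: "(\<Sum>i<n. cnj (A $$ (i, j)) * A $$ (i, k)) = (if j = k then 1 else 0)" if "j < n" "k < n" for j k
  proof -
    have "(cadj A * A) $$ (j, k) = (\<Sum>i<n. cnj (A $$ (i, j)) * A $$ (i, k))"
      using Ac that by (simp add: cadj_def scalar_prod_def lessThan_atLeast0)
    then show ?thesis using A that by (simp add: is_unitary_def)
  qed
  have "complex_of_real ((vnorm (A *\<^sub>v v))^2) = (\<Sum>i<n. cnj ((A *\<^sub>v v) $ i) * (A *\<^sub>v v) $ i)"
    using Ac by (simp add: vnorm_power2 complex_norm_square mult.commute del: index_mult_mat_vec of_real_power)
  also have "\<dots> = (\<Sum>i<n. cnj (\<Sum>j<n. A $$ (i, j) * v $ j) * (\<Sum>k<n. A $$ (i, k) * v $ k))"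
    using mult_mat_vec_index[OF Ac v] by (intro sum.cong refl) simp
  also have "\<dots> = (\<Sum>i<n. \<Sum>j<n. \<Sum>k<n. cnj (v $ j) * v $ k * (cnj (A $$ (i, j)) * A $$ (i, k)))"
    unfolding cnj_sum sum_product by (intro sum.cong refl) (simp add: mult_ac)
  also have "\<dots> = (\<Sum>j<n. \<Sum>k<n. \<Sum>i<n. cnj (v $ j) * v $ k * (cnj (A $$ (i, j)) * A $$ (i, k)))"
    by (subst sum.swap, rule sum.cong, simp, rule sum.swap)
  also have "\<dots> = (\<Sum>j<n. \<Sum>k<n. if k = j then cnj (v $ j) * v $ j else 0)"
    unfolding sum_distrib_left[symmetric] by (intro sum.cong refl) (auto simp: gram)
  also have "\<dots> = (\<Sum>j<n. cnj (v $ j) * v $ j)" by simp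
  also have "\<dots> = complex_of_real ((vnorm v)^2)"
    using v by (simp add: vnorm_power2 complex_norm_square mult.commute del: of_real_power)
  finally have "(vnorm (A *\<^sub>v v))^2 = (vnorm v)^2" by (simp only: of_real_eq_iff)
  then show ?thesis using vnorm_nonneg by (simp add: power2_eq_iff_nonneg)
qed

lemma cadj_mult:
  assumes "A \<in> carrier_mat n n" "B \<in> carrier_mat n n"
  shows "cadj (A * B) = cadj B * cadj A"
proof (rule eq_matI)
  fix i j assume "i < dim_row (cadj B * cadj A)" "j < dim_col (cadj B * cadj A)"
  then have ij: "i < n" "j < n" using assms by (auto simp: cadj_def)
  have "cadj (A * B) $$ (i, j) = (\<Sum>k<n. cnj (A $$ (j, k) * B $$ (k, i)))"
    using assms ij by (simp add: cadj_def scalar_prod_def lessThan_atLeast0)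
  also have "\<dots> = (\<Sum>k<n. cnj (B $$ (k, i)) * cnj (A $$ (j, k)))"
    by (simp only: complex_cnj_mult mult.commute)
  also have "\<dots> = (cadj B * cadj A) $$ (i, j)"
    using assms ij by (simp add: cadj_def scalar_prod_def lessThan_atLeast0)
  finally show "cadj (A * B) $$ (i, j) = (cadj B * cadj A) $$ (i, j)" .
qed (use assms in \<open>auto simp: cadj_def\<close>)

lemma is_unitary_mult:
  assumes "is_unitary n A" "is_unitary n B"
  shows "is_unitary n (A * B)"
proof -
  have c: "A \<in> carrier_mat n n" "B \<in> carrier_mat n n" "cadj A \<in> carrier_mat n n" "cadj B \<in> carrier_mat n n"
    using assms by (auto simp: is_unitary_def cadj_def)
  have adj: "cadj (A * B) = cadj B * cadj A" by (rule cadj_mult[OF c(1,2)])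
  have u: "cadj A * A = 1\<^sub>m n" "A * cadj A = 1\<^sub>m n" "cadj B * B = 1\<^sub>m n" "B * cadj B = 1\<^sub>m n"
    using assms by (auto simp: is_unitary_def)
  have "cadj B * cadj A * (A * B) = cadj B * (cadj A * A * B)"
    unfolding assoc_mult_mat[OF c(4,3) mult_carrier_mat[OF c(1,2)]] assoc_mult_mat[OF c(3,1,2)] ..
  also have "\<dots> = 1\<^sub>m n" unfolding u left_mult_one_mat[OF c(2)] ..
  finally have 1: "cadj B * cadj A * (A * B) = 1\<^sub>m n" .
  have "A * B * (cadj B * cadj A) = A * (B * cadj B * cadj A)"
    unfolding assoc_mult_mat[OF c(1,2) mult_carrier_mat[OF c(4,3)]] assoc_mult_mat[OF c(2,4,3)] ..
  also have "\<dots> = 1\<^sub>m n" unfolding u left_mult_one_mat[OF c(3)] ..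
  finally have 2: "A * B * (cadj B * cadj A) = 1\<^sub>m n" .
  show ?thesis unfolding is_unitary_def adj using 1 2 mult_carrier_mat[OF c(1,2)] by blast
qed

lemma is_unitary_cadj:
  assumes "is_unitary n A"
  shows "is_unitary n (cadj A)"
proof -
  have "cadj (cadj A) = A" by (rule eq_matI) (auto simp: cadj_def)
  then show ?thesis using assms by (auto simp: is_unitary_def cadj_def)
qed

lemma is_unitary_one: "is_unitary n (1\<^sub>m n)"
proof -
  have "cadj (1\<^sub>m n) = 1\<^sub>m n" by (rule eq_matI) (auto simp: cadj_def)
  then show ?thesis by (simp add: is_unitary_def)
qed

section \<open>Oracles built from rotations\<close>

text \<open>The parameters are complex and no conjugate occurs, so the entries are polynomials in
  \<open>c\<close> and \<open>s\<close> also away from real angles.\<close>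

definition plane_rot :: "nat \<Rightarrow> nat \<Rightarrow> complex \<Rightarrow> complex \<Rightarrow> complex mat" where
  "plane_rot n l c s = mat n n (\<lambda>(i, j).
     if i = 0 \<and> j = 0 \<or> i = l \<and> j = l then c
     else if i = l \<and> j = 0 then s else if i = 0 \<and> j = l then - s
     else if i = j then 1 else 0)"

lemma plane_rot_carrier: "plane_rot n l c s \<in> carrier_mat n n"
  by (simp add: plane_rot_def)

lemma plane_rot_vec_index:
  assumes x: "x \<in> carrier_vec n" and l: "0 < l" "l < n" and i: "i < n"
  shows "(plane_rot n l c s *\<^sub>v x) $ i =
    (if i = 0 then c * x $ 0 - s * x $ l else if i = l then s * x $ 0 + c * x $ l else x $ i)"
proof -
  have "(plane_rot n l c s *\<^sub>v x) $ i = (\<Sum>j<n. plane_rot n l c s $$ (i, j) * x $ j)"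
    by (rule mult_mat_vec_index[OF plane_rot_carrier x i])
  also have "\<dots> = (\<Sum>j<n. (if j = 0 then (if i = 0 then c else if i = l then s else 0) * x $ 0 else 0)
      + (if j = l then (if i = 0 then - s else if i = l then c else 0) * x $ l else 0)
      + (if j = i then (if i = 0 \<or> i = l then 0 else 1) * x $ i else 0))"
    using l i by (intro sum.cong refl) (auto simp: plane_rot_def)
  also have "\<dots> = (if i = 0 then c else if i = l then s else 0) * x $ 0
      + (if i = 0 then - s else if i = l then c else 0) * x $ l
      + (if i = 0 \<or> i = l then 0 else 1) * x $ i"
    using l i by (simp add: sum.distrib)
  finally show ?thesis using l by auto
qed

text \<open>Over the complex numbers the rotation has eigenvalues \<open>c \<plusminus> \<i> s\<close>, with orthogonal eigenvectors.\<close>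

lemma complex_rotation_norm_le:
  fixes c s x y :: complex
  assumes "cmod (c + \<i> * s) \<le> \<kappa>" "cmod (c - \<i> * s) \<le> \<kappa>"
  shows "(cmod (c * x - s * y))^2 + (cmod (s * x + c * y))^2 \<le> \<kappa>^2 * ((cmod x)^2 + (cmod y)^2)"
proof -
  have par: "(cmod (a + \<i> * b))^2 + (cmod (a - \<i> * b))^2 = 2 * ((cmod a)^2 + (cmod b)^2)" for a b
    unfolding cmod_power2 by (simp add: power2_eq_square algebra_simps)
  have k: "0 \<le> \<kappa>" using assms(1) norm_ge_zero order_trans by blast
  have "2 * ((cmod (c * x - s * y))^2 + (cmod (s * x + c * y))^2)
      = (cmod ((c + \<i> * s) * (x + \<i> * y)))^2 + (cmod ((c - \<i> * s) * (x - \<i> * y)))^2"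
    unfolding par[symmetric]
    by (intro arg_cong2[where f = "(+)"] arg_cong[where f = "\<lambda>z. (cmod z)^2"]) (simp_all add: algebra_simps)
  also have "\<dots> \<le> \<kappa>^2 * (cmod (x + \<i> * y))^2 + \<kappa>^2 * (cmod (x - \<i> * y))^2"
    unfolding norm_mult power_mult_distrib using assms
    by (intro add_mono mult_right_mono power_mono) auto
  also have "\<dots> = 2 * (\<kappa>^2 * ((cmod x)^2 + (cmod y)^2))"
    unfolding distrib_left[symmetric] par by simp
  finally show ?thesis by simp
qed

lemma sum_split_two:
  fixes f :: "nat \<Rightarrow> real"
  assumes "0 < l" "l < n"
  shows "(\<Sum>i<n. f i) = f 0 + f l + (\<Sum>i\<in>{..<n} - {0, l}. f i)"
proof -
  have "(\<Sum>i<n. f i) = (\<Sum>i\<in>{..<n} - {0, l}. f i) + (\<Sum>i\<in>{0, l}. f i)"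
    using assms by (intro sum.subset_diff) auto
  then show ?thesis using assms by simp
qed

lemma vnorm_plane_rot_le:
  assumes x: "x \<in> carrier_vec n" and l: "0 < l" "l < n"
    and \<kappa>: "1 \<le> \<kappa>" "cmod (c + \<i> * s) \<le> \<kappa>" "cmod (c - \<i> * s) \<le> \<kappa>"
  shows "vnorm (plane_rot n l c s *\<^sub>v x) \<le> \<kappa> * vnorm x"
proof (rule vnorm_leI)
  let ?rest = "(\<Sum>k\<in>{..<n} - {0, l}. (cmod (x $ k))^2)"
  let ?y = "plane_rot n l c s *\<^sub>v x"
  have dim: "dim_vec ?y = n" "dim_vec x = n" using x by (auto simp: plane_rot_def)
  note idx = plane_rot_vec_index[OF x l]
  have "(\<Sum>k<n. (cmod (?y $ k))^2) = (cmod (?y $ 0))^2 + (cmod (?y $ l))^2 + (\<Sum>k\<in>{..<n} - {0, l}. (cmod (?y $ k))^2)"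
    by (rule sum_split_two[OF l])
  also have "\<dots> = (cmod (c * x $ 0 - s * x $ l))^2 + (cmod (s * x $ 0 + c * x $ l))^2
      + ?rest"
    using l idx by (simp del: index_mult_mat_vec)
  also have "\<dots> \<le> \<kappa>^2 * ((cmod (x $ 0))^2 + (cmod (x $ l))^2) + \<kappa>^2 * ?rest"
  proof (rule add_mono[OF complex_rotation_norm_le[OF \<kappa>(2,3)]])
    have "1 * ?rest \<le> \<kappa>^2 * ?rest"
      using \<kappa>(1) by (intro mult_right_mono sum_nonneg) auto
    then show "?rest \<le> \<kappa>^2 * ?rest"
      by simp
  qed
  also have "\<dots> = \<kappa>^2 * (vnorm x)^2"
    unfolding vnorm_power2 dim sum_split_two[OF l] by (simp add: distrib_left)
  finally show "(\<Sum>k<dim_vec ?y. (cmod (?y $ k))^2) \<le> (\<kappa> * vnorm x)^2"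
    by (simp only: dim power_mult_distrib)
  show "0 \<le> \<kappa> * vnorm x" using \<kappa>(1) vnorm_nonneg[of x] by simp
qed

lemma vnorm_plane_rot_diff_le:
  assumes x: "x \<in> carrier_vec n" and l: "0 < l" "l < n"
    and \<kappa>: "0 \<le> \<kappa>" "cmod ((c - c') + \<i> * (s - s')) \<le> \<kappa>" "cmod ((c - c') - \<i> * (s - s')) \<le> \<kappa>"
  shows "vnorm (plane_rot n l c s *\<^sub>v x - plane_rot n l c' s' *\<^sub>v x) \<le> \<kappa> * vnorm x"
proof (rule vnorm_leI)
  let ?y = "plane_rot n l c s *\<^sub>v x - plane_rot n l c' s' *\<^sub>v x"
  have dim: "dim_vec ?y = n" "dim_vec x = n" using x by (auto simp: plane_rot_def)
  have idx: "?y $ i = (if i = 0 then (c - c') * x $ 0 - (s - s') * x $ l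
      else if i = l then (s - s') * x $ 0 + (c - c') * x $ l else 0)" if "i < n" for i
    using plane_rot_vec_index[OF x l that] that
    by (simp add: index_minus_vec(1) plane_rot_def algebra_simps del: index_mult_mat_vec)
  have "(\<Sum>k<n. (cmod (?y $ k))^2) = (cmod (?y $ 0))^2 + (cmod (?y $ l))^2 + (\<Sum>k\<in>{..<n} - {0, l}. (cmod (?y $ k))^2)"
    by (rule sum_split_two[OF l])
  also have "\<dots> = (cmod ((c - c') * x $ 0 - (s - s') * x $ l))^2 + (cmod ((s - s') * x $ 0 + (c - c') * x $ l))^2"
    using l idx by (simp del: index_minus_vec index_mult_mat_vec)
  also have "\<dots> \<le> \<kappa>^2 * ((cmod (x $ 0))^2 + (cmod (x $ l))^2)"
    by (rule complex_rotation_norm_le[OF \<kappa>(2,3)])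
  also have "\<dots> \<le> \<kappa>^2 * (vnorm x)^2"
    unfolding vnorm_power2 dim sum_split_two[OF l] by (intro mult_left_mono) (auto intro: sum_nonneg)
  finally show "(\<Sum>k<dim_vec ?y. (cmod (?y $ k))^2) \<le> (\<kappa> * vnorm x)^2"
    by (simp only: dim power_mult_distrib)
  show "0 \<le> \<kappa> * vnorm x" using \<kappa>(1) vnorm_nonneg[of x] by simp
qed

lemma mat_eqI_mult_vec:
  fixes A B :: "complex mat"
  assumes "A \<in> carrier_mat n n" "B \<in> carrier_mat n n"
    and "\<And>x. x \<in> carrier_vec n \<Longrightarrow> A *\<^sub>v x = B *\<^sub>v x"
  shows "A = B"
proof (rule eq_matI)
  fix i j assume ij: "i < dim_row B" "j < dim_col B"
  have e: "(M *\<^sub>v unit_vec n j) $ i = M $$ (i, j)" if "M \<in> carrier_mat n n" for M :: "complex mat"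
    using that ij assms(2) by (simp add: mult_mat_vec_def)
  show "A $$ (i, j) = B $$ (i, j)"
    using e[OF assms(1)] e[OF assms(2)] assms(3)[of "unit_vec n j"] by simp
qed (use assms in auto)

lemma plane_rot_mult:
  assumes "0 < l" "l < n" "c * c' - s * s' = 1" "s * c' + c * s' = 0"
  shows "plane_rot n l c s * plane_rot n l c' s' = 1\<^sub>m n"
proof (rule mat_eqI_mult_vec)
  fix x :: "complex vec" assume x: "x \<in> carrier_vec n"
  have y: "plane_rot n l c' s' *\<^sub>v x \<in> carrier_vec n"
    by (rule mult_mat_vec_carrier[OF plane_rot_carrier x])
  have "plane_rot n l c s *\<^sub>v (plane_rot n l c' s' *\<^sub>v x) = x"
  proof (rule eq_vecI)
    fix i assume "i < dim_vec x"
    then have i: "i < n" "0 < n" using x assms by auto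
    have "c * (c' * a - s' * b) - s * (s' * a + c' * b) = a"
      "s * (c' * a - s' * b) + c * (s' * a + c' * b) = b" for a b
    proof -
      have "c * (c' * a - s' * b) - s * (s' * a + c' * b) = (c * c' - s * s') * a - (s * c' + c * s') * b"
        "s * (c' * a - s' * b) + c * (s' * a + c' * b) = (s * c' + c * s') * a + (c * c' - s * s') * b"
        by (simp_all add: algebra_simps)
      then show "c * (c' * a - s' * b) - s * (s' * a + c' * b) = a"
        "s * (c' * a - s' * b) + c * (s' * a + c' * b) = b"
        unfolding assms(3,4) by simp_all
    qed
    then show "(plane_rot n l c s *\<^sub>v (plane_rot n l c' s' *\<^sub>v x)) $ i = x $ i"
      using plane_rot_vec_index[OF x assms(1,2)] plane_rot_vec_index[OF y assms(1,2) i(1)] i assms(1,2)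
      by (simp del: index_mult_mat_vec)
  qed (use x in \<open>simp add: plane_rot_def\<close>)
  then show "plane_rot n l c s * plane_rot n l c' s' *\<^sub>v x = 1\<^sub>m n *\<^sub>v x"
    using x assoc_mult_mat_vec[OF plane_rot_carrier plane_rot_carrier x] by simp
qed (auto intro!: mult_carrier_mat plane_rot_carrier)

text \<open>For a real angle the adjoint is the rotation by the opposite angle. It is this
  expression, not the conjugate transpose, that is extended to complex angles.\<close>

lemma cadj_plane_rot: "cadj (plane_rot n l (of_real c) (of_real s)) = plane_rot n l (of_real c) (- of_real s)"
  by (rule eq_matI) (auto simp: cadj_def plane_rot_def)

lemma is_unitary_plane_rot:
  assumes "0 < l" "l < n" "c^2 + s^2 = 1"
  shows "is_unitary n (plane_rot n l (of_real c) (of_real s))"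
proof -
  have "complex_of_real c * of_real c + of_real s * of_real s = 1"
    unfolding of_real_mult[symmetric] of_real_add[symmetric] using assms(3) by (simp add: power2_eq_square)
  then show ?thesis
    unfolding is_unitary_def cadj_plane_rot
    by (intro conjI plane_rot_carrier plane_rot_mult assms(1,2)) (simp_all add: mult.commute)
qed

text \<open>Element \<open>i\<close> is paired with the ancilla basis state \<open>i\<close>, so it occupies the basis index \<open>i * m + i\<close>.\<close>

primrec chain_oracle :: "nat \<Rightarrow> nat \<Rightarrow> (nat \<Rightarrow> real \<times> real) \<Rightarrow> nat \<Rightarrow> complex mat" where
  "chain_oracle n m r 0 = 1\<^sub>m n"
| "chain_oracle n m r (Suc k) = chain_oracle n m r k *
     plane_rot n (Suc k * m + Suc k) (of_real (fst (r k))) (of_real (snd (r k)))"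

text \<open>The rotation added last is the rightmost factor and acts first on the start state: it
  settles the share of element \<open>Suc k\<close>, and the earlier rotations distribute the
  remaining amplitude \<open>fst (r k)\<close> among the earlier elements.\<close>

primrec chain_amp :: "(nat \<Rightarrow> real \<times> real) \<Rightarrow> nat \<Rightarrow> nat \<Rightarrow> real" where
  "chain_amp r 0 i = (if i = 0 then 1 else 0)"
| "chain_amp r (Suc k) i = (if i = Suc k then snd (r k) else fst (r k) * chain_amp r k i)"

lemma chain_oracle_carrier: "chain_oracle n m r k \<in> carrier_mat n n"
  by (induction k) (auto intro!: mult_carrier_mat plane_rot_carrier)

lemma chain_oracle_cong:
  "(\<And>i. i < k \<Longrightarrow> r i = r' i) \<Longrightarrow> chain_oracle n m r k = chain_oracle n m r' k"
  by (induction k) auto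

lemma is_unitary_chain_oracle:
  assumes "k * m + k < n" "\<And>i. i < k \<Longrightarrow> (fst (r i))^2 + (snd (r i))^2 = 1"
  shows "is_unitary n (chain_oracle n m r k)"
  using assms
proof (induction k)
  case (Suc k)
  have "is_unitary n (chain_oracle n m r k)" using Suc by simp
  moreover have "is_unitary n (plane_rot n (Suc k * m + Suc k) (of_real (fst (r k))) (of_real (snd (r k))))"
    using Suc.prems by (intro is_unitary_plane_rot) auto
  ultimately show ?case by (simp only: chain_oracle.simps is_unitary_mult)
qed (simp add: is_unitary_one)

text \<open>\<open>A\<close> and \<open>B\<close> are chosen before \<open>c\<close> and
  \<open>s\<close>. This uniformity allows one rotation to be varied, and later made complex, while
  everything around it stays fixed and unitary.\<close>

lemma chain_oracle_factor:
  assumes "k * m + k < n" "\<And>i. i < k \<Longrightarrow> (fst (r i))^2 + (snd (r i))^2 = 1" "i < k"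
  shows "\<exists>A B. is_unitary n A \<and> is_unitary n B \<and>
    (\<forall>c s. chain_oracle n m (r(i := (c, s))) k = A * plane_rot n (Suc i * m + Suc i) (of_real c) (of_real s) * B)"
  using assms
proof (induction k)
  case (Suc k)
  show ?case
  proof (cases "i = k")
    case True
    have A: "is_unitary n (chain_oracle n m r k)" using Suc.prems by (intro is_unitary_chain_oracle) auto
    have "chain_oracle n m (r(i := (c, s))) (Suc k)
        = chain_oracle n m r k * plane_rot n (Suc i * m + Suc i) (of_real c) (of_real s) * 1\<^sub>m n" for c s
      using True chain_oracle_cong[of k "r(i := (c, s))" r n m]
        right_mult_one_mat[OF mult_carrier_mat[OF chain_oracle_carrier[of n m r k] plane_rot_carrier]] by simp
    with A is_unitary_one show ?thesis by blast
  next
    case False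
    have "k * m + k < n" "i < k" using Suc.prems False by auto
    then obtain A B where AB: "is_unitary n A" "is_unitary n B"
      "\<And>c s. chain_oracle n m (r(i := (c, s))) k = A * plane_rot n (Suc i * m + Suc i) (of_real c) (of_real s) * B"
      using Suc.IH Suc.prems(2) less_SucI by blast
    define P where "P = plane_rot n (Suc k * m + Suc k) (of_real (fst (r k))) (of_real (snd (r k)))"
    have P: "is_unitary n P" unfolding P_def using Suc.prems by (intro is_unitary_plane_rot) auto
    have c: "A \<in> carrier_mat n n" "B \<in> carrier_mat n n" "P \<in> carrier_mat n n"
      using AB(1,2) P by (auto dest: is_unitary_carrier)
    have "chain_oracle n m (r(i := (c, s))) (Suc k)
        = A * plane_rot n (Suc i * m + Suc i) (of_real c) (of_real s) * (B * P)" for c s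
      using False assoc_mult_mat[OF mult_carrier_mat[OF c(1) plane_rot_carrier] c(2,3)]
      by (simp add: AB(3) P_def)
    with AB(1) is_unitary_mult[OF AB(2) P] show ?thesis by blast
  qed
qed simp

lemma chain_amp_eq_0: "k < i \<Longrightarrow> chain_amp r k i = 0"
  by (induction k) auto

lemma plane_rot_unit_vec_other:
  assumes "0 < l" "l < n" "j < n" "j \<noteq> 0" "j \<noteq> l"
  shows "plane_rot n l c s *\<^sub>v unit_vec n j = unit_vec n j"
  by (rule eq_vecI) (use assms plane_rot_vec_index[OF unit_vec_carrier assms(1,2), of _ c s j] in
      \<open>auto simp del: index_mult_mat_vec simp: plane_rot_carrier[THEN carrier_matD(1)]\<close>)

lemma chain_oracle_unit_vec_other:
  assumes "k * m + k < j" "j < n"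
  shows "chain_oracle n m r k *\<^sub>v unit_vec n j = unit_vec n j"
  using assms
proof (induction k)
  case (Suc k)
  have "chain_oracle n m r (Suc k) *\<^sub>v unit_vec n j = chain_oracle n m r k *\<^sub>v
      (plane_rot n (Suc k * m + Suc k) (of_real (fst (r k))) (of_real (snd (r k))) *\<^sub>v unit_vec n j)"
    unfolding chain_oracle.simps by (rule assoc_mult_mat_vec[OF chain_oracle_carrier plane_rot_carrier unit_vec_carrier])
  also have "\<dots> = chain_oracle n m r k *\<^sub>v unit_vec n j"
    using Suc.prems by (subst plane_rot_unit_vec_other) auto
  also have "\<dots> = unit_vec n j" using Suc by simp
  finally show ?case .
qed simp

lemma chain_oracle_unit_vec_0:
  assumes "k < m" "k * m + k < n"
  shows "chain_oracle n m r k *\<^sub>v unit_vec n 0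
    = vec n (\<lambda>x. if x div m = x mod m then of_real (chain_amp r k (x div m)) else 0)"
  using assms
proof (induction k)
  case 0
  have iff: "x div m = x mod m \<and> x div m = 0 \<longleftrightarrow> x = 0" for x
    by (metis div_mult_mod_eq mult_0 add_0 div_0 mod_0)
  show ?case
  proof (rule eq_vecI)
    fix x assume "x < dim_vec (vec n (\<lambda>x. if x div m = x mod m then complex_of_real (chain_amp r 0 (x div m)) else 0))"
    then show "(chain_oracle n m r 0 *\<^sub>v unit_vec n 0) $ x
        = vec n (\<lambda>x. if x div m = x mod m then of_real (chain_amp r 0 (x div m)) else 0) $ x"
      using iff[of x] by (cases "x = 0") auto
  qed simp
next
  case (Suc k)
  let ?amp = "(\<lambda>x. if x div m = x mod m then of_real (chain_amp r k (x div m)) else 0)"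
  define l where "l = Suc k * m + Suc k"
  define c where "c = complex_of_real (fst (r k))"
  define s where "s = complex_of_real (snd (r k))"
  have l: "0 < l" "l < n" using Suc.prems by (auto simp: l_def)
  have ldiv: "l div m = Suc k" "l mod m = Suc k"
  proof -
    show "l div m = Suc k" unfolding l_def using Suc.prems(1) by (subst div_mult_self3) auto
    show "l mod m = Suc k" unfolding l_def using Suc.prems(1) by (subst mod_mult_self3) auto
  qed
  have lI: "x = l" if "x div m = x mod m" "x div m = Suc k" for x
    using that div_mult_mod_eq[of x m] by (simp add: l_def)
  have rot: "plane_rot n l c s *\<^sub>v unit_vec n 0 = c \<cdot>\<^sub>v unit_vec n 0 + s \<cdot>\<^sub>v unit_vec n l"
    by (rule eq_vecI) (use l plane_rot_vec_index[OF unit_vec_carrier l, of _ c s 0] in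
      \<open>auto simp del: index_mult_mat_vec simp: plane_rot_carrier[THEN carrier_matD(1)]\<close>)
  have "chain_oracle n m r (Suc k) *\<^sub>v unit_vec n 0 = chain_oracle n m r k *\<^sub>v (plane_rot n l c s *\<^sub>v unit_vec n 0)"
    unfolding chain_oracle.simps l_def c_def s_def
    by (rule assoc_mult_mat_vec[OF chain_oracle_carrier plane_rot_carrier unit_vec_carrier])
  also have "\<dots> = c \<cdot>\<^sub>v (chain_oracle n m r k *\<^sub>v unit_vec n 0) + s \<cdot>\<^sub>v (chain_oracle n m r k *\<^sub>v unit_vec n l)"
    unfolding rot by (simp add: mult_add_distrib_mat_vec[OF chain_oracle_carrier] mult_mat_vec[OF chain_oracle_carrier])
  also have "chain_oracle n m r k *\<^sub>v unit_vec n l = unit_vec n l"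
    by (rule chain_oracle_unit_vec_other) (use l in \<open>auto simp: l_def\<close>)
  also have "chain_oracle n m r k *\<^sub>v unit_vec n 0
      = vec n ?amp"
    using Suc by simp
  also have "c \<cdot>\<^sub>v vec n ?amp + s \<cdot>\<^sub>v unit_vec n l
      = vec n (\<lambda>x. if x div m = x mod m then of_real (chain_amp r (Suc k) (x div m)) else 0)"
  proof (rule eq_vecI)
    fix x assume "x < dim_vec (vec n (\<lambda>x. if x div m = x mod m then complex_of_real (chain_amp r (Suc k) (x div m)) else 0))"
    then have x: "x < n" by simp
    show "(c \<cdot>\<^sub>v vec n ?amp + s \<cdot>\<^sub>v unit_vec n l) $ x
      = vec n (\<lambda>x. if x div m = x mod m then complex_of_real (chain_amp r (Suc k) (x div m)) else 0) $ x"
    proof (cases "x = l")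
      case True
      then show ?thesis using x ldiv chain_amp_eq_0[of k "Suc k" r] by (simp add: s_def)
    next
      case False
      then have "x div m = x mod m \<Longrightarrow> x div m \<noteq> Suc k" using lI by blast
      then show ?thesis using x False l by (auto simp: c_def)
    qed
  qed simp
  finally show ?case .
qed

lemma purified_oracle_chain:
  assumes d: "d = Suc k" "d \<le> m" and r: "\<And>i. i < k \<Longrightarrow> (fst (r i))^2 + (snd (r i))^2 = 1"
  shows "purified_oracle d m (\<lambda>i. (chain_amp r k i)^2) (chain_oracle (d * m) m r k)"
proof -
  have lt: "k * m + k < d * m" using d by simp
  \<comment> \<open>The amplitudes may be negative, since the signs of \<open>c\<close> and
    \<open>s\<close> will be random, whereas the access model prescribes the coefficient sqrt p_i.
    The sign is moved into the ancilla vector.\<close>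
  define \<psi> :: "nat \<Rightarrow> complex vec" where
    "\<psi> i = vec m (\<lambda>j. if j = i then (if chain_amp r k i < 0 then - 1 else 1) else 0)" for i
  have sgn: "complex_of_real (sqrt ((chain_amp r k i)^2)) * (if chain_amp r k i < 0 then - 1 else 1)
      = of_real (chain_amp r k i)" for i
    by simp
  have "cinner (\<psi> i) (\<psi> j) = (if i = j then 1 else 0)" if "i < d" "j < d" for i j
  proof -
    have "cinner (\<psi> i) (\<psi> j) = (\<Sum>x<m. if x = i then (if i = j then 1 else 0) else 0)"
      unfolding cinner_def by (rule sum.cong) (auto simp: \<psi>_def)
    then show ?thesis using that d by simp
  qed
  moreover have "chain_oracle (d * m) m r k *\<^sub>v unit_vec (d * m) 0 =
      vec (d * m) (\<lambda>x. complex_of_real (sqrt ((chain_amp r k (x div m))^2)) * (\<psi> (x div m) $ (x mod m)))"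
  proof -
    have m: "0 < m" "k < m" using d by auto
    show ?thesis
      unfolding chain_oracle_unit_vec_0[OF m(2) lt]
      by (rule eq_vecI) (use m in \<open>auto simp: \<psi>_def\<close>)
  qed
  moreover have "is_unitary (d * m) (chain_oracle (d * m) m r k)"
    by (rule is_unitary_chain_oracle[OF lt r])
  moreover have "dim_vec (\<psi> i) = m" for i by (simp add: \<psi>_def)
  ultimately show ?thesis unfolding purified_oracle_def by blast
qed

section \<open>Polynomial dependence on one rotation\<close>

text \<open>Functions on the complex circle \<open>c^2 + s^2 = 1\<close> that are polynomial in \<open>c\<close> and \<open>s\<close>; averaging
  over the signs of \<open>c\<close> and \<open>s\<close> leaves the component \<open>p\<^sub>0\<close>.\<close>

definition circle_poly :: "(complex \<Rightarrow> complex \<Rightarrow> complex) \<Rightarrow> bool" where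
  "circle_poly g \<longleftrightarrow> (\<exists>p0 p1 p2 p3. \<forall>c s. c^2 + s^2 = 1 \<longrightarrow>
     g c s = poly p0 (s^2) + c * poly p1 (s^2) + s * poly p2 (s^2) + c * s * poly p3 (s^2))"

lemma circle_polyI:
  assumes "\<And>c s. c^2 + s^2 = 1 \<Longrightarrow>
     g c s = poly p0 (s^2) + c * poly p1 (s^2) + s * poly p2 (s^2) + c * s * poly p3 (s^2)"
  shows "circle_poly g"
  unfolding circle_poly_def using assms by blast

lemma circle_poly_const: "circle_poly (\<lambda>c s. a)"
  by (rule circle_polyI[of _ "[:a:]" 0 0 0]) simp

lemma circle_poly_cos: "circle_poly (\<lambda>c s. c)"
  by (rule circle_polyI[of _ 0 1 0 0]) simp

lemma circle_poly_sin: "circle_poly (\<lambda>c s. s)"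
  by (rule circle_polyI[of _ 0 0 1 0]) simp

lemma circle_poly_add:
  assumes "circle_poly f" "circle_poly g"
  shows "circle_poly (\<lambda>c s. f c s + g c s)"
proof -
  obtain p0 p1 p2 p3 where p: "\<And>c s. c^2 + s^2 = 1 \<Longrightarrow>
      f c s = poly p0 (s^2) + c * poly p1 (s^2) + s * poly p2 (s^2) + c * s * poly p3 (s^2)"
    using assms(1) unfolding circle_poly_def by blast
  obtain q0 q1 q2 q3 where q: "\<And>c s. c^2 + s^2 = 1 \<Longrightarrow>
      g c s = poly q0 (s^2) + c * poly q1 (s^2) + s * poly q2 (s^2) + c * s * poly q3 (s^2)"
    using assms(2) unfolding circle_poly_def by blast
  show ?thesis
    by (rule circle_polyI[of _ "p0 + q0" "p1 + q1" "p2 + q2" "p3 + q3"]) (simp add: p q algebra_simps)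
qed

lemma circle_poly_mult:
  assumes "circle_poly f" "circle_poly g"
  shows "circle_poly (\<lambda>c s. f c s * g c s)"
proof -
  obtain p0 p1 p2 p3 where p: "\<And>c s. c^2 + s^2 = 1 \<Longrightarrow>
      f c s = poly p0 (s^2) + c * poly p1 (s^2) + s * poly p2 (s^2) + c * s * poly p3 (s^2)"
    using assms(1) unfolding circle_poly_def by blast
  obtain q0 q1 q2 q3 where q: "\<And>c s. c^2 + s^2 = 1 \<Longrightarrow>
      g c s = poly q0 (s^2) + c * poly q1 (s^2) + s * poly q2 (s^2) + c * s * poly q3 (s^2)"
    using assms(2) unfolding circle_poly_def by blast
  \<comment> \<open>\<open>?u\<close> and \<open>?v\<close> are s^2 and c^2 = 1 - s^2 as polynomials
    in s^2; the four witnesses are the multiplication table of the basis 1, c, s, c s over these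
    polynomials.\<close>
  let ?u = "[:0, 1:] :: complex poly" and ?v = "[:1, -1:] :: complex poly"
  show ?thesis
  proof (rule circle_polyI[of _
        "p0 * q0 + ?v * p1 * q1 + ?u * p2 * q2 + ?u * ?v * p3 * q3"
        "p0 * q1 + p1 * q0 + ?u * (p2 * q3 + p3 * q2)"
        "p0 * q2 + p2 * q0 + ?v * (p1 * q3 + p3 * q1)"
        "p0 * q3 + p3 * q0 + p1 * q2 + p2 * q1"])
    fix c s :: complex assume cs: "c^2 + s^2 = 1"
    define u where "u = s^2"
    have ev: "poly ?u u = u" "poly ?v u = c * c"
      using cs by (simp_all add: u_def algebra_simps power2_eq_square)
    have ss: "s * s = u" by (simp add: u_def power2_eq_square)
    have expand: "(a0 + c * a1 + s * a2 + c * s * a3) * (b0 + c * b1 + s * b2 + c * s * b3)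
      = (a0 * b0 + c * c * a1 * b1 + (s * s) * a2 * b2 + (s * s) * (c * c) * a3 * b3)
        + c * (a0 * b1 + a1 * b0 + (s * s) * (a2 * b3 + a3 * b2))
        + s * (a0 * b2 + a2 * b0 + (c * c) * (a1 * b3 + a3 * b1))
        + c * s * (a0 * b3 + a3 * b0 + a1 * b2 + a2 * b1)" for a0 a1 a2 a3 b0 b1 b2 b3
      by (simp add: algebra_simps)
    show "f c s * g c s =
        poly (p0 * q0 + ?v * p1 * q1 + ?u * p2 * q2 + ?u * ?v * p3 * q3) (s^2)
        + c * poly (p0 * q1 + p1 * q0 + ?u * (p2 * q3 + p3 * q2)) (s^2)
        + s * poly (p0 * q2 + p2 * q0 + ?v * (p1 * q3 + p3 * q1)) (s^2)
        + c * s * poly (p0 * q3 + p3 * q0 + p1 * q2 + p2 * q1) (s^2)"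
      unfolding p[OF cs] q[OF cs] u_def[symmetric] expand poly_add poly_mult ev ss ..
  qed
qed

lemma circle_poly_sum:
  "(\<And>i. i \<in> I \<Longrightarrow> circle_poly (f i)) \<Longrightarrow> circle_poly (\<lambda>c s. \<Sum>i\<in>I. f i c s)"
  by (induction I rule: infinite_finite_induct) (auto intro: circle_poly_const circle_poly_add)

lemma circle_poly_uminus_sin: "circle_poly (\<lambda>c s. - s)"
  using circle_poly_mult[OF circle_poly_const[of "-1"] circle_poly_sin] by simp

text \<open>For real \<open>c\<close> and \<open>s\<close> this is the plain conjugate of
  \<open>g c s\<close>, but conjugating the arguments as well keeps it polynomial in
  \<open>c\<close> and \<open>s\<close>. Squared moduli thus become polynomials.\<close>

lemma circle_poly_cnj:
  assumes "circle_poly g"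
  shows "circle_poly (\<lambda>c s. cnj (g (cnj c) (cnj s)))"
proof -
  obtain p0 p1 p2 p3 where p: "\<And>c s. c^2 + s^2 = 1 \<Longrightarrow>
      g c s = poly p0 (s^2) + c * poly p1 (s^2) + s * poly p2 (s^2) + c * s * poly p3 (s^2)"
    using assms unfolding circle_poly_def by blast
  have pc: "cnj (poly q (cnj z)) = poly (map_poly cnj q) z" for q z
    by (induction q) (simp_all add: map_poly_pCons)
  show ?thesis
  proof (rule circle_polyI[of _ "map_poly cnj p0" "map_poly cnj p1" "map_poly cnj p2" "map_poly cnj p3"])
    fix c s :: complex assume cs: "c^2 + s^2 = 1"
    have "(cnj c)^2 + (cnj s)^2 = cnj (c^2 + s^2)" by simp
    then have "(cnj c)^2 + (cnj s)^2 = 1" using cs by simp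
    note pcs = p[OF this]
    have sq: "(cnj s)^2 = cnj (s^2)" by simp
    show "cnj (g (cnj c) (cnj s)) = poly (map_poly cnj p0) (s^2) + c * poly (map_poly cnj p1) (s^2)
        + s * poly (map_poly cnj p2) (s^2) + c * s * poly (map_poly cnj p3) (s^2)"
      unfolding pcs sq complex_cnj_add complex_cnj_mult pc complex_cnj_cnj ..
  qed
qed

lemma circle_poly_sign_average:
  assumes "circle_poly g"
  obtains P where "\<And>c s. c^2 + s^2 = 1 \<Longrightarrow> poly P (s^2) = (g c s + g (- c) s + g c (- s) + g (- c) (- s)) / 4"
proof -
  obtain p0 p1 p2 p3 where p: "\<And>c s. c^2 + s^2 = 1 \<Longrightarrow>
      g c s = poly p0 (s^2) + c * poly p1 (s^2) + s * poly p2 (s^2) + c * s * poly p3 (s^2)"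
    using assms unfolding circle_poly_def by blast
  show ?thesis
  proof (rule that)
    fix c s :: complex assume cs: "c^2 + s^2 = 1"
    show "poly p0 (s^2) = (g c s + g (- c) s + g c (- s) + g (- c) (- s)) / 4"
      using p[of c s] p[of "- c" s] p[of c "- s"] p[of "- c" "- s"] cs by simp
  qed
qed

section \<open>Matrices, vectors and runs with polynomial entries\<close>

definition circle_poly_mat :: "nat \<Rightarrow> (complex \<Rightarrow> complex \<Rightarrow> complex mat) \<Rightarrow> bool" where
  "circle_poly_mat n M \<longleftrightarrow> (\<forall>c s. M c s \<in> carrier_mat n n) \<and> (\<forall>i<n. \<forall>j<n. circle_poly (\<lambda>c s. M c s $$ (i, j)))"

definition circle_poly_vec :: "nat \<Rightarrow> (complex \<Rightarrow> complex \<Rightarrow> complex vec) \<Rightarrow> bool" where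
  "circle_poly_vec n v \<longleftrightarrow> (\<forall>c s. v c s \<in> carrier_vec n) \<and> (\<forall>i<n. circle_poly (\<lambda>c s. v c s $ i))"

lemma circle_poly_mat_const: "A \<in> carrier_mat n n \<Longrightarrow> circle_poly_mat n (\<lambda>c s. A)"
  by (simp add: circle_poly_mat_def circle_poly_const)

lemma circle_poly_vec_const: "v \<in> carrier_vec n \<Longrightarrow> circle_poly_vec n (\<lambda>c s. v)"
  by (simp add: circle_poly_vec_def circle_poly_const)

lemma circle_poly_mat_mult:
  assumes "circle_poly_mat n A" "circle_poly_mat n B"
  shows "circle_poly_mat n (\<lambda>c s. A c s * B c s)"
  unfolding circle_poly_mat_def
proof (intro conjI allI impI)
  have A: "A c s \<in> carrier_mat n n" and B: "B c s \<in> carrier_mat n n" for c s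
    using assms by (auto simp: circle_poly_mat_def)
  show "A c s * B c s \<in> carrier_mat n n" for c s by (rule mult_carrier_mat[OF A B])
  fix i j assume ij: "i < n" "j < n"
  have "(A c s * B c s) $$ (i, j) = (\<Sum>k<n. A c s $$ (i, k) * B c s $$ (k, j))" for c s
    using A[of c s] B[of c s] ij by (simp add: scalar_prod_def lessThan_atLeast0)
  then show "circle_poly (\<lambda>c s. (A c s * B c s) $$ (i, j))"
    using assms ij by (auto simp: circle_poly_mat_def intro!: circle_poly_sum circle_poly_mult)
qed

lemma circle_poly_mat_mult_vec:
  assumes "circle_poly_mat n A" "circle_poly_vec n v"
  shows "circle_poly_vec n (\<lambda>c s. A c s *\<^sub>v v c s)"
  unfolding circle_poly_vec_def
proof (intro conjI allI impI)
  have A: "A c s \<in> carrier_mat n n" and v: "v c s \<in> carrier_vec n" for c s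
    using assms by (auto simp: circle_poly_mat_def circle_poly_vec_def)
  show "A c s *\<^sub>v v c s \<in> carrier_vec n" for c s by (rule mult_mat_vec_carrier[OF A v])
  fix i assume i: "i < n"
  show "circle_poly (\<lambda>c s. (A c s *\<^sub>v v c s) $ i)"
    unfolding mult_mat_vec_index[OF A v i]
    using assms i by (auto simp: circle_poly_mat_def circle_poly_vec_def intro!: circle_poly_sum circle_poly_mult)
qed

lemma circle_poly_if:
  "circle_poly f \<Longrightarrow> circle_poly g \<Longrightarrow> circle_poly (\<lambda>c s. if b then f c s else g c s)"
  by (cases b) auto

lemma circle_poly_mat_plane_rot:
  "circle_poly_mat n (\<lambda>c s. plane_rot n l c s)" "circle_poly_mat n (\<lambda>c s. plane_rot n l c (- s))"
  by (simp_all add: circle_poly_mat_def plane_rot_def circle_poly_if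
      circle_poly_const circle_poly_cos circle_poly_sin circle_poly_uminus_sin)

lemma circle_poly_vec_apply_query:
  assumes W: "circle_poly_mat dm W" and v: "circle_poly_vec (2 * (dm * w)) v"
  shows "circle_poly_vec (2 * (dm * w)) (\<lambda>c s. apply_query dm w (W c s) t *\<^sub>v v c s)"
  unfolding circle_poly_vec_def
proof (intro conjI allI impI)
  have Wc: "W c s \<in> carrier_mat dm dm" and vc: "v c s \<in> carrier_vec (2 * (dm * w))" for c s
    using assms by (auto simp: circle_poly_mat_def circle_poly_vec_def)
  show "apply_query dm w (W c s) t *\<^sub>v v c s \<in> carrier_vec (2 * (dm * w))" for c s
    by (rule mult_mat_vec_carrier[OF apply_query_carrier[OF Wc] vc])
  fix x assume x: "x < 2 * (dm * w)"
  define q r where "q = x div (dm * w)" and "r = x mod (dm * w)"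
  define a y where "a = r div w" and "y = r mod w"
  have pos: "0 < dm * w" "0 < w" using x by (auto intro: gr0I)
  have q: "q < 2" using x unfolding q_def by (simp add: less_mult_imp_div_less)
  have r: "r < dm * w" unfolding r_def using pos by simp
  have a: "a < dm" using r unfolding a_def by (simp add: less_mult_imp_div_less)
  have y: "y < w" unfolding y_def using pos by simp
  have x_eq: "x = q * (dm * w) + (a * w + y)" 
  proof -
    have "a * w + y = r" by (simp add: a_def y_def)
    then show ?thesis unfolding q_def r_def by (simp only: div_mult_mod_eq)
  qed
  have lt: "q * (dm * w) + (a' * w + y) < 2 * (dm * w)" if "a' < dm" for a'
    using add_mult_lt[OF q add_mult_lt[OF that y]] .
  show "circle_poly (\<lambda>c s. (apply_query dm w (W c s) t *\<^sub>v v c s) $ x)"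
    unfolding x_eq apply_query_index[OF Wc vc q a y]
    using W v a lt[OF a] lt
    by (auto simp: circle_poly_mat_def circle_poly_vec_def intro!: circle_poly_if circle_poly_sum circle_poly_mult)
qed

text \<open>The state recursion with a freely chosen matrix for each query type. Besides the genuine
  oracle and its adjoint it admits their continuations to complex angles, which are not
  unitary.\<close>

primrec run_state :: "nat \<Rightarrow> nat \<Rightarrow> (nat \<Rightarrow> complex mat) \<Rightarrow> (nat \<Rightarrow> nat) \<Rightarrow> (nat \<Rightarrow> complex mat) \<Rightarrow> nat \<Rightarrow> complex vec" where
  "run_state dm w V qt W 0 = V 0 *\<^sub>v unit_vec (2 * (dm * w)) 0"
| "run_state dm w V qt W (Suc k) =
     V (Suc k) *\<^sub>v (apply_query dm w (W (qt (Suc k))) (qt (Suc k)) *\<^sub>v run_state dm w V qt W k)"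

definition oracle_dir :: "complex mat \<Rightarrow> complex mat \<Rightarrow> nat \<Rightarrow> complex mat" where
  "oracle_dir U U' t = (if t = 0 \<or> t = 2 then U else U')"

lemma alg_state_eq_run_state: "alg_state dm w V qt U k = run_state dm w V qt (oracle_dir U (cadj U)) k"
  by (induction k) (simp_all add: query_op_eq oracle_dir_def mult.assoc)

lemma valid_algorithm_unitary:
  "valid_algorithm dm w T V qt \<Longrightarrow> k \<le> T \<Longrightarrow> is_unitary (2 * (dm * w)) (V k)"
  by (simp add: valid_algorithm_def mult.assoc)

lemma run_state_carrier:
  assumes "valid_algorithm dm w T V qt" "\<And>t. W t \<in> carrier_mat dm dm" "k \<le> T"
  shows "run_state dm w V qt W k \<in> carrier_vec (2 * (dm * w))"
  using assms(3)
proof (induction k)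
  case 0
  show ?case unfolding run_state.simps
    by (rule mult_mat_vec_carrier[OF is_unitary_carrier[OF valid_algorithm_unitary[OF assms(1) 0]]]) simp
next
  case (Suc k)
  then show ?case unfolding run_state.simps
    by (intro mult_mat_vec_carrier[OF is_unitary_carrier[OF valid_algorithm_unitary[OF assms(1)]]]
        mult_mat_vec_carrier[OF apply_query_carrier[OF assms(2)]]) auto
qed

lemma vnorm_unit_vec: "i < n \<Longrightarrow> vnorm (unit_vec n i) = 1"
proof -
  assume i: "i < n"
  have "(vnorm (unit_vec n i))^2 = (\<Sum>k<n. if k = i then 1 else 0)"
    unfolding vnorm_power2 using i by (intro sum.cong) auto
  then have "(vnorm (unit_vec n i))^2 = 1^2" using i by simp
  then show ?thesis using vnorm_nonneg[of "unit_vec n i"] by (simp only: power2_eq_iff_nonneg zero_le_one)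
qed

lemma vnorm_run_state_le:
  assumes alg: "valid_algorithm dm w T V qt" "0 < dm" and W: "\<And>t. W t \<in> carrier_mat dm dm"
    and \<kappa>: "1 \<le> \<kappa>" "\<And>t x. x \<in> carrier_vec dm \<Longrightarrow> vnorm (W t *\<^sub>v x) \<le> \<kappa> * vnorm x"
    and k: "k \<le> T"
  shows "vnorm (run_state dm w V qt W k) \<le> \<kappa> ^ k"
  using k
proof (induction k)
  case 0
  have "0 < 2 * (dm * w)" using alg by (simp add: valid_algorithm_def)
  then show ?case
    using vnorm_unitary[OF valid_algorithm_unitary[OF alg(1) 0] unit_vec_carrier, of 0]
    by (simp add: vnorm_unit_vec)
next
  case (Suc k)
  have c: "run_state dm w V qt W k \<in> carrier_vec (2 * (dm * w))"
    using run_state_carrier[OF alg(1) W] Suc.prems by simp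
  have "vnorm (run_state dm w V qt W (Suc k))
      = vnorm (apply_query dm w (W (qt (Suc k))) (qt (Suc k)) *\<^sub>v run_state dm w V qt W k)"
    unfolding run_state.simps
    by (rule vnorm_unitary[OF valid_algorithm_unitary[OF alg(1) Suc.prems]
          mult_mat_vec_carrier[OF apply_query_carrier[OF W] c]])
  also have "\<dots> \<le> \<kappa> * vnorm (run_state dm w V qt W k)"
    by (rule vnorm_apply_query_le[OF W c \<kappa>])
  also have "\<dots> \<le> \<kappa> * \<kappa> ^ k" using Suc \<kappa>(1) by (intro mult_left_mono) auto
  finally show ?case by simp
qed

text \<open>The difference inherited from the earlier steps does not grow, as queries of the first
  run are contractions; the new query adds at most \<delta>, as the state of the second run has norm
  at most 1.\<close>

lemma vnorm_run_state_diff_le: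
  assumes alg: "valid_algorithm dm w T V qt" "0 < dm"
    and W: "\<And>t. W t \<in> carrier_mat dm dm" "\<And>t. W' t \<in> carrier_mat dm dm"
    and iso: "\<And>t x. x \<in> carrier_vec dm \<Longrightarrow> vnorm (W t *\<^sub>v x) \<le> vnorm x"
      "\<And>t x. x \<in> carrier_vec dm \<Longrightarrow> vnorm (W' t *\<^sub>v x) \<le> vnorm x"
    and \<delta>: "0 \<le> \<delta>" "\<And>t x. x \<in> carrier_vec dm \<Longrightarrow> vnorm (W t *\<^sub>v x - W' t *\<^sub>v x) \<le> \<delta> * vnorm x"
    and k: "k \<le> T"
  shows "vnorm (run_state dm w V qt W k - run_state dm w V qt W' k) \<le> k * \<delta>"
  using k
proof (induction k)
  case 0
  have "V 0 *\<^sub>v unit_vec (2 * (dm * w)) 0 \<in> carrier_vec (2 * (dm * w))"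
    using run_state_carrier[OF alg(1) W(1) 0] by simp
  then show ?case by (simp add: vnorm_def L2_set_def del: index_mult_mat_vec)
next
  case (Suc k)
  let ?N = "2 * (dm * w)" and ?t = "qt (Suc k)"
  define f g where "f = run_state dm w V qt W k" and "g = run_state dm w V qt W' k"
  have c: "f \<in> carrier_vec ?N" "g \<in> carrier_vec ?N"
    unfolding f_def g_def using run_state_carrier[OF alg(1) W(1)] run_state_carrier[OF alg(1) W(2)] Suc.prems by auto
  define A A' where "A = apply_query dm w (W ?t) ?t" and "A' = apply_query dm w (W' ?t) ?t"
  have Ac: "A \<in> carrier_mat ?N ?N" "A' \<in> carrier_mat ?N ?N"
    unfolding A_def A'_def by (rule apply_query_carrier[OF W(1)], rule apply_query_carrier[OF W(2)])
  note Av = mult_mat_vec_carrier[OF Ac(1)] mult_mat_vec_carrier[OF Ac(2)]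
  have U: "is_unitary ?N (V (Suc k))" by (rule valid_algorithm_unitary[OF alg(1) Suc.prems])
  have "vnorm (run_state dm w V qt W (Suc k) - run_state dm w V qt W' (Suc k)) = vnorm (V (Suc k) *\<^sub>v (A *\<^sub>v f - A' *\<^sub>v g))"
    unfolding run_state.simps A_def[symmetric] A'_def[symmetric] f_def[symmetric] g_def[symmetric]
    by (rule arg_cong[where f = vnorm],
        rule mult_minus_distrib_mat_vec[OF is_unitary_carrier[OF U] Av(1)[OF c(1)] Av(2)[OF c(2)], symmetric])
  also have "\<dots> = vnorm (A *\<^sub>v f - A' *\<^sub>v g)"
    by (rule vnorm_unitary[OF U minus_carrier_vec[OF Av(1)[OF c(1)] Av(2)[OF c(2)]]])
  also have "A *\<^sub>v f - A' *\<^sub>v g = A *\<^sub>v (f - g) + (A *\<^sub>v g - A' *\<^sub>v g)"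
    unfolding mult_minus_distrib_mat_vec[OF Ac(1) c]
    by (rule eq_vecI) (use carrier_matD(1)[OF Ac(1)] carrier_matD(1)[OF Ac(2)] in
        \<open>auto simp: index_minus_vec(1) simp del: index_mult_mat_vec\<close>)
  also have "vnorm (A *\<^sub>v (f - g) + (A *\<^sub>v g - A' *\<^sub>v g)) \<le> vnorm (A *\<^sub>v (f - g)) + vnorm (A *\<^sub>v g - A' *\<^sub>v g)"
    by (rule vnorm_triangle[OF Av(1)[OF minus_carrier_vec[OF c]] minus_carrier_vec[OF Av(1)[OF c(2)] Av(2)[OF c(2)]]])
  also have "vnorm (A *\<^sub>v (f - g)) \<le> 1 * vnorm (f - g)"
    unfolding A_def by (rule vnorm_apply_query_le[OF W(1) minus_carrier_vec[OF c]]) (use iso in auto)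
  also have "vnorm (f - g) \<le> k * \<delta>" using Suc by (simp add: f_def g_def)
  also have "vnorm (A *\<^sub>v g - A' *\<^sub>v g) \<le> \<delta> * vnorm g"
    unfolding A_def A'_def by (rule vnorm_apply_query_diff_le[OF W c(2) \<delta>])
  also have "\<delta> * vnorm g \<le> \<delta> * 1"
    unfolding g_def using vnorm_run_state_le[OF alg W(2), where \<kappa> = 1 and k = k] iso(2) Suc.prems \<delta>(1)
    by (intro mult_left_mono) auto
  finally show ?case by (simp add: algebra_simps)
qed

lemma circle_poly_run_state:
  assumes alg: "valid_algorithm dm w T V qt" and W: "\<And>t. circle_poly_mat dm (\<lambda>c s. W c s t)" and k: "k \<le> T"
  shows "circle_poly_vec (2 * (dm * w)) (\<lambda>c s. run_state dm w V qt (W c s) k)"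
  using k
proof (induction k)
  case 0
  show ?case unfolding run_state.simps
    by (intro circle_poly_vec_const mult_mat_vec_carrier[OF is_unitary_carrier[OF valid_algorithm_unitary[OF alg 0]]]) simp
next
  case (Suc k)
  then show ?case unfolding run_state.simps
    by (intro circle_poly_mat_mult_vec circle_poly_vec_apply_query W
        circle_poly_mat_const[OF is_unitary_carrier[OF valid_algorithm_unitary[OF alg]]]) auto
qed

text \<open>Cauchy's estimate with the integral replaced by the mean over M equally spaced points of
  the circle. This is exact because M exceeds every |i - k| with i <= degree P, so no other
  coefficient is aliased onto the k-th.\<close>

lemma poly_coeff_bound:
  fixes P :: "complex poly"
  assumes \<rho>: "0 < \<rho>" and bound: "\<And>z. cmod z = \<rho> \<Longrightarrow> cmod (poly P z) \<le> B"
  shows "cmod (coeff P k) * \<rho> ^ k \<le> B"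
proof -
  define M where "M = degree P + k + 1"
  have M: "0 < M" by (simp add: M_def)
  let ?e = "\<lambda>i j. cis (2 * pi * of_int (int i - int k) * real j / real M)"
  define \<theta> where "\<theta> j = 2 * pi * real j / real M" for j
  define z where "z j = of_real \<rho> * cis (\<theta> j)" for j
  let ?s = "(\<Sum>j<M. poly P (z j) * cis (- (real k * \<theta> j)))"
  have "?s
      = (\<Sum>j<M. \<Sum>i\<le>degree P. coeff P i * of_real (\<rho> ^ i) * ?e i j)"
  proof (rule sum.cong[OF refl])
    fix j
    have "z j ^ i * cis (- (real k * \<theta> j)) = of_real (\<rho> ^ i) * ?e i j" for i
    proof -
      have "real i * \<theta> j + - (real k * \<theta> j) = 2 * pi * of_int (int i - int k) * real j / real M"
        by (simp add: \<theta>_def algebra_simps diff_divide_distrib)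
      then show ?thesis
        unfolding z_def power_mult_distrib Complex.DeMoivre mult.assoc cis_mult by simp
    qed
    then show "poly P (z j) * cis (- (real k * \<theta> j))
        = (\<Sum>i\<le>degree P. coeff P i * of_real (\<rho> ^ i) * ?e i j)"
      unfolding poly_altdef sum_distrib_right by (simp add: mult.assoc)
  qed
  also have "\<dots> = (\<Sum>i\<le>degree P. coeff P i * of_real (\<rho> ^ i) *
        (\<Sum>j<M. ?e i j))"
    by (subst sum.swap) (simp only: sum_distrib_left)
  also have "\<dots> = (\<Sum>i\<le>degree P. if i = k then coeff P k * of_real (\<rho> ^ k) * of_nat M else 0)"
  proof (rule sum.cong[OF refl])
    fix i assume "i \<in> {..degree P}"
    then have lt: "\<bar>int i - int k\<bar> < \<bar>int M\<bar>" by (auto simp: M_def)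
    have "int M dvd int i - int k \<longleftrightarrow> i = k"
      using dvd_imp_le_int[of "int i - int k" "int M"] lt by (cases "i = k") auto
    then show "coeff P i * of_real (\<rho> ^ i) * (\<Sum>j<M. ?e i j)
        = (if i = k then coeff P k * of_real (\<rho> ^ k) * of_nat M else 0)"
      unfolding sum_cis_roots_of_unity[OF M] by auto
  qed
  also have "\<dots> = coeff P k * of_real (\<rho> ^ k) * of_nat M"
    by (cases "k \<le> degree P") (auto simp: coeff_eq_0)
  finally have eq: "?s = coeff P k * of_real (\<rho> ^ k) * of_nat M" .
  have "cmod (coeff P k) * \<rho> ^ k * real M = cmod ?s"
    unfolding eq norm_mult using \<rho> by (simp add: norm_power)
  also have "\<dots> \<le> (\<Sum>j<M. cmod (poly P (z j) * cis (- (real k * \<theta> j))))"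
    by (rule norm_sum)
  also have "\<dots> \<le> (\<Sum>j<M. B)"
    using \<rho> by (intro sum_mono) (simp add: norm_mult bound z_def)
  finally have "real M * (cmod (coeff P k) * \<rho> ^ k) \<le> real M * B" by (simp add: mult_ac)
  then show ?thesis using M by simp
qed

text \<open>Powers below K drop out. From K on, a coefficient of size at most B / \<rho>^k meets a
  moment difference of at most 2 b^k, and the resulting geometric series has ratio b / \<rho> <= 1 /
  2, hence sum at most twice its first term.\<close>

lemma poly_moment_difference:
  fixes P :: "complex poly" and u v w :: "nat \<Rightarrow> real"
  assumes \<rho>: "0 < \<rho>" and bound: "\<And>z. cmod z = \<rho> \<Longrightarrow> cmod (poly P z) \<le> B"
    and vw: "prob_weight I v" "prob_weight I w" and u: "\<And>j. 0 \<le> u j" "\<And>j. u j \<le> b" "2 * b \<le> \<rho>"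
    and moments: "\<And>k. k < K \<Longrightarrow> (\<Sum>j\<in>I. v j * u j ^ k) = (\<Sum>j\<in>I. w j * u j ^ k)"
  shows "cmod (\<Sum>j\<in>I. of_real (v j - w j) * poly P (of_real (u j))) \<le> 4 * B * (b / \<rho>) ^ K"
proof -
  define \<theta> where "\<theta> = b / \<rho>"
  have \<theta>: "0 \<le> \<theta>" "\<theta> \<le> 1 / 2" using u(1,2)[of 0] u(3) \<rho> by (auto simp: \<theta>_def field_simps)
  have "cmod (poly P (of_real \<rho>)) \<le> B" by (rule bound) (use \<rho> in simp)
  then have B0: "0 \<le> B" by (rule order.trans[OF norm_ge_zero])
  define m where "m k = (\<Sum>j\<in>I. (v j - w j) * u j ^ k)" for k
  have m0: "m k = 0" if "k < K" for k
    using moments[OF that] by (simp add: m_def left_diff_distrib sum_subtractf)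
  have w_bound: "\<bar>\<Sum>j\<in>I. q j * u j ^ k\<bar> \<le> b ^ k" if "prob_weight I q" for q k
  proof -
    have q: "\<And>j. j \<in> I \<Longrightarrow> 0 \<le> q j" "sum q I = 1" using that by (auto simp: prob_weight_def)
    have "\<bar>\<Sum>j\<in>I. q j * u j ^ k\<bar> = (\<Sum>j\<in>I. q j * u j ^ k)"
      using q u by (intro abs_of_nonneg sum_nonneg) auto
    also have "\<dots> \<le> (\<Sum>j\<in>I. q j * b ^ k)"
      using q u by (intro sum_mono mult_left_mono power_mono) auto
    also have "\<dots> = b ^ k" using q by (simp flip: sum_distrib_right)
    finally show ?thesis .
  qed
  have mb: "\<bar>m k\<bar> \<le> 2 * b ^ k" for k
    using w_bound[OF vw(1), of k] w_bound[OF vw(2), of k]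
    by (simp add: m_def left_diff_distrib sum_subtractf)
  have "(\<Sum>j\<in>I. of_real (v j - w j) * poly P (of_real (u j))) = (\<Sum>k\<le>degree P. coeff P k * of_real (m k))"
    unfolding poly_altdef sum_distrib_left m_def of_real_sum
    by (subst sum.swap) (simp add: mult_ac)
  also have "cmod \<dots> \<le> (\<Sum>k\<le>degree P. cmod (coeff P k) * \<bar>m k\<bar>)"
    by (rule order.trans[OF norm_sum]) (simp add: norm_mult)
  also have "\<dots> \<le> (\<Sum>k\<le>degree P. if K \<le> k then 2 * B * \<theta> ^ k else 0)"
  proof (rule sum_mono)
    fix k
    show "cmod (coeff P k) * \<bar>m k\<bar> \<le> (if K \<le> k then 2 * B * \<theta> ^ k else 0)"
    proof (cases "K \<le> k")
      case True
      have "cmod (coeff P k) * \<bar>m k\<bar> \<le> cmod (coeff P k) * (2 * b ^ k)"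
        by (rule mult_left_mono[OF mb]) simp
      also have "\<dots> = 2 * (cmod (coeff P k) * \<rho> ^ k) * \<theta> ^ k"
        using \<rho> by (simp add: \<theta>_def power_divide)
      also have "\<dots> \<le> 2 * B * \<theta> ^ k"
        using poly_coeff_bound[OF \<rho> bound] \<theta> by (intro mult_right_mono mult_left_mono) auto
      finally show ?thesis using True by simp
    qed (simp add: m0)
  qed
  also have "\<dots> = (\<Sum>k\<in>{K..degree P}. 2 * B * \<theta> ^ k)"
    by (subst sum.inter_filter[symmetric]) (auto intro!: sum.cong)
  also have "\<dots> \<le> (\<Sum>k\<in>{K..<K + Suc (degree P)}. 2 * B * \<theta> ^ k)"
    using B0 \<theta> by (intro sum_mono2) auto
  also have "\<dots> = (\<Sum>i<Suc (degree P). 2 * B * \<theta> ^ K * \<theta> ^ i)"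
    using sum.shift_bounds_nat_ivl[of "\<lambda>k. 2 * B * \<theta> ^ k" 0 K "Suc (degree P)"]
    by (simp add: lessThan_atLeast0 add.commute power_add mult_ac)
  also have "\<dots> \<le> (\<Sum>i<Suc (degree P). 2 * B * \<theta> ^ K * (1 / 2) ^ i)"
    using B0 \<theta> by (intro sum_mono mult_left_mono power_mono) auto
  also have "\<dots> = 2 * B * \<theta> ^ K * (\<Sum>i<Suc (degree P). (1 / 2) ^ i)"
    by (simp only: sum_distrib_left)
  also have "\<dots> \<le> 2 * B * \<theta> ^ K * 2"
  proof (rule mult_left_mono)
    have "(\<Sum>i<n. (1 / 2 :: real) ^ i) = 2 - 2 * (1 / 2) ^ n" for n
      by (induction n) (simp_all add: field_simps)
    then show "(\<Sum>i<Suc (degree P). (1 / 2 :: real) ^ i) \<le> 2" by (simp only:) simp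
  qed (use B0 \<theta> in simp)
  finally show ?thesis by (simp add: \<theta>_def)
qed

definition accept_prob :: "nat \<Rightarrow> nat set \<Rightarrow> complex vec \<Rightarrow> real" where
  "accept_prob n X v = (\<Sum>x\<in>X \<inter> {..<n}. (cmod (v $ x))^2)"

lemma success_prob_eq:
  "success_prob dm w T V qt out U S
    = accept_prob (2 * (dm * w)) {x. S (out x)} (run_state dm w V qt (oracle_dir U (cadj U)) T)"
proof -
  have "{x. S (out x)} \<inter> {..<2 * (dm * w)} = {x \<in> {..<2 * (dm * w)}. S (out x)}" by auto
  then show ?thesis
    unfolding success_prob_def accept_prob_def alg_state_eq_run_state mult.assoc
    by (simp only:) (rule sum.inter_filter[symmetric], simp)
qed

lemma circle_poly_mat_oracle_dir:
  assumes "A \<in> carrier_mat n n" "B \<in> carrier_mat n n"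
  shows "circle_poly_mat n (\<lambda>c s. oracle_dir (A * plane_rot n l c s * B) (cadj B * plane_rot n l c (- s) * cadj A) t)"
proof -
  have "cadj A \<in> carrier_mat n n" "cadj B \<in> carrier_mat n n" using assms by (auto simp: cadj_def)
  then show ?thesis
    unfolding oracle_dir_def using assms
    by (cases "t = 0 \<or> t = 2") (auto intro!: circle_poly_mat_mult circle_poly_mat_const circle_poly_mat_plane_rot)
qed

lemma cadj_factor:
  assumes "A \<in> carrier_mat n n" "B \<in> carrier_mat n n"
  shows "cadj (A * plane_rot n l (of_real c) (of_real s) * B) = cadj B * plane_rot n l (of_real c) (- of_real s) * cadj A"
proof -
  have c: "cadj A \<in> carrier_mat n n" "cadj B \<in> carrier_mat n n" using assms by (auto simp: cadj_def)
  show ?thesis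
    unfolding cadj_mult[OF mult_carrier_mat[OF assms(1) plane_rot_carrier] assms(2)]
      cadj_mult[OF assms(1) plane_rot_carrier] cadj_plane_rot
    by (rule assoc_mult_mat[OF c(2) plane_rot_carrier c(1), symmetric])
qed

lemma vnorm_factor_le:
  assumes A: "is_unitary n A" and B: "is_unitary n B" and x: "x \<in> carrier_vec n" and R: "R \<in> carrier_mat n n"
    and le: "\<And>y. y \<in> carrier_vec n \<Longrightarrow> vnorm (R *\<^sub>v y) \<le> \<kappa> * vnorm y"
  shows "vnorm (A * R * B *\<^sub>v x) \<le> \<kappa> * vnorm x"
proof -
  note c = is_unitary_carrier[OF A] is_unitary_carrier[OF B]
  have "A * R * B *\<^sub>v x = A *\<^sub>v (R *\<^sub>v (B *\<^sub>v x))"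
    by (simp add: assoc_mult_mat_vec[OF mult_carrier_mat[OF c(1) R] c(2) x]
        assoc_mult_mat_vec[OF c(1) R mult_mat_vec_carrier[OF c(2) x]])
  then have "vnorm (A * R * B *\<^sub>v x) = vnorm (R *\<^sub>v (B *\<^sub>v x))"
    using vnorm_unitary[OF A mult_mat_vec_carrier[OF R mult_mat_vec_carrier[OF c(2) x]]] by simp
  also have "\<dots> \<le> \<kappa> * vnorm (B *\<^sub>v x)" by (rule le[OF mult_mat_vec_carrier[OF c(2) x]])
  finally show ?thesis using vnorm_unitary[OF B x] by simp
qed

text \<open>The values at real angles determine the polynomial, but its growth is controlled at
  complex ones: each of the T queries multiplies the norm by at most exp (sqrt |z|), and the
  probability is quadratic in the state. The dimension and the degree do not enter.\<close>

lemma accept_prob_polynomial: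
  fixes X :: "nat set"
  assumes alg: "valid_algorithm dm w T V qt" "0 < dm" and l: "0 < l" "l < dm"
    and AB: "is_unitary dm A" "is_unitary dm B"
  defines "acc \<equiv> \<lambda>c s. accept_prob (2 * (dm * w)) X
      (run_state dm w V qt (oracle_dir (A * plane_rot dm l (of_real c) (of_real s) * B)
        (cadj (A * plane_rot dm l (of_real c) (of_real s) * B))) T)"
  obtains P :: "complex poly" where
    "\<And>c s. c^2 + s^2 = 1 \<Longrightarrow> poly P (of_real (s^2)) = of_real ((acc c s + acc (- c) s + acc c (- s) + acc (- c) (- s)) / 4)"
    "\<And>z. cmod (poly P z) \<le> exp (2 * real T * sqrt (cmod z))"
proof -
  let ?N = "2 * (dm * w)"
  let ?U = "\<lambda>c s. A * plane_rot dm l (of_real c) (of_real s) * B"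
  \<comment> \<open>The inverse query equals the adjoint for real \<open>c\<close> and
    \<open>s\<close> but contains neither of them conjugated.\<close>
  define W where "W c s t = oracle_dir (A * plane_rot dm l c s * B) (cadj B * plane_rot dm l c (- s) * cadj A) t" for c s t
  define \<Psi> where "\<Psi> c s = run_state dm w V qt (W c s) T" for c s
  note ABc = is_unitary_carrier[OF AB(1)] is_unitary_carrier[OF AB(2)]
  have Wpoly: "circle_poly_mat dm (\<lambda>c s. W c s t)" for t
    unfolding W_def by (rule circle_poly_mat_oracle_dir[OF ABc])
  then have Wc: "W c s t \<in> carrier_mat dm dm" for c s t by (simp add: circle_poly_mat_def)
  have \<Psi>poly: "circle_poly_vec ?N \<Psi>"
    unfolding \<Psi>_def by (rule circle_poly_run_state[OF alg(1) Wpoly]) simp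
  then have \<Psi>c: "\<Psi> c s \<in> carrier_vec ?N" for c s by (simp add: circle_poly_vec_def)
  \<comment> \<open>Not the squared norm at complex arguments: the second factor is the conjugate of
    the state at conjugated arguments, which makes \<open>g\<close> polynomial and agrees with the
    squared norm on the reals.\<close>
  define g where "g c s = (\<Sum>x\<in>X \<inter> {..<?N}. \<Psi> c s $ x * cnj (\<Psi> (cnj c) (cnj s) $ x))" for c s
  have gpoly: "circle_poly g"
    unfolding g_def using \<Psi>poly
    by (auto simp: circle_poly_vec_def intro!: circle_poly_sum circle_poly_mult circle_poly_cnj)
  have g_real: "g (of_real c) (of_real s) = of_real (acc c s)" for c s
  proof -
    have "(\<lambda>t. W (of_real c) (of_real s) t) = oracle_dir (?U c s)
        (cadj (?U c s))"
      unfolding W_def cadj_factor[OF ABc] ..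
    then show ?thesis
      unfolding g_def acc_def accept_prob_def \<Psi>_def of_real_sum complex_norm_square by simp
  qed
  have \<Psi>bound: "vnorm (\<Psi> c s) \<le> exp (sqrt (cmod z)) ^ T" if cs: "c^2 + s^2 = 1" "s^2 = z" for c s z
  proof -
    define a where "a = sqrt (cmod z)"
    have a: "0 \<le> a" "a^2 = cmod z" by (auto simp: a_def)
    have s: "cmod s = a" unfolding a_def cs(2)[symmetric] by (simp add: norm_power)
    \<comment> \<open>With |s| = a this leads to |c| + |s| <= 1 + a + a^2 / 2 <= exp a, which
      dominates the moduli of both eigenvalues of the rotation.\<close>
    have "c^2 = 1 - z" using cs by (simp add: eq_diff_eq)
    then have "(cmod c)^2 = cmod (1 - z)" by (simp flip: norm_power)
    also have "\<dots> \<le> 1 + a^2" using norm_triangle_ineq4[of 1 z] a by simp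
    also have "\<dots> \<le> (1 + a^2 / 2)^2" unfolding power2_sum by simp
    finally have "cmod c \<le> 1 + a^2 / 2" by (rule power2_le_imp_le) simp
    then have "cmod c + cmod s \<le> exp a"
      using exp_lower_Taylor_quadratic[OF a(1)] s by linarith
    then have k: "cmod (c + \<i> * (\<sigma> * s)) \<le> exp a" "cmod (c - \<i> * (\<sigma> * s)) \<le> exp a" if "cmod \<sigma> = 1" for \<sigma>
      using norm_triangle_ineq[of c "\<i> * (\<sigma> * s)"] norm_triangle_ineq4[of c "\<i> * (\<sigma> * s)"] that
      by (auto simp: norm_mult)
    have e1: "1 \<le> exp a" using a by simp
    have R: "vnorm (plane_rot dm l c s *\<^sub>v y) \<le> exp a * vnorm y"
      "vnorm (plane_rot dm l c (- s) *\<^sub>v y) \<le> exp a * vnorm y" if "y \<in> carrier_vec dm" for y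
      using vnorm_plane_rot_le[OF that l e1, of c s] vnorm_plane_rot_le[OF that l e1, of c "- s"] k[of 1] k[of "-1"] by auto
    have "vnorm (W c s t *\<^sub>v x) \<le> exp a * vnorm x" if "x \<in> carrier_vec dm" for t x
      unfolding W_def oracle_dir_def
      using vnorm_factor_le[OF AB that plane_rot_carrier R(1)]
        vnorm_factor_le[OF is_unitary_cadj[OF AB(2)] is_unitary_cadj[OF AB(1)] that plane_rot_carrier R(2)] by simp
    from vnorm_run_state_le[OF alg Wc e1 this] show ?thesis unfolding \<Psi>_def a_def by simp
  qed
  have gbound: "cmod (g c s) \<le> exp (2 * real T * sqrt (cmod z))" if cs: "c^2 + s^2 = 1" "s^2 = z" for c s z
  proof -
    have cs': "(cnj c)^2 + (cnj s)^2 = 1" "(cnj s)^2 = cnj z"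
      using arg_cong[OF cs(1), of cnj] arg_cong[OF cs(2), of cnj] by simp_all
    have "cmod (g c s) \<le> (\<Sum>x\<in>X \<inter> {..<?N}. cmod (\<Psi> c s $ x) * cmod (\<Psi> (cnj c) (cnj s) $ x))"
      unfolding g_def by (rule order.trans[OF norm_sum]) (simp add: norm_mult)
    also have "\<dots> \<le> (\<Sum>x<?N. cmod (\<Psi> c s $ x) * cmod (\<Psi> (cnj c) (cnj s) $ x))"
      by (rule sum_mono2) auto
    also have "\<dots> \<le> vnorm (\<Psi> c s) * vnorm (\<Psi> (cnj c) (cnj s))"
      using L2_set_mult_ineq[of "\<lambda>x. cmod (\<Psi> c s $ x)" "\<lambda>x. cmod (\<Psi> (cnj c) (cnj s) $ x)" "{..<?N}"]
      by (simp add: vnorm_def carrier_vecD[OF \<Psi>c])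
    also have "\<dots> \<le> exp (sqrt (cmod z)) ^ T * exp (sqrt (cmod z)) ^ T"
      using \<Psi>bound[OF cs] \<Psi>bound[OF cs'] by (intro mult_mono) (auto simp: vnorm_nonneg)
    also have "\<dots> = exp (2 * real T * sqrt (cmod z))"
      by (simp flip: exp_of_nat_mult exp_add)
    finally show ?thesis .
  qed
  obtain P where P: "\<And>c s. c^2 + s^2 = 1 \<Longrightarrow> poly P (s^2) = (g c s + g (- c) s + g c (- s) + g (- c) (- s)) / 4"
    using circle_poly_sign_average[OF gpoly] by blast
  show ?thesis
  proof (rule that[of P])
    fix c s :: real assume "c^2 + s^2 = 1"
    then have "(complex_of_real c)^2 + (of_real s)^2 = 1" by (simp flip: of_real_power of_real_add)
    from P[OF this] show "poly P (of_real (s^2)) = of_real ((acc c s + acc (- c) s + acc c (- s) + acc (- c) (- s)) / 4)"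
      using g_real[of c s] g_real[of "- c" s] g_real[of c "- s"] g_real[of "- c" "- s"] by simp
  next
    fix z :: complex
    \<comment> \<open>Any choice of roots will do, since the bound on \<open>g\<close> is the same
      for all four sign patterns.\<close>
    define s c where "s = csqrt z" and "c = csqrt (1 - z)"
    have cs: "c^2 + s^2 = 1" "s^2 = z" by (simp_all add: s_def c_def)
    define e where "e = exp (2 * real T * sqrt (cmod z))"
    have "cmod (g c s) \<le> e" "cmod (g (- c) s) \<le> e" "cmod (g c (- s)) \<le> e" "cmod (g (- c) (- s)) \<le> e"
      unfolding e_def using gbound[of c s z] gbound[of "- c" s z] gbound[of c "- s" z] gbound[of "- c" "- s" z] cs
      by (simp_all only: power2_minus)
    then have "cmod (g c s + g (- c) s + g c (- s) + g (- c) (- s)) \<le> 4 * e"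
      using norm_triangle_ineq[of "g c s + g (- c) s + g c (- s)" "g (- c) (- s)"]
        norm_triangle_ineq[of "g c s + g (- c) s" "g c (- s)"] norm_triangle_ineq[of "g c s" "g (- c) s"] by linarith
    then show "cmod (poly P z) \<le> exp (2 * real T * sqrt (cmod z))"
      unfolding P[OF cs(1), unfolded cs(2)] norm_divide e_def by simp
  qed
qed

section \<open>The lower bounds\<close>

lemma chain_amp_distribution:
  assumes "\<And>i. i < k \<Longrightarrow> (fst (r i))^2 + (snd (r i))^2 = 1"
  shows "(\<Sum>i<Suc k. (chain_amp r k i)^2) = 1"
    and "shannon_entropy (Suc k) (\<lambda>i. (chain_amp r k i)^2) = chain_entropy (\<lambda>i. (snd (r i))^2) k"
  using assms
proof (induction k)
  case 0
  { case 1 show ?case by simp }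
  { case 2 show ?case by (simp add: shannon_entropy_def) }
next
  case (Suc k)
  define c s where "c = (fst (r k))^2" and "s = (snd (r k))^2"
  define p where "p i = (chain_amp r k i)^2" for i
  have amp: "(chain_amp r (Suc k) i)^2 = (if i = Suc k then s else c * p i)" for i
    by (simp add: c_def s_def p_def power_mult_distrib)
  {
    case 1
    have "sum p {..<Suc k} = 1" unfolding p_def using Suc.IH(1) 1 by simp
    then have "(\<Sum>i<Suc (Suc k). (chain_amp r (Suc k) i)^2) = c + s"
      unfolding amp sum.lessThan_Suc[of _ "Suc k"] by (simp flip: sum_distrib_left)
    then show ?case using 1[of k] by (simp add: c_def s_def)
  next
    case 2
    have cs: "c = 1 - s" using 2[of k] by (simp add: c_def s_def)
    have sum_p: "sum p {..<Suc k} = 1" unfolding p_def using Suc.IH(1) 2 by simp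
    have H: "- (\<Sum>i<Suc k. p i * ln (p i)) = chain_entropy (\<lambda>i. (snd (r i))^2) k"
      using Suc.IH(2) 2 by (simp add: shannon_entropy_def p_def)
    have "c * p i * ln (c * p i) = c * ln c * p i + c * (p i * ln (p i))" for i
      by (cases "c = 0 \<or> p i = 0") (auto simp: ln_mult algebra_simps)
    then have "(\<Sum>i<Suc k. c * p i * ln (c * p i)) = c * ln c * sum p {..<Suc k} + c * (\<Sum>i<Suc k. p i * ln (p i))"
      by (simp only: sum.distrib sum_distrib_left)
    then have "shannon_entropy (Suc (Suc k)) (\<lambda>i. (chain_amp r (Suc k) i)^2)
        = - (c * ln c) + c * (- (\<Sum>i<Suc k. p i * ln (p i))) - s * ln s"
      unfolding shannon_entropy_def amp sum.lessThan_Suc[of _ "Suc k"] sum_p by (simp add: algebra_simps)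
    then show ?case unfolding H cs by (simp add: binary_entropy_def s_def[symmetric])
  }
qed

lemma is_distribution_chain:
  assumes "\<And>i. i < k \<Longrightarrow> (fst (r i))^2 + (snd (r i))^2 = 1"
  shows "is_distribution (Suc k) (\<lambda>i. (chain_amp r k i)^2)"
  unfolding is_distribution_def using chain_amp_distribution(1)[of k r, OF assms] by simp

definition estimates_entropy :: "nat \<Rightarrow> nat \<Rightarrow> nat \<Rightarrow> nat \<Rightarrow> (nat \<Rightarrow> complex mat) \<Rightarrow> (nat \<Rightarrow> nat) \<Rightarrow> (nat \<Rightarrow> real) \<Rightarrow> real \<Rightarrow> bool" where
  "estimates_entropy d m w T V qt out \<epsilon> \<longleftrightarrow> valid_algorithm (d * m) w T V qt \<and>
     (\<forall>p U. is_distribution d p \<longrightarrow> purified_oracle d m p U \<longrightarrow>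
        success_prob (d * m) w T V qt out U (\<lambda>y. \<bar>y - shannon_entropy d p\<bar> \<le> \<epsilon>) \<ge> 2/3)"

lemma estimates_entropy_chain:
  assumes "estimates_entropy (Suc k) m w T V qt out \<epsilon>" "Suc k \<le> m"
    and "\<And>i. i < k \<Longrightarrow> (fst (r i))^2 + (snd (r i))^2 = 1"
  shows "success_prob (Suc k * m) w T V qt out (chain_oracle (Suc k * m) m r k)
           (\<lambda>y. \<bar>y - chain_entropy (\<lambda>i. (snd (r i))^2) k\<bar> \<le> \<epsilon>) \<ge> 2/3"
proof -
  have "is_distribution (Suc k) (\<lambda>i. (chain_amp r k i)^2)"
    by (rule is_distribution_chain) (rule assms(3))
  moreover have "purified_oracle (Suc k) m (\<lambda>i. (chain_amp r k i)^2) (chain_oracle (Suc k * m) m r k)"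
    by (rule purified_oracle_chain[OF refl assms(2)]) (rule assms(3))
  moreover have "shannon_entropy (Suc k) (\<lambda>i. (chain_amp r k i)^2) = chain_entropy (\<lambda>i. (snd (r i))^2) k"
    by (rule chain_amp_distribution(2)) (rule assms(3))
  ultimately show ?thesis using assms(1) unfolding estimates_entropy_def by metis
qed

lemma success_prob_unitary:
  assumes alg: "valid_algorithm dm w T V qt" "0 < dm" and U: "is_unitary dm U"
  shows "0 \<le> success_prob dm w T V qt out U S"
    and "(\<And>y. S y \<Longrightarrow> S' y) \<Longrightarrow> success_prob dm w T V qt out U S \<le> success_prob dm w T V qt out U S'"
    and "(\<And>y. \<not> (S y \<and> S' y)) \<Longrightarrow> success_prob dm w T V qt out U S + success_prob dm w T V qt out U S' \<le> 1"
    and "success_prob dm w T V qt out U S \<le> 1"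
proof -
  define v where "v = run_state dm w V qt (oracle_dir U (cadj U)) T"
  let ?n = "(\<Sum>x<2 * (dm * w). (cmod (v $ x))^2)"
  have Wu: "is_unitary dm (oracle_dir U (cadj U) t)" for t
    using U is_unitary_cadj[OF U] by (simp add: oracle_dir_def)
  note Wc = is_unitary_carrier[OF Wu]
  have vc: "v \<in> carrier_vec (2 * (dm * w))" unfolding v_def by (rule run_state_carrier[OF alg(1) Wc]) simp
  have "vnorm v \<le> 1 ^ T"
    unfolding v_def by (rule vnorm_run_state_le[OF alg Wc]) (use vnorm_unitary[OF Wu] in auto)
  then have "(vnorm v)^2 \<le> 1" using vnorm_nonneg[of v] by (simp add: power_le_one)
  then have total: "?n \<le> 1" using vc by (simp add: vnorm_power2)
  have sp: "success_prob dm w T V qt out U R = (\<Sum>x<2 * (dm * w). if R (out x) then (cmod (v $ x))^2 else 0)" for R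
    unfolding success_prob_def alg_state_eq_run_state v_def mult.assoc ..
  show "0 \<le> success_prob dm w T V qt out U S" unfolding sp by (intro sum_nonneg) auto
  show "success_prob dm w T V qt out U S \<le> success_prob dm w T V qt out U S'" if "\<And>y. S y \<Longrightarrow> S' y"
    unfolding sp by (intro sum_mono) (use that in auto)
  have "success_prob dm w T V qt out U S \<le> ?n"
    unfolding sp by (intro sum_mono) auto
  then show "success_prob dm w T V qt out U S \<le> 1" using total by linarith
  show "success_prob dm w T V qt out U S + success_prob dm w T V qt out U S' \<le> 1" if "\<And>y. \<not> (S y \<and> S' y)"
  proof -
    have "success_prob dm w T V qt out U S + success_prob dm w T V qt out U S' \<le> ?n"
      unfolding sp sum.distrib[symmetric] by (intro sum_mono) (use that in auto)
    then show ?thesis using total by linarith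
  qed
qed

section \<open>The term with sqrt d: two priors that few queries cannot tell apart\<close>

lemma sum_signs:
  fixes f :: "'a \<times> real \<times> real \<Rightarrow> 'b::comm_monoid_add"
  assumes "finite I"
  shows "(\<Sum>a\<in>I \<times> {1, -1} \<times> {1, -1}. f a) = (\<Sum>j\<in>I. f (j, 1, 1) + f (j, -1, 1) + f (j, 1, -1) + f (j, -1, -1))"
proof -
  have "(\<Sum>a\<in>I \<times> {1, -1} \<times> {1, -1}. f a) = (\<Sum>j\<in>I. \<Sum>\<sigma>\<in>{1, -1}. \<Sum>\<tau>\<in>{1, -1}. f (j, \<sigma>, \<tau>))"
    by (simp only: sum.cartesian_product case_prod_unfold prod.collapse)
  also have "\<dots> = (\<Sum>j\<in>I. f (j, 1, 1) + f (j, -1, 1) + f (j, 1, -1) + f (j, -1, -1))"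
    by (rule sum.cong) (auto simp: ac_simps)
  finally show ?thesis .
qed

lemma prob_weight_signs:
  fixes v :: "nat \<Rightarrow> real"
  assumes "prob_weight I v"
  shows "prob_weight (I \<times> {1, -1 :: real} \<times> {1, -1 :: real}) (\<lambda>a. v (fst a) / 4)"
    and "(\<Sum>a\<in>I \<times> {1, -1 :: real} \<times> {1, -1 :: real}. v (fst a) / 4 * f (fst a)) = (\<Sum>j\<in>I. v j * f j)"
  using assms sum_signs[of I "\<lambda>a. v (fst a) / 4"] sum_signs[of I "\<lambda>a. v (fst a) / 4 * f (fst a)"]
  by (auto simp: prob_weight_def mult.commute)

text \<open>The two laws trade places in the last claim: entropy contains - u ln u, so the larger
  mean of u ln u under \<open>v\<close> means the smaller entropy. The part - (1 - u) ln (1 - u)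
  contributes almost equally because the means of \<open>u\<close> agree.\<close>

lemma entropy_prior_bounds:
  fixes u v w :: "nat \<Rightarrow> real"
  assumes v: "prob_weight I v" and w: "prob_weight I w" and n: "n \<ge> 1" and b: "0 < b" "b \<le> 1 / 1024"
    and u: "\<And>j. 0 \<le> u j" "\<And>j. u j \<le> b"
    and \<mu>: "(\<Sum>j\<in>I. v j * u j) \<le> 8 * b / (real n)^2"
    and eq: "(\<Sum>j\<in>I. v j * u j) = (\<Sum>j\<in>I. w j * u j)"
  shows "\<And>q. q = v \<or> q = w \<Longrightarrow> (\<Sum>j\<in>I. q j * (u j)^2) \<le> b * (8 * b / (real n)^2)"
    and "\<And>q. q = v \<or> q = w \<Longrightarrow>
      (\<Sum>j\<in>I. q j * (binary_entropy (u j))^2) \<le> 25 * sqrt b * (8 * b / (real n)^2)"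
    and "b / (64 * (real n)^2) \<le> (\<Sum>j\<in>I. v j * (u j * ln (u j))) - (\<Sum>j\<in>I. w j * (u j * ln (u j)))
      \<Longrightarrow> b / (128 * (real n)^2) \<le> (\<Sum>j\<in>I. w j * binary_entropy (u j)) - (\<Sum>j\<in>I. v j * binary_entropy (u j))"
proof -
  have q0: "0 \<le> q j" if "q = v \<or> q = w" "j \<in> I" for q j
    using v w that by (auto simp: prob_weight_def)
  have \<mu>q: "(\<Sum>j\<in>I. q j * u j) \<le> 8 * b / (real n)^2" if "q = v \<or> q = w" for q
    using that \<mu> eq by auto
  have u1: "u j < 1" for j using u(2)[of j] b by simp
  show sq: "(\<Sum>j\<in>I. q j * (u j)^2) \<le> b * (8 * b / (real n)^2)" if q: "q = v \<or> q = w" for q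
  proof -
    have "(\<Sum>j\<in>I. q j * (u j)^2) \<le> (\<Sum>j\<in>I. b * (q j * u j))"
    proof (rule sum_mono)
      fix j assume j: "j \<in> I"
      have "(q j * u j) * u j \<le> (q j * u j) * b"
        using q0[OF q j] u by (intro mult_left_mono) auto
      then show "q j * (u j)^2 \<le> b * (q j * u j)" by (simp add: power2_eq_square mult_ac)
    qed
    also have "\<dots> \<le> b * (8 * b / (real n)^2)"
      unfolding sum_distrib_left[symmetric] using \<mu>q[OF q] b by (intro mult_left_mono) auto
    finally show ?thesis .
  qed
  show "(\<Sum>j\<in>I. q j * (binary_entropy (u j))^2) \<le> 25 * sqrt b * (8 * b / (real n)^2)" if q: "q = v \<or> q = w" for q
  proof -
    have "(\<Sum>j\<in>I. q j * (binary_entropy (u j))^2) \<le> (\<Sum>j\<in>I. 25 * sqrt b * (q j * u j))"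
    proof (rule sum_mono)
      fix j assume j: "j \<in> I"
      have "(binary_entropy (u j))^2 \<le> 25 * (u j * sqrt (u j))"
        by (rule binary_entropy_power2_le[OF u(1) u1])
      also have "\<dots> \<le> 25 * (u j * sqrt b)"
        using u by (intro mult_left_mono) auto
      finally have "q j * (binary_entropy (u j))^2 \<le> q j * (25 * (u j * sqrt b))"
        by (rule mult_left_mono[OF _ q0[OF q j]])
      then show "q j * (binary_entropy (u j))^2 \<le> 25 * sqrt b * (q j * u j)" by (simp add: mult_ac)
    qed
    also have "\<dots> \<le> 25 * sqrt b * (8 * b / (real n)^2)"
      unfolding sum_distrib_left[symmetric] using \<mu>q[OF q] b by (intro mult_left_mono) auto
    finally show ?thesis .
  qed
  show "b / (128 * (real n)^2) \<le> (\<Sum>j\<in>I. w j * binary_entropy (u j)) - (\<Sum>j\<in>I. v j * binary_entropy (u j))"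
    if gap: "b / (64 * (real n)^2) \<le> (\<Sum>j\<in>I. v j * (u j * ln (u j))) - (\<Sum>j\<in>I. w j * (u j * ln (u j)))"
  proof -
    define h where "h x = - ((1 - x) * ln (1 - x))" for x :: real
    have split: "(\<Sum>j\<in>I. q j * binary_entropy (u j)) = (\<Sum>j\<in>I. q j * h (u j)) - (\<Sum>j\<in>I. q j * (u j * ln (u j)))" for q
      by (simp add: binary_entropy_def h_def algebra_simps sum.distrib sum_subtractf)
    have "(\<Sum>j\<in>I. w j * (u j - (u j)^2)) \<le> (\<Sum>j\<in>I. w j * h (u j))"
      using one_minus_ln_bounds(1)[OF u(1) u1] q0[of w] unfolding h_def by (intro sum_mono mult_left_mono) auto
    moreover have "(\<Sum>j\<in>I. w j * (u j - (u j)^2)) = (\<Sum>j\<in>I. w j * u j) - (\<Sum>j\<in>I. w j * (u j)^2)"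
      by (simp add: right_diff_distrib sum_subtractf)
    moreover have "(\<Sum>j\<in>I. v j * h (u j)) \<le> (\<Sum>j\<in>I. v j * u j)"
      using one_minus_ln_bounds(2)[OF u(1) u1] q0[of v] unfolding h_def by (intro sum_mono mult_left_mono) auto
    moreover have "(\<Sum>j\<in>I. w j * (u j)^2) \<le> b * (8 * b / (real n)^2)" by (rule sq) simp
    \<comment> \<open>Here the bound b <= 1 / 1024 is used up: the quadratic error takes at most
      half of the gap.\<close>
    moreover have "b * (8 * b / (real n)^2) \<le> b / (128 * (real n)^2)"
    proof -
      have "b * (8 * b / (real n)^2) = (8 * b) * (b / (real n)^2)" by simp
      also have "\<dots> \<le> (1 / 128) * (b / (real n)^2)" using b by (intro mult_right_mono) auto
      finally show ?thesis by simp
    qed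
    moreover have "b / (64 * (real n)^2) = b / (128 * (real n)^2) + b / (128 * (real n)^2)" using n by (simp add: field_simps)
    ultimately show ?thesis unfolding split using gap eq by linarith
  qed
qed

text \<open>Each numerical hypothesis feeds one estimate. \<open>queries\<close> keeps the
  polynomial below exp n on the circle of radius 16 b; \<open>real k \<le> exp (real n)\<close> pays
  for k replacements; \<open>mass\<close> keeps (1 - \<mu>)^k at least 1/2 by Bernoulli's
  inequality; \<open>gap\<close> then separates the mean entropies by more than 4 \<epsilon>;
  \<open>variance\<close> makes the failure probability in Chebyshev's inequality at most
  1/20.\<close>

lemma moment_matching_contradiction:
  assumes est: "estimates_entropy (Suc k) m w T V qt out \<epsilon>" and m: "Suc k \<le> m" and \<epsilon>: "0 < \<epsilon>"
    and n: "9 \<le> n" "real k \<le> exp (real n)" and b: "0 < b" "b \<le> 1 / 1024"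
    and queries: "8 * real T * sqrt b \<le> real n"
    and mass: "8 * real k * b / (real n)^2 \<le> 1 / 2"
    and gap: "4 * \<epsilon> < real k * b / (256 * (real n)^2)"
    and variance: "real k * (2 * (25 * sqrt b * (8 * b / (real n)^2)) * (1 + b * (8 * b / (real n)^2) * (real k)^2)) \<le> \<epsilon>^2 / 20"
  shows False
proof -
  define dm where "dm = Suc k * m"
  have alg: "valid_algorithm dm w T V qt" using est by (simp add: estimates_entropy_def dm_def)
  have dm: "0 < dm" "k * m + k < dm" using m by (auto simp: dm_def)
  have n1: "n \<ge> 1" using n by simp
  obtain u v v' :: "nat \<Rightarrow> real" where
    pw: "prob_weight {..<8 * n} v" "prob_weight {..<8 * n} v'"
    and u: "\<And>j. 0 \<le> u j" "\<And>j. u j \<le> b"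
    and moments: "\<And>k. k \<le> 2 * n + 1 \<Longrightarrow> (\<Sum>j<8 * n. v j * u j ^ k) = (\<Sum>j<8 * n. v' j * u j ^ k)"
    and \<mu>: "(\<Sum>j<8 * n. v j * u j) \<le> 8 * b / (real n)^2"
    and lngap: "b / (64 * (real n)^2) \<le> (\<Sum>j<8 * n. v j * (u j * ln (u j))) - (\<Sum>j<8 * n. v' j * (u j * ln (u j)))"
    by (rule moment_matching[OF n1 b(1)], rule that)
  have \<mu>eq: "(\<Sum>j<8 * n. v j * u j) = (\<Sum>j<8 * n. v' j * u j)" using moments[of 1] by simp
  have u1: "u j < 1" for j using u(2)[of j] b by simp
  define A where "A = {..<8 * n} \<times> {1, -1 :: real} \<times> {1, -1 :: real}"
  define lift :: "(nat \<Rightarrow> real) \<Rightarrow> nat \<times> real \<times> real \<Rightarrow> real" where "lift q a = q (fst a) / 4" for q a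
  define g :: "nat \<times> real \<times> real \<Rightarrow> real" where "g a = u (fst a)" for a
  define cs :: "nat \<times> real \<times> real \<Rightarrow> real \<times> real" where
    "cs a = (fst (snd a) * sqrt (1 - u (fst a)), snd (snd a) * sqrt (u (fst a)))" for a
  have A: "prob_weight A (lift v)" "prob_weight A (lift v')"
    unfolding A_def lift_def[abs_def] using prob_weight_signs(1) pw by auto
  have lift_sum: "(\<Sum>a\<in>A. lift q a * f (u (fst a))) = (\<Sum>j<8 * n. q j * f (u j))" if "q = v \<or> q = v'" for q f
    unfolding A_def lift_def using prob_weight_signs(2)[of "{..<8 * n}" q "\<lambda>j. f (u j)"] that pw by auto
  have g: "0 \<le> g a" "g a < 1" for a using u u1 by (auto simp: g_def)
  have circle: "(fst (cs a))^2 + (snd (cs a))^2 = 1" "(snd (cs a))^2 = g a" if "a \<in> A" for a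
  proof -
    have "0 \<le> u (fst a)" "0 \<le> 1 - u (fst a)" using u(1) u1[of "fst a"] by auto
    then show "(fst (cs a))^2 + (snd (cs a))^2 = 1" "(snd (cs a))^2 = g a"
      using that by (auto simp: A_def cs_def g_def power_mult_distrib)
  qed
  define H where "H x = chain_entropy (\<lambda>i. g (x i)) k" for x
  define h1 h2 where "h1 = chain_mean A (lift v) g k" and "h2 = chain_mean A (lift v') g k"
  \<comment> \<open>The window of radius 2 \<epsilon> around \<open>h1\<close> contains every good
    answer when the entropy is within \<epsilon> of \<open>h1\<close>, and none when it is within
    \<epsilon> of \<open>h2\<close>, since h2 - h1 > 4 \<epsilon>.\<close>
  define F where "F x = success_prob dm w T V qt out (chain_oracle dm m (\<lambda>i. cs (x i)) k) (\<lambda>y. \<bar>y - h1\<bar> \<le> 2 * \<epsilon>)" for x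
  note bounds = entropy_prior_bounds[OF pw n1 b u \<mu> \<mu>eq]

  have "4 * \<epsilon> < h2 - h1"
  proof -
    define \<mu>1 where "\<mu>1 = (\<Sum>j<8 * n. v j * u j)"
    define \<delta> where "\<delta> = b / (128 * (real n)^2)"
    have \<mu>0: "0 \<le> \<mu>1" unfolding \<mu>1_def using pw u by (intro sum_nonneg) (auto simp: prob_weight_def)
    have \<mu>k: "real k * \<mu>1 \<le> 1 / 2"
    proof -
      have "real k * \<mu>1 \<le> real k * (8 * b / (real n)^2)" using \<mu> by (intro mult_left_mono) (auto simp: \<mu>1_def)
      also have "\<dots> \<le> 1 / 2" using mass by (simp add: mult_ac)
      finally show ?thesis .
    qed
    have k1: "1 \<le> k" using gap \<epsilon> by (cases k) auto
    have "\<mu>1 \<le> real k * \<mu>1" using k1 \<mu>0 by (simp add: mult_le_cancel_right1)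
    then have \<mu>1: "\<mu>1 \<le> 1" using \<mu>k by linarith
    have "real k * \<delta> * (1 - \<mu>1) ^ k \<le> h2 - h1"
      unfolding h1_def h2_def
    proof (rule chain_mean_gap[OF A _ _ \<mu>0 \<mu>1])
      show "(\<Sum>a\<in>A. lift v a * g a) = \<mu>1" using lift_sum[of v "\<lambda>x. x"] by (simp add: g_def \<mu>1_def)
      show "(\<Sum>a\<in>A. lift v' a * g a) = \<mu>1" using lift_sum[of v' "\<lambda>x. x"] by (simp add: g_def \<mu>1_def \<mu>eq)
      show "\<delta> \<le> (\<Sum>a\<in>A. lift v' a * binary_entropy (g a)) - (\<Sum>a\<in>A. lift v a * binary_entropy (g a))"
        using bounds(3)[OF lngap] lift_sum[of v binary_entropy] lift_sum[of v' binary_entropy] by (simp add: g_def \<delta>_def)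
      show "0 \<le> \<delta>" using b by (simp add: \<delta>_def)
    qed
    moreover have "real k * \<delta> * (1 / 2) \<le> real k * \<delta> * (1 - \<mu>1) ^ k"
    proof (rule mult_left_mono)
      have "1 + real k * (- \<mu>1) \<le> (1 + (- \<mu>1)) ^ k" by (rule Bernoulli_inequality) (use \<mu>1 in simp)
      then show "1 / 2 \<le> (1 - \<mu>1) ^ k" using \<mu>k by simp
      show "0 \<le> real k * \<delta>" using b by (simp add: \<delta>_def)
    qed
    moreover have "real k * \<delta> * (1 / 2) = real k * b / (256 * (real n)^2)" by (simp add: \<delta>_def)
    ultimately show ?thesis using gap by linarith
  qed
  note h12 = this

  have var: "prod_expect A (lift q) k (\<lambda>x. (H x - chain_mean A (lift q) g k)^2) \<le> \<epsilon>^2 / 20" if q: "q = v \<or> q = v'" for q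
  proof -
    have Aq: "prob_weight A (lift q)" using q A by auto
    have "prod_expect A (lift q) k (\<lambda>x. (H x - chain_mean A (lift q) g k)^2)
      \<le> k * (2 * (25 * sqrt b * (8 * b / (real n)^2)) * (1 + b * (8 * b / (real n)^2) * (real k)^2))"
      unfolding H_def
    proof (rule chain_entropy_variance[OF Aq g])
      show "(\<Sum>a\<in>A. lift q a * (binary_entropy (g a))^2) \<le> 25 * sqrt b * (8 * b / (real n)^2)"
        using bounds(2)[OF q] lift_sum[OF q, of "\<lambda>x. (binary_entropy x)^2"] by (simp add: g_def)
      show "(\<Sum>a\<in>A. lift q a * (g a)^2) \<le> b * (8 * b / (real n)^2)"
        using bounds(1)[OF q] lift_sum[OF q, of "\<lambda>x. x^2"] by (simp add: g_def)
    qed simp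
    then show ?thesis using variance by linarith
  qed

  have unitary: "is_unitary dm (chain_oracle dm m (\<lambda>i. cs (x i)) k)" if "\<forall>i<k. x i \<in> A" for x
    by (rule is_unitary_chain_oracle[OF dm(2)]) (use circle(1) that in auto)
  have success: "2/3 \<le> success_prob dm w T V qt out (chain_oracle dm m (\<lambda>i. cs (x i)) k) (\<lambda>y. \<bar>y - H x\<bar> \<le> \<epsilon>)"
    if "\<forall>i<k. x i \<in> A" for x
  proof -
    have "chain_entropy (\<lambda>i. (snd (cs (x i)))^2) k = H x"
      unfolding H_def by (rule chain_entropy_cong) (use circle(2) that in auto)
    then show ?thesis
      using estimates_entropy_chain[OF est m, of "\<lambda>i. cs (x i)"] circle(1) that by (simp add: dm_def)
  qed

  \<comment> \<open>Chebyshev's inequality in pointwise form: if \<open>H x\<close> is farther than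
    \<epsilon> from its mean, the quadratic term is at least 1 and the claim is trivial.
    Expectations can then be taken on both sides.\<close>
  have lower: "2 / 3 - (1 / \<epsilon>^2) * (H x - h1)^2 \<le> F x" if x: "\<forall>i<k. x i \<in> A" for x
  proof (cases "\<bar>H x - h1\<bar> \<le> \<epsilon>")
    case True
    have "2 / 3 \<le> F x"
      unfolding F_def
      by (rule order.trans[OF success[OF x] success_prob_unitary(2)[OF alg dm(1) unitary[OF x]]]) (use True in auto)
    moreover have "0 \<le> (1 / \<epsilon>^2) * (H x - h1)^2" by simp
    ultimately show ?thesis by linarith
  next
    case False
    then have "\<epsilon>^2 \<le> \<bar>H x - h1\<bar>^2" using \<epsilon> by (intro power_mono) auto
    then have "1 \<le> (1 / \<epsilon>^2) * (H x - h1)^2" using \<epsilon> by (simp add: field_simps)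
    moreover have "0 \<le> F x" unfolding F_def by (rule success_prob_unitary(1)[OF alg dm(1) unitary[OF x]])
    ultimately show ?thesis by linarith
  qed
  have upper: "F x \<le> 1 / 3 + (1 / \<epsilon>^2) * (H x - h2)^2" if x: "\<forall>i<k. x i \<in> A" for x
  proof (cases "\<bar>H x - h2\<bar> \<le> \<epsilon>")
    case True
    have "F x + success_prob dm w T V qt out (chain_oracle dm m (\<lambda>i. cs (x i)) k) (\<lambda>y. \<bar>y - H x\<bar> \<le> \<epsilon>) \<le> 1"
      unfolding F_def by (rule success_prob_unitary(3)[OF alg dm(1) unitary[OF x]]) (use True h12 \<epsilon> in linarith)
    then have "F x \<le> 1 / 3" using success[OF x] by linarith
    moreover have "0 \<le> (1 / \<epsilon>^2) * (H x - h2)^2" by simp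
    ultimately show ?thesis by linarith
  next
    case False
    then have "\<epsilon>^2 \<le> \<bar>H x - h2\<bar>^2" using \<epsilon> by (intro power_mono) auto
    then have "1 \<le> (1 / \<epsilon>^2) * (H x - h2)^2" using \<epsilon> by (simp add: field_simps)
    moreover have "F x \<le> 1" unfolding F_def by (rule success_prob_unitary(4)[OF alg dm(1) unitary[OF x]])
    ultimately show ?thesis by linarith
  qed

  have w0: "\<And>a. a \<in> A \<Longrightarrow> 0 \<le> lift v a" "\<And>a. a \<in> A \<Longrightarrow> 0 \<le> lift v' a"
    using A by (auto simp: prob_weight_def)
  have E1: "2 / 3 - 1 / 20 \<le> prod_expect A (lift v) k F"
  proof -
    have "2 / 3 - (1 / \<epsilon>^2) * prod_expect A (lift v) k (\<lambda>x. (H x - h1)^2) \<le> prod_expect A (lift v) k F"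
      using prod_expect_mono[of A "lift v" k "\<lambda>x. 2 / 3 - (1 / \<epsilon>^2) * (H x - h1)^2" F, OF w0(1) lower]
      by (simp add: prod_expect_diff prod_expect_cmult[of _ _ _ "1 / \<epsilon>^2", simplified] prod_expect_const[OF A(1)])
    moreover have "(1 / \<epsilon>^2) * prod_expect A (lift v) k (\<lambda>x. (H x - h1)^2) \<le> (1 / \<epsilon>^2) * (\<epsilon>^2 / 20)"
      using var[of v] by (intro mult_left_mono) (auto simp: h1_def)
    moreover have "(1 / \<epsilon>^2) * (\<epsilon>^2 / 20) = 1 / 20" using \<epsilon> by simp
    ultimately show ?thesis by linarith
  qed
  have E2: "prod_expect A (lift v') k F \<le> 1 / 3 + 1 / 20"
  proof -
    have "prod_expect A (lift v') k F \<le> 1 / 3 + (1 / \<epsilon>^2) * prod_expect A (lift v') k (\<lambda>x. (H x - h2)^2)"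
      using prod_expect_mono[of A "lift v'" k F "\<lambda>x. 1 / 3 + (1 / \<epsilon>^2) * (H x - h2)^2", OF w0(2) upper]
      by (simp add: prod_expect_add prod_expect_cmult[of _ _ _ "1 / \<epsilon>^2", simplified] prod_expect_const[OF A(2)])
    moreover have "(1 / \<epsilon>^2) * prod_expect A (lift v') k (\<lambda>x. (H x - h2)^2) \<le> (1 / \<epsilon>^2) * (\<epsilon>^2 / 20)"
      using var[of v'] by (intro mult_left_mono) (auto simp: h2_def)
    moreover have "(1 / \<epsilon>^2) * (\<epsilon>^2 / 20) = 1 / 20" using \<epsilon> by simp
    ultimately show ?thesis by linarith
  qed

  have "\<bar>prod_expect A (lift v) k F - prod_expect A (lift v') k F\<bar> \<le> k * exp (- 2 * real n)"
  proof (rule prod_expect_replace[OF A])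
    fix i and x :: "nat \<Rightarrow> nat \<times> real \<times> real"
    assume i: "i < k" and x: "\<forall>j<k. x j \<in> A"
    define l where "l = Suc i * m + Suc i"
    have l: "0 < l" "l < dm"
    proof -
      have "Suc i * m + Suc i \<le> k * m + k" using i by (intro add_mono mult_right_mono) auto
      then show "0 < l" "l < dm" using dm(2) by (auto simp: l_def)
    qed
    obtain B C where BC: "is_unitary dm B" "is_unitary dm C"
      "\<And>c s. chain_oracle dm m ((\<lambda>i. cs (x i))(i := (c, s))) k = B * plane_rot dm l (of_real c) (of_real s) * C"
      using chain_oracle_factor[OF dm(2), of "\<lambda>i. cs (x i)" i] circle(1) x i unfolding l_def by blast
    define X where "X = {y. \<bar>out y - h1\<bar> \<le> 2 * \<epsilon>}"
    define acc where "acc c s = accept_prob (2 * (dm * w)) X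
      (run_state dm w V qt (oracle_dir (B * plane_rot dm l (of_real c) (of_real s) * C)
        (cadj (B * plane_rot dm l (of_real c) (of_real s) * C))) T)" for c s :: real
    have Fx: "F (x(i := a)) = acc (fst (cs a)) (snd (cs a))" for a
    proof -
      have "(\<lambda>j. cs ((x(i := a)) j)) = (\<lambda>j. cs (x j))(i := (fst (cs a), snd (cs a)))" by auto
      then show ?thesis unfolding F_def success_prob_eq acc_def X_def by (simp only: BC(3))
    qed
    obtain P :: "complex poly" where P:
      "\<And>c s. c^2 + s^2 = 1 \<Longrightarrow> poly P (of_real (s^2)) = of_real ((acc c s + acc (- c) s + acc c (- s) + acc (- c) (- s)) / 4)"
      "\<And>z. cmod (poly P z) \<le> exp (2 * real T * sqrt (cmod z))"
      using accept_prob_polynomial[OF alg dm(1) l BC(1,2), of X] unfolding acc_def by blast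
    \<comment> \<open>The four sign patterns carry weight 1/4 each, so summing over them produces
      exactly the sign average that \<open>P\<close> represents.\<close>
    have "(\<Sum>a\<in>A. (lift v a - lift v' a) * F (x(i := a)))
        = (\<Sum>j<8 * n. (v j - v' j) * Re (poly P (of_real (u j))))"
      unfolding A_def sum_signs[OF finite_lessThan]
    proof (rule sum.cong[OF refl])
      fix j
      define c s where "c = sqrt (1 - u j)" and "s = sqrt (u j)"
      have c2: "c^2 + s^2 = 1" "s^2 = u j" using u(1)[of j] u1[of j] by (auto simp: c_def s_def)
      have e: "cs (j, 1, 1) = (c, s)" "cs (j, -1, 1) = (- c, s)" "cs (j, 1, -1) = (c, - s)" "cs (j, -1, -1) = (- c, - s)"
        by (auto simp: cs_def c_def s_def)
      have "Re (poly P (of_real (u j))) = (acc c s + acc (- c) s + acc c (- s) + acc (- c) (- s)) / 4"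
        unfolding P(1)[OF c2(1), unfolded c2(2)] by (rule Re_complex_of_real)
      then show "(lift v (j, 1, 1) - lift v' (j, 1, 1)) * F (x(i := (j, 1, 1))) +
          (lift v (j, -1, 1) - lift v' (j, -1, 1)) * F (x(i := (j, -1, 1))) +
          (lift v (j, 1, -1) - lift v' (j, 1, -1)) * F (x(i := (j, 1, -1))) +
          (lift v (j, -1, -1) - lift v' (j, -1, -1)) * F (x(i := (j, -1, -1)))
        = (v j - v' j) * Re (poly P (of_real (u j)))"
        unfolding Fx e fst_conv snd_conv lift_def by (simp add: algebra_simps add_divide_distrib diff_divide_distrib)
    qed
    also have "\<dots> = Re (\<Sum>j<8 * n. of_real (v j - v' j) * poly P (of_real (u j)))" by simp
    finally have "\<bar>\<Sum>a\<in>A. (lift v a - lift v' a) * F (x(i := a))\<bar>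
        \<le> cmod (\<Sum>j<8 * n. of_real (v j - v' j) * poly P (of_real (u j)))"
      by (simp only: abs_Re_le_cmod)
    \<comment> \<open>Radius 16 b: its root is 4 sqrt b, so the growth exponent is 8 T sqrt b <= n,
      while 2 n + 2 matched moments (counting the zeroth) give 16^(- 2 n - 2) = 256^(- n - 1), far
      below exp (- 3 n).\<close>
    also have "\<dots> \<le> 4 * exp (real n) * (b / (16 * b)) ^ (2 * n + 2)"
    proof (rule poly_moment_difference[OF _ _ pw u])
      show "0 < 16 * b" "2 * b \<le> 16 * b" using b by auto
      show "cmod (poly P z) \<le> exp (real n)" if "cmod z = 16 * b" for z
      proof -
        have "sqrt (16 * b) = 4 * sqrt b" using real_sqrt_mult[of 16 b] by simp
        then have "2 * real T * sqrt (cmod z) \<le> real n" unfolding that using queries by simp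
        then show ?thesis using P(2)[of z] by (meson exp_le_cancel_iff order_trans)
      qed
    qed (use moments in auto)
    also have "\<dots> \<le> exp (- 2 * real n)"
    proof -
      have "exp (1::real) ^ 3 \<le> 3 ^ 3" using exp_le by (intro power_mono) auto
      then have "(exp 1 ^ 3) ^ n \<le> (256::real) ^ n" by (intro power_mono) auto
      then have "exp (3 * real n) \<le> 256 ^ n" by (simp flip: exp_of_nat_mult exp_of_nat2_mult power_mult add: mult.commute)
      then have le: "exp (real n) * (1 / 256 ^ n) \<le> exp (real n) * (1 / exp (3 * real n))"
        by (intro mult_left_mono divide_left_mono) auto
      have "(b / (16 * b)) ^ (2 * n + 2) = (1 / 256) * (1 / 256 ^ n)"
        using b by (simp add: power_add power_mult power_one_over)
      then have "4 * exp (real n) * (b / (16 * b)) ^ (2 * n + 2) = (1 / 64) * (exp (real n) * (1 / 256 ^ n))" by simp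
      also have "\<dots> \<le> 1 * (exp (real n) * (1 / 256 ^ n))" by (intro mult_right_mono) auto
      also have "\<dots> \<le> exp (real n) * (1 / exp (3 * real n))" using le by simp
      also have "\<dots> = exp (- 2 * real n)" by (simp flip: exp_diff)
      finally show ?thesis .
    qed
    finally show "\<bar>\<Sum>a\<in>A. (lift v a - lift v' a) * F (x(i := a))\<bar> \<le> exp (- 2 * real n)" .
  qed
  also have "\<dots> \<le> exp (real n) * exp (- 2 * real n)" using n(2) by (intro mult_right_mono) auto
  also have "\<dots> = exp (- real n)" by (simp flip: exp_add)
  also have "\<dots> \<le> 1 / 10"
  proof -
    have "10 \<le> exp (real n)" using exp_ge_add_one_self[of "real n"] n(1) by linarith
    then show ?thesis by (simp add: exp_minus field_simps)
  qed
  \<comment> \<open>The Chebyshev losses leave a distance of 1/3 - 1/10 between the two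
    expectations, more than 1/10.\<close>
  finally show False using E1 E2 by linarith
qed

section \<open>The term ln d / \<epsilon>: two oracles at small distance\<close>

lemma chain_entropy_uniform:
  "chain_entropy (\<lambda>i. 1 / (real i + 2)) k = ln (real k + 1)"
proof (induction k)
  case (Suc k)
  define N where "N = real k + 2"
  have N: "N > 1" by (simp add: N_def)
  have 1: "1 - 1 / N = (N - 1) / N" using N by (simp add: field_simps)
  have e: "ln (1 / N) = - ln N" "ln ((N - 1) / N) = ln (N - 1) - ln N" using N by (simp_all add: ln_div)
  have "binary_entropy (1 / N) + (1 - 1 / N) * ln (N - 1) = (1 / N + (N - 1) / N) * ln N"
    unfolding binary_entropy_def 1 e by (simp add: algebra_simps)
  also have "1 / N + (N - 1) / N = 1" using N by (simp add: field_simps)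
  finally have "binary_entropy (1 / N) + (1 - 1 / N) * ln (N - 1) = ln N" by simp
  then show ?case using Suc by (simp add: N_def add.commute add.left_commute)
qed simp

text \<open>The binary entropy is stationary at 1/2, so moving mass x / 2 away from the heavy
  element loses only second order in x, against a first-order gain from the uniform part.\<close>

lemma binary_entropy_half_diff:
  fixes x :: real
  assumes "0 \<le> x" "x < 1"
  shows "ln 2 - x^2 \<le> binary_entropy ((1 - x) / 2)" "binary_entropy (1 / 2) = ln 2"
proof -
  have "ln ((1 - x) / 2) = ln (1 - x) - ln 2" using assms by (simp add: ln_div)
  then have a: "ln ((1 - x) / 2) \<le> - x - ln 2" using ln_le_minus_one[of "1 - x"] assms by simp
  have "ln ((1 + x) / 2) = ln (1 + x) - ln 2" using assms by (simp add: ln_div)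
  then have b: "ln ((1 + x) / 2) \<le> x - ln 2" using ln_le_minus_one[of "1 + x"] assms by simp
  have "(1 - x) / 2 * ln ((1 - x) / 2) \<le> (1 - x) / 2 * (- x - ln 2)"
    using a assms by (intro mult_left_mono) auto
  moreover have "(1 + x) / 2 * ln ((1 + x) / 2) \<le> (1 + x) / 2 * (x - ln 2)"
    using b assms by (intro mult_left_mono) auto
  moreover have "(1 - x) / 2 * (- x - ln 2) + (1 + x) / 2 * (x - ln 2) = x^2 - ln 2"
    by (simp add: field_simps power2_eq_square)
  moreover have "1 - (1 - x) / 2 = (1 + x) / 2" by (simp add: field_simps)
  then have "binary_entropy ((1 - x) / 2) = - ((1 - x) / 2 * ln ((1 - x) / 2)) - (1 + x) / 2 * ln ((1 + x) / 2)"
    by (simp only: binary_entropy_def)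
  ultimately show "ln 2 - x^2 \<le> binary_entropy ((1 - x) / 2)" by linarith
  show "binary_entropy (1 / 2) = ln 2" by (simp add: binary_entropy_def ln_div)
qed

text \<open>Acceptance probabilities are squared norms a^2 and b^2 of restricted vectors; a^2 - b^2
  = (a - b) (a + b) with a + b <= 2, and restriction does not increase the distance.\<close>

lemma accept_prob_diff_le:
  assumes c: "u \<in> carrier_vec n" "v \<in> carrier_vec n" and le: "vnorm u \<le> 1" "vnorm v \<le> 1"
  shows "accept_prob n X u - accept_prob n X v \<le> 2 * vnorm (u - v)"
proof -
  define S where "S = X \<inter> {..<n}"
  define a b where "a = L2_set (\<lambda>x. cmod (u $ x)) S" and "b = L2_set (\<lambda>x. cmod (v $ x)) S"
  have S: "finite S" "S \<subseteq> {..<n}" by (auto simp: S_def)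
  have mono: "L2_set f S \<le> L2_set f {..<n}" for f :: "nat \<Rightarrow> real"
    unfolding L2_set_def using S by (intro real_sqrt_le_mono sum_mono2) auto
  have a: "0 \<le> a" "a \<le> 1" "accept_prob n X u = a^2"
    using mono[of "\<lambda>x. cmod (u $ x)"] c le
    by (auto simp: a_def vnorm_def accept_prob_def S_def[symmetric] L2_set_def sum_nonneg)
  have b: "0 \<le> b" "b \<le> 1" "accept_prob n X v = b^2"
    using mono[of "\<lambda>x. cmod (v $ x)"] c le
    by (auto simp: b_def vnorm_def accept_prob_def S_def[symmetric] L2_set_def sum_nonneg)
  have "a \<le> L2_set (\<lambda>x. cmod (v $ x) + cmod ((u - v) $ x)) S"
    unfolding a_def
  proof (rule L2_set_mono)
    fix x assume "x \<in> S"
    then have "x < n" using S by auto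
    then have "(u - v) $ x = u $ x - v $ x" using c by (simp add: index_minus_vec(1))
    then show "cmod (u $ x) \<le> cmod (v $ x) + cmod ((u - v) $ x)"
      using norm_triangle_ineq[of "v $ x" "(u - v) $ x"] by simp
  qed simp
  also have "\<dots> \<le> b + L2_set (\<lambda>x. cmod ((u - v) $ x)) S"
    unfolding b_def by (rule L2_set_triangle_ineq)
  also have "L2_set (\<lambda>x. cmod ((u - v) $ x)) S \<le> vnorm (u - v)"
    using mono[of "\<lambda>x. cmod ((u - v) $ x)"] c by (simp add: vnorm_def)
  finally have ab: "a - b \<le> vnorm (u - v)" by simp
  have "a^2 - b^2 = (a - b) * (a + b)" by (simp add: power2_eq_square algebra_simps)
  also have "\<dots> \<le> vnorm (u - v) * (a + b)" using ab a b by (intro mult_right_mono) auto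
  also have "\<dots> \<le> vnorm (u - v) * 2" using a b vnorm_nonneg by (intro mult_left_mono) auto
  finally show ?thesis using a b by simp
qed

text \<open>The hard pair: one element of mass \<open>1/2\<close> or \<open>(1 - x)/2\<close>, the rest uniform on \<open>k + 1\<close> elements.
  The entropies differ by about \<open>x ln k\<close>, the oracles only by \<open>x\<close> in operator norm.\<close>

lemma log_lower_bound:
  assumes est: "estimates_entropy d m w T V qt out \<epsilon>" and d: "d = k + 2" "d \<le> m"
    and x: "0 < x" "x \<le> 1 / 2" and gap: "2 * \<epsilon> < x * (ln (real (k + 1)) / 2 - x)"
  shows "1 / (6 * x) \<le> real T"
proof -
  define dm where "dm = d * m"
  define l where "l = Suc k * m + Suc k"
  have alg: "valid_algorithm dm w T V qt" using est by (simp add: estimates_entropy_def dm_def)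
  have dm: "0 < dm" using d by (auto simp: dm_def)
  have l: "0 < l" "l < dm" using d by (auto simp: l_def dm_def)
  \<comment> \<open>Breaking off the fraction 1 / (i + 2) keeps all pieces equal, so the first
    \<open>k\<close> breaks give the uniform distribution on k + 1 elements; only the break with
    index \<open>k\<close> depends on the parameter.\<close>
  define q where "q s = (\<lambda>i. (sqrt (1 - 1 / (real i + 2)), sqrt (1 / (real i + 2))))(k := (sqrt (1 - s), sqrt s))" for s
  have circle: "(fst (q s i))^2 + (snd (q s i))^2 = 1" if "0 \<le> s" "s \<le> 1" for s i
    using that by (auto simp: q_def field_simps)
  define H where "H s = binary_entropy s + (1 - s) * ln (real k + 1)" for s
  have entropy: "chain_entropy (\<lambda>i. (snd (q s i))^2) (Suc k) = H s" if "0 \<le> s" for s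
  proof -
    have "chain_entropy (\<lambda>i. (snd (q s i))^2) k = chain_entropy (\<lambda>i. 1 / (real i + 2)) k"
      by (rule chain_entropy_cong) (auto simp: q_def)
    then show ?thesis using that by (simp add: H_def chain_entropy_uniform) (simp add: q_def)
  qed
  define B where "B = chain_oracle dm m (q 0) k"
  define U where "U s = chain_oracle dm m (q s) (Suc k)" for s
  have U_eq: "U s = B * plane_rot dm l (of_real (sqrt (1 - s))) (of_real (sqrt s)) * 1\<^sub>m dm" for s
  proof -
    have "chain_oracle dm m (q s) k = B" unfolding B_def by (rule chain_oracle_cong) (simp add: q_def)
    then show ?thesis
      using right_mult_one_mat[OF mult_carrier_mat[OF chain_oracle_carrier plane_rot_carrier]]
      by (simp add: U_def l_def q_def B_def)
  qed
  have B: "is_unitary dm B"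
    unfolding B_def by (rule is_unitary_chain_oracle) (use circle l in \<open>auto simp: l_def\<close>)
  have U: "is_unitary dm (U s)" if "0 \<le> s" "s \<le> 1" for s
    unfolding U_def by (rule is_unitary_chain_oracle) (use circle[OF that] l in \<open>auto simp: l_def\<close>)
  have Wu: "is_unitary dm (oracle_dir (U s) (cadj (U s)) t)" if "0 \<le> s" "s \<le> 1" for s t
    using U[OF that] is_unitary_cadj[OF U[OF that]] by (simp add: oracle_dir_def)
  define \<Phi> where "\<Phi> s = run_state dm w V qt (oracle_dir (U s) (cadj (U s))) T" for s
  have \<Phi>: "\<Phi> s \<in> carrier_vec (2 * (dm * w))" "vnorm (\<Phi> s) \<le> 1" if "0 \<le> s" "s \<le> 1" for s
  proof -
    show "\<Phi> s \<in> carrier_vec (2 * (dm * w))"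
      unfolding \<Phi>_def by (rule run_state_carrier[OF alg is_unitary_carrier[OF Wu[OF that]]]) simp
    have "vnorm (\<Phi> s) \<le> 1 ^ T"
      unfolding \<Phi>_def by (rule vnorm_run_state_le[OF alg dm is_unitary_carrier[OF Wu[OF that]]])
        (use vnorm_unitary[OF Wu[OF that]] in auto)
    then show "vnorm (\<Phi> s) \<le> 1" by simp
  qed
  define s1 s2 where "s1 = (1 / 2 :: real)" and "s2 = (1 - x) / 2"
  have s: "0 \<le> s1" "s1 \<le> 1" "0 \<le> s2" "s2 \<le> 1" using x by (auto simp: s1_def s2_def)
  have success: "2/3 \<le> success_prob dm w T V qt out (U r) (\<lambda>y. \<bar>y - H r\<bar> \<le> \<epsilon>)" if r: "0 \<le> r" "r \<le> 1" for r
    using estimates_entropy_chain[of "Suc k" m w T V qt out \<epsilon> "q r"] est d circle[OF r] entropy[OF r(1)]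
    by (simp add: dm_def U_def)
  have far: "2 * \<epsilon> < H s2 - H s1"
  proof -
    have h: "ln 2 - x^2 \<le> binary_entropy s2" "binary_entropy s1 = ln 2"
      unfolding s1_def s2_def using binary_entropy_half_diff[of x] x by auto
    have s21: "1 - s2 = (1 - s1) + x / 2" by (simp add: s1_def s2_def field_simps)
    have "H s2 - H s1 = binary_entropy s2 - binary_entropy s1 + x / 2 * ln (real k + 1)"
      unfolding H_def s21 by (simp add: algebra_simps)
    then have "x / 2 * ln (real k + 1) - x^2 \<le> H s2 - H s1" using h by linarith
    moreover have "x * (ln (real (k + 1)) / 2 - x) = x / 2 * ln (real k + 1) - x^2"
      by (simp add: power2_eq_square algebra_simps)
    ultimately show ?thesis using gap by linarith
  qed
  have "success_prob dm w T V qt out (U s2) (\<lambda>y. \<bar>y - H s1\<bar> \<le> \<epsilon>) \<le> 1 / 3"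
  proof -
    have "success_prob dm w T V qt out (U s2) (\<lambda>y. \<bar>y - H s1\<bar> \<le> \<epsilon>)
        + success_prob dm w T V qt out (U s2) (\<lambda>y. \<bar>y - H s2\<bar> \<le> \<epsilon>) \<le> 1"
      by (rule success_prob_unitary(3)[OF alg dm U[OF s(3,4)]]) (use far in linarith)
    then show ?thesis using success[OF s(3,4)] by linarith
  qed
  then have "1 / 3 \<le> success_prob dm w T V qt out (U s1) (\<lambda>y. \<bar>y - H s1\<bar> \<le> \<epsilon>)
      - success_prob dm w T V qt out (U s2) (\<lambda>y. \<bar>y - H s1\<bar> \<le> \<epsilon>)"
    using success[OF s(1,2)] by linarith
  also have "\<dots> \<le> 2 * vnorm (\<Phi> s1 - \<Phi> s2)"
    unfolding success_prob_eq \<Phi>_def[symmetric]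
    by (rule accept_prob_diff_le[OF \<Phi>(1)[OF s(1,2)] \<Phi>(1)[OF s(3,4)] \<Phi>(2)[OF s(1,2)] \<Phi>(2)[OF s(3,4)]])
  also have "vnorm (\<Phi> s1 - \<Phi> s2) \<le> T * x"
    unfolding \<Phi>_def
  proof (rule vnorm_run_state_diff_le[OF alg dm is_unitary_carrier[OF Wu[OF s(1,2)]] is_unitary_carrier[OF Wu[OF s(3,4)]]])
    fix t and y :: "complex vec" assume y: "y \<in> carrier_vec dm"
    show "vnorm (oracle_dir (U s1) (cadj (U s1)) t *\<^sub>v y) \<le> vnorm y"
      "vnorm (oracle_dir (U s2) (cadj (U s2)) t *\<^sub>v y) \<le> vnorm y"
      using vnorm_unitary[OF Wu y] s by simp_all
    \<comment> \<open>The oracle and its adjoint are brought to the common shape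
      \<open>L * P r * R\<close>, with the opposite angle for the adjoint, so that one estimate of a
      rotation difference serves all query types.\<close>
    define \<sigma> where "\<sigma> = (if t = 0 \<or> t = 2 then 1 else -1 :: real)"
    define L R where "L = (if t = 0 \<or> t = 2 then B else 1\<^sub>m dm)" and "R = (if t = 0 \<or> t = 2 then 1\<^sub>m dm else cadj B)"
    have LR: "is_unitary dm L" "is_unitary dm R"
      using B is_unitary_cadj[OF B] is_unitary_one by (auto simp: L_def R_def)
    note c = is_unitary_carrier[OF LR(1)] is_unitary_carrier[OF LR(2)]
    define P where "P r = plane_rot dm l (of_real (sqrt (1 - r))) (of_real (\<sigma> * sqrt r))" for r
    have cadj_one: "cadj (1\<^sub>m dm) = 1\<^sub>m dm" by (rule eq_matI) (auto simp: cadj_def)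
    have dir: "oracle_dir (U r) (cadj (U r)) t = L * P r * R" for r
      unfolding oracle_dir_def U_eq cadj_factor[OF is_unitary_carrier[OF B] one_carrier_mat] cadj_one
      by (simp add: L_def R_def P_def \<sigma>_def)
    define z where "z = R *\<^sub>v y"
    have z: "z \<in> carrier_vec dm" "vnorm z = vnorm y"
      unfolding z_def using mult_mat_vec_carrier[OF c(2) y] vnorm_unitary[OF LR(2) y] by auto
    have Pc: "P r \<in> carrier_mat dm dm" for r unfolding P_def by (rule plane_rot_carrier)
    have split: "L * P r * R *\<^sub>v y = L *\<^sub>v (P r *\<^sub>v z)" for r
      unfolding z_def by (simp add: assoc_mult_mat_vec[OF mult_carrier_mat[OF c(1) Pc] c(2) y]
          assoc_mult_mat_vec[OF c(1) Pc mult_mat_vec_carrier[OF c(2) y]])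
    note Pz = mult_mat_vec_carrier[OF Pc z(1)]
    have "vnorm (oracle_dir (U s1) (cadj (U s1)) t *\<^sub>v y - oracle_dir (U s2) (cadj (U s2)) t *\<^sub>v y)
        = vnorm (L *\<^sub>v (P s1 *\<^sub>v z - P s2 *\<^sub>v z))"
      unfolding dir split by (simp only: mult_minus_distrib_mat_vec[OF c(1) Pz Pz])
    also have "\<dots> = vnorm (P s1 *\<^sub>v z - P s2 *\<^sub>v z)"
      by (rule vnorm_unitary[OF LR(1) minus_carrier_vec[OF Pz Pz]])
    also have "\<dots> \<le> x * vnorm z"
    proof -
      define \<gamma> \<eta> where "\<gamma> = sqrt (1 - s1) - sqrt (1 - s2)" and "\<eta> = \<sigma> * sqrt s1 - \<sigma> * sqrt s2"
      \<comment> \<open>Near mass 1/2 both amplitudes are Lipschitz in the mass: each changes by at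
        most x / sqrt 2, so the combined change \<gamma> + i \<eta> has modulus at most x. This is
        why the heavy element has mass near 1/2.\<close>
      have root: "\<bar>sqrt (1 / 2) - sqrt ((1 + r) / 2)\<bar> \<le> \<bar>r\<bar> * sqrt (1 / 2)" if "- 1 \<le> r" for r
      proof -
        define e where "e = sqrt (1 + r)"
        have e: "0 \<le> e" "e^2 = 1 + r" using that by (auto simp: e_def)
        have "\<bar>1 - e\<bar> * 1 \<le> \<bar>1 - e\<bar> * \<bar>1 + e\<bar>" using e by (intro mult_left_mono) auto
        also have "\<dots> = \<bar>1 - e^2\<bar>" by (simp add: power2_eq_square algebra_simps flip: abs_mult)
        also have "\<dots> = \<bar>r\<bar>" using e by simp
        finally have "\<bar>1 - e\<bar> * sqrt (1 / 2) \<le> \<bar>r\<bar> * sqrt (1 / 2)" by (intro mult_right_mono) auto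
        moreover have "sqrt (1 / 2) - sqrt ((1 + r) / 2) = (1 - e) * sqrt (1 / 2)"
          unfolding e_def by (simp add: real_sqrt_divide field_simps)
        ultimately show ?thesis by (simp add: abs_mult)
      qed
      have "\<bar>\<gamma>\<bar> \<le> x * sqrt (1 / 2)"
        using root[of x] x by (simp add: \<gamma>_def s1_def s2_def field_simps)
      then have g2: "\<gamma>^2 \<le> x^2 / 2"
        using power_mono[of "\<bar>\<gamma>\<bar>" "x * sqrt (1 / 2)" 2] by (simp add: power_mult_distrib)
      have "\<bar>\<eta>\<bar> = \<bar>sqrt s1 - sqrt s2\<bar>" by (auto simp: \<eta>_def \<sigma>_def)
      also have "\<dots> \<le> x * sqrt (1 / 2)" using root[of "- x"] x by (simp add: s1_def s2_def)
      finally have e2: "\<eta>^2 \<le> x^2 / 2"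
        using power_mono[of "\<bar>\<eta>\<bar>" "x * sqrt (1 / 2)" 2] by (simp add: power_mult_distrib)
      have cm: "cmod (of_real \<gamma> + \<i> * of_real \<eta>) \<le> x" "cmod (of_real \<gamma> - \<i> * of_real \<eta>) \<le> x"
        using g2 e2 x by (auto simp: cmod_def intro!: real_le_lsqrt)
      show ?thesis
        unfolding P_def by (rule vnorm_plane_rot_diff_le[OF z(1) l]) (use cm x in \<open>simp_all add: \<gamma>_def \<eta>_def\<close>)
    qed
    finally show "vnorm (oracle_dir (U s1) (cadj (U s1)) t *\<^sub>v y - oracle_dir (U s2) (cadj (U s2)) t *\<^sub>v y) \<le> x * vnorm y"
      by (simp only: z(2))
  qed (use x in auto)
  finally have "1 / 3 \<le> 2 * (real T * x)" by simp
  then show ?thesis using x by (simp add: field_simps)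
qed

text \<open>\<open>K\<close> collects the factors 20 * 400 * 4096 * 64 of the variance estimate. The
  assumption \<open>\<epsilon>d\<close> and the last two parts of \<open>large\<close> make that
  variance small; the first part of \<open>large\<close> keeps b <= 1 / 1024. The constant 512 is 8
  * 64, from 8 T sqrt b <= n with sqrt b = 64 sqrt \<epsilon> n / sqrt d.\<close>

lemma sqrt_lower_bound:
  defines "K \<equiv> 8000 * 64 ^ 3 :: real"
  assumes est: "estimates_entropy d m w T V qt out \<epsilon>" and dm: "d \<le> m"
    and \<epsilon>: "0 < \<epsilon>" "\<epsilon> < 1 / 65536" and d: "9 \<le> ln (real d)"
    and large: "256 * (ln (real d))^2 \<le> real d" "(4 * K)^2 \<le> ln (real d)" "128 * 4096^2 * K * ln (real d) ^ 3 \<le> sqrt (real d)"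
    and \<epsilon>d: "ln (real d) ^ 3 \<le> \<epsilon> * real d"
  shows "sqrt (real d) / sqrt \<epsilon> / 512 \<le> real T"
proof (rule ccontr)
  assume "\<not> ?thesis"
  then have T: "real T \<le> sqrt (real d) / sqrt \<epsilon> / 512" by simp
  define L where "L = ln (real d)"
  define n where "n = nat \<lceil>L\<rceil>"
  \<comment> \<open>4096 = 16 * 256 turns the gap condition into 4 \<epsilon> < 16 \<epsilon> k / d,
    where k / d >= 1/2. The mass condition becomes 32768 \<epsilon> k / d <= 1/2, the origin of the
    bound 1 / 65536 on \<epsilon>.\<close>
  define b where "b = 4096 * \<epsilon> * (real n)^2 / real d"
  let ?S = "(25 * sqrt b * (8 * b / (real n)^2))"
  have L: "9 \<le> L" using d by (simp add: L_def)
  have n: "L \<le> real n" "real n \<le> 2 * L" using L unfolding n_def by linarith+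
  have n9: "9 \<le> n" using n L by linarith
  have d2: "2 \<le> d" using d by (cases "d = 0 \<or> d = 1") auto
  then obtain k where k: "d = Suc k" "1 \<le> k" by (cases d) auto
  let ?R = "(1 + b * (8 * b / (real n)^2) * (real k)^2)"
  have dpos: "0 < real d" using d2 by simp
  have kd: "real d / 2 \<le> real k" "real k \<le> real d" using k by auto
  have n2: "(real n)^2 \<le> 4 * L^2" using power_mono[OF n(2), of 2] by (simp add: power_mult_distrib)
  have sqb: "sqrt b = 64 * sqrt \<epsilon> * real n / sqrt (real d)"
    by (simp add: b_def real_sqrt_mult real_sqrt_divide)
  have b0: "0 < b" using \<epsilon> n9 dpos by (simp add: b_def)
  have b1: "b \<le> 1 / 1024"
  proof -
    have "b = (4096 * \<epsilon>) * ((real n)^2 / real d)" by (simp add: b_def)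
    also have "\<dots> \<le> (1 / 16) * (1 / 64)"
    proof (rule mult_mono)
      have "64 * (real n)^2 \<le> real d" using n2 large(1) by (simp add: L_def)
      then show "(real n)^2 / real d \<le> 1 / 64" using dpos by (simp add: field_simps)
    qed (use \<epsilon> in auto)
    finally show ?thesis by simp
  qed
  show False
  proof (rule moment_matching_contradiction[OF est[unfolded k(1)] dm[unfolded k(1)] \<epsilon>(1) n9 _ b0 b1])
    have "exp L = real d" using dpos by (simp add: L_def)
    then show "real k \<le> exp (real n)" using n(1) kd(2) by (metis exp_le_cancel_iff order_trans)
    show "8 * real T * sqrt b \<le> real n"
    proof -
      have "8 * real T * sqrt b \<le> 8 * (sqrt (real d) / sqrt \<epsilon> / 512) * sqrt b"
        using T b0 by (intro mult_right_mono) auto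
      also have "\<dots> = real n" using \<epsilon> dpos by (simp add: sqb)
      finally show ?thesis .
    qed
    show "8 * real k * b / (real n)^2 \<le> 1 / 2"
    proof -
      have "8 * real k * b / (real n)^2 = 32768 * \<epsilon> * (real k / real d)" using n9 by (simp add: b_def)
      also have "\<dots> \<le> 32768 * \<epsilon> * 1" using \<epsilon> kd(2) dpos by (intro mult_left_mono) auto
      finally show ?thesis using \<epsilon> by simp
    qed
    show "4 * \<epsilon> < real k * b / (256 * (real n)^2)"
    proof -
      have "4 * \<epsilon> < 16 * \<epsilon> * (1 / 2)" using \<epsilon> by simp
      also have "\<dots> \<le> 16 * \<epsilon> * (real k / real d)" using \<epsilon> kd(1) dpos by (intro mult_left_mono) (auto simp: field_simps)
      also have "\<dots> = real k * b / (256 * (real n)^2)" using n9 by (simp add: b_def)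
      finally show ?thesis .
    qed
    show "real k * (2 * ?S * ?R) \<le> \<epsilon>^2 / 20"
    proof -
      define q where "q = 8 * 4096^2 * \<epsilon>^2 * (real n)^2"
      have q0: "0 \<le> q" by (simp add: q_def)
      have "b * (8 * b / (real n)^2) * (real k)^2 = q * (real k / real d)^2"
        using n9 dpos by (simp add: b_def q_def power2_eq_square field_simps)
      also have "\<dots> \<le> q * 1" using kd(2) dpos q0 by (intro mult_left_mono power_le_one) auto
      finally have 1: "1 + b * (8 * b / (real n)^2) * (real k)^2 \<le> 1 + q" by simp
      have "real k * (2 * ?S) = 400 * 4096 * \<epsilon> * sqrt b * (real k / real d)"
        using n9 dpos by (simp add: b_def field_simps)
      also have "\<dots> \<le> 400 * 4096 * \<epsilon> * sqrt b * 1"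
        using kd(2) dpos \<epsilon> b0 by (intro mult_left_mono) auto
      finally have 2: "real k * (2 * ?S) \<le> 400 * 4096 * \<epsilon> * sqrt b" by simp
      have "real k * (2 * ?S * ?R)
          = real k * (2 * ?S) * ?R"
        by (simp only: mult.assoc)
      also have "\<dots> \<le> (400 * 4096 * \<epsilon> * sqrt b) * (1 + q)"
        using \<epsilon> b0 by (intro mult_mono[OF 2 1]) auto
      also have "\<dots> = (\<epsilon> / 20) * (K * sqrt \<epsilon> * (real n / sqrt (real d)) * (1 + q))"
        by (simp add: sqb K_def)
      also have "\<dots> \<le> (\<epsilon> / 20) * \<epsilon>"
      proof (rule mult_left_mono)
        define r where "r = real n / sqrt (real d)"
        have r0: "0 \<le> r" by (simp add: r_def)
        have K0: "0 < K" by (simp add: K_def)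
        have se: "sqrt \<epsilon> * sqrt \<epsilon> = \<epsilon>" using \<epsilon> by simp
        \<comment> \<open>Leading part of the variance: (4 K)^2 <= L gives 4 K L <= sqrt (L^3) <=
          sqrt (\<epsilon> d). The third power of L in the assumption on \<epsilon> d thus absorbs
          the constant.\<close>
        have A: "K * r \<le> sqrt \<epsilon> / 2"
        proof -
          have "4 * K \<le> sqrt L" by (rule real_le_rsqrt) (use large(2) in \<open>simp add: L_def\<close>)
          then have "4 * K * L \<le> sqrt L * L" using L by (intro mult_right_mono) auto
          also have "\<dots> = sqrt (L ^ 3)" using L by (simp add: power3_eq_cube real_sqrt_mult)
          also have "\<dots> \<le> sqrt (\<epsilon> * real d)" using \<epsilon>d by (simp add: L_def)
          also have "\<dots> = sqrt \<epsilon> * sqrt (real d)" by (rule real_sqrt_mult)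
          finally have "4 * K * L \<le> sqrt \<epsilon> * sqrt (real d)" .
          moreover have "2 * K * real n \<le> 2 * K * (2 * L)" using n(2) K0 by (intro mult_left_mono) auto
          ultimately have "2 * K * real n \<le> sqrt \<epsilon> * sqrt (real d)" by simp
          then show ?thesis using dpos by (simp add: r_def field_simps)
        qed
        \<comment> \<open>The correction \<open>q\<close> has a factor \<epsilon>^2 <= sqrt
          \<epsilon> of its own, so here d being large suffices.\<close>
        have Bd: "K * r * q \<le> sqrt \<epsilon> / 2"
        proof -
          have "real n ^ 3 \<le> (2 * L) ^ 3" by (rule power_mono[OF n(2)]) simp
          then have "16 * 4096^2 * K * real n ^ 3 \<le> 16 * 4096^2 * K * (2 * L) ^ 3"
            using K0 by (intro mult_left_mono) auto
          also have "\<dots> = 128 * 4096^2 * K * L ^ 3" by (simp add: power_mult_distrib)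
          also have "\<dots> \<le> sqrt (real d)" using large(3) by (simp add: L_def)
          finally have "16 * 4096^2 * K * real n ^ 3 / sqrt (real d) \<le> 1" using dpos by simp
          then have "8 * 4096^2 * K * real n ^ 3 / sqrt (real d) \<le> 1 / 2" by simp
          then have "\<epsilon>^2 * (8 * 4096^2 * K * real n ^ 3 / sqrt (real d)) \<le> \<epsilon>^2 * (1 / 2)"
            by (intro mult_left_mono) auto
          also have "\<epsilon>^2 * (8 * 4096^2 * K * real n ^ 3 / sqrt (real d)) = K * r * q"
            by (simp add: q_def r_def power2_eq_square power3_eq_cube)
          finally have "K * r * q \<le> \<epsilon>^2 / 2" by simp
          also have "\<epsilon>^2 \<le> sqrt \<epsilon>"
          proof (rule real_le_rsqrt)
            have "(\<epsilon>^2)^2 = \<epsilon> ^ 4" by simp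
            also have "\<dots> \<le> \<epsilon> ^ 1" using \<epsilon> by (intro power_decreasing) auto
            finally show "(\<epsilon>^2)^2 \<le> \<epsilon>" by simp
          qed
          finally show ?thesis by simp
        qed
        have "K * sqrt \<epsilon> * r * (1 + q) = sqrt \<epsilon> * (K * r + K * r * q)" by (simp add: algebra_simps)
        also have "\<dots> \<le> sqrt \<epsilon> * (sqrt \<epsilon> / 2 + sqrt \<epsilon> / 2)"
          using A Bd \<epsilon> by (intro mult_left_mono) auto
        also have "\<dots> = \<epsilon>" using se by simp
        finally show "K * sqrt \<epsilon> * (real n / sqrt (real d)) * (1 + q) \<le> \<epsilon>" by (simp add: r_def)
      qed (use \<epsilon> in simp)
      finally show ?thesis by (simp add: power2_eq_square)
    qed
  qed
qed

theorem theorem2p10: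
  shows "\<exists>c>0. \<exists>\<epsilon>0>0. \<exists>d0::nat. \<forall>(d::nat) (m::nat) (w::nat) (T::nat) V qt (out :: nat \<Rightarrow> real) (\<epsilon>::real).
     d \<ge> d0 \<longrightarrow> d \<le> m \<longrightarrow> 0 < \<epsilon> \<longrightarrow> \<epsilon> < \<epsilon>0 \<longrightarrow>
     valid_algorithm (d * m) w T V qt \<longrightarrow>
     (\<forall>p U. is_distribution d p \<longrightarrow> purified_oracle d m p U \<longrightarrow>
        success_prob (d * m) w T V qt out U (\<lambda>y. \<bar>y - shannon_entropy d p\<bar> \<le> \<epsilon>) \<ge> 2/3) \<longrightarrow>
     real T \<ge> c * (sqrt (real d) / sqrt (\<epsilon> * ln (real d)) + ln (real d) / \<epsilon>)"
proof -
  define K where "K = (8000 * 64 ^ 3 :: real)"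
  have "\<forall>\<^sub>F d::nat in sequentially. 9 \<le> ln (real d)" by real_asymp
  moreover have "\<forall>\<^sub>F d::nat in sequentially. 256 * (ln (real d))^2 \<le> real d" by real_asymp
  moreover have "\<forall>\<^sub>F d::nat in sequentially. (4 * K)^2 \<le> ln (real d)" unfolding K_def by real_asymp
  moreover have "\<forall>\<^sub>F d::nat in sequentially. 128 * 4096^2 * K * ln (real d) ^ 3 \<le> sqrt (real d)"
    unfolding K_def by real_asymp
  \<comment> \<open>In the hard pair the uniform part has d - 1 elements; the summand 1 covers the
    second-order loss, which is at most 1/2.\<close>
  moreover have "\<forall>\<^sub>F d::nat in sequentially. ln (real d) / 4 + 1 < ln (real d - 1) / 2" by real_asymp
  ultimately have "\<forall>\<^sub>F d::nat in sequentially. 9 \<le> ln (real d) \<and> 256 * (ln (real d))^2 \<le> real d \<and>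
      (4 * K)^2 \<le> ln (real d) \<and> 128 * 4096^2 * K * ln (real d) ^ 3 \<le> sqrt (real d) \<and>
      ln (real d) / 4 + 1 < ln (real d - 1) / 2"
    by eventually_elim simp
  then obtain d0 where d0: "\<And>d::nat. d0 \<le> d \<Longrightarrow> 9 \<le> ln (real d) \<and> 256 * (ln (real d))^2 \<le> real d \<and>
      (4 * K)^2 \<le> ln (real d) \<and> 128 * 4096^2 * K * ln (real d) ^ 3 \<le> sqrt (real d) \<and>
      ln (real d) / 4 + 1 < ln (real d - 1) / 2"
    unfolding eventually_sequentially by blast
  show ?thesis
  proof (intro exI conjI allI impI)
    show "(0::real) < 1 / 1024" "(0::real) < 1 / 65536" by simp_all
    fix d m w T :: nat and V qt and out :: "nat \<Rightarrow> real" and \<epsilon> :: real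
    assume d: "d0 \<le> d" "d \<le> m" and \<epsilon>: "0 < \<epsilon>" "\<epsilon> < 1 / 65536" and alg: "valid_algorithm (d * m) w T V qt"
      and succ: "\<forall>p U. is_distribution d p \<longrightarrow> purified_oracle d m p U \<longrightarrow>
        success_prob (d * m) w T V qt out U (\<lambda>y. \<bar>y - shannon_entropy d p\<bar> \<le> \<epsilon>) \<ge> 2/3"
    have est: "estimates_entropy d m w T V qt out \<epsilon>" using alg succ by (simp add: estimates_entropy_def)
    define L where "L = ln (real d)"
    have L: "9 \<le> L" "L / 4 + 1 < ln (real d - 1) / 2" using d0[OF d(1)] by (auto simp: L_def)
    have dpos: "2 \<le> d" using L(1) unfolding L_def by (cases "d = 0 \<or> d = 1") auto
    then obtain k where k: "d = k + 2" by (metis le_Suc_ex add.commute)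
    have log: "L / (54 * \<epsilon>) \<le> real T"
    proof -
      \<comment> \<open>The factor 9 makes x L / 4 exceed 2 \<epsilon>, and 1 / (6 x) is then L /
        (54 \<epsilon>).\<close>
      define x where "x = 9 * \<epsilon> / L"
      have x: "0 < x" "x \<le> 1 / 2" using \<epsilon> L(1) by (auto simp: x_def field_simps)
      have "2 * \<epsilon> < x * (L / 4)" using L(1) \<epsilon> by (simp add: x_def)
      also have "\<dots> \<le> x * (ln (real (k + 1)) / 2 - x)"
        using x L(2) by (intro mult_left_mono) (auto simp: k add.commute)
      finally have "1 / (6 * x) \<le> real T" by (rule log_lower_bound[OF est k d(2) x])
      then show ?thesis using L(1) \<epsilon> by (simp add: x_def field_simps)
    qed
    have sq: "sqrt (real d) / sqrt (\<epsilon> * L) \<le> 512 * real T"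
    \<comment> \<open>At L^3 = \<epsilon> d the two terms coincide. Above it the stronger bound
      without the logarithm under the root is available; below it the first term is at most L /
      \<epsilon>.\<close>
    proof (cases "L ^ 3 \<le> \<epsilon> * real d")
      case True
      have "sqrt (real d) / sqrt (\<epsilon> * L) \<le> sqrt (real d) / sqrt \<epsilon>"
        using \<epsilon> L(1) dpos by (intro divide_left_mono) (auto simp: mult_le_cancel_left1)
      also have "\<dots> \<le> 512 * real T"
        using sqrt_lower_bound[OF est d(2) \<epsilon>] d0[OF d(1)] True by (simp add: L_def K_def)
      finally show ?thesis .
    next
      case False
      have "sqrt (real d) / sqrt (\<epsilon> * L) = sqrt (real d / (\<epsilon> * L))" by (simp add: real_sqrt_divide)
      also have "\<dots> \<le> L / \<epsilon>"
      proof (rule real_le_lsqrt)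
        have "real d * \<epsilon> \<le> L ^ 3" using False by (simp add: mult.commute)
        then have "(real d * \<epsilon>) * (1 / (\<epsilon>^2 * L)) \<le> L ^ 3 * (1 / (\<epsilon>^2 * L))"
          using \<epsilon> L(1) by (intro mult_right_mono) auto
        then show "real d / (\<epsilon> * L) \<le> (L / \<epsilon>)^2"
          using \<epsilon> L(1) by (simp add: power2_eq_square power3_eq_cube)
      qed (use \<epsilon> L(1) in auto)
      also have "\<dots> = 54 * (L / (54 * \<epsilon>))" by simp
      also have "\<dots> \<le> 512 * real T" using log by linarith
      finally show ?thesis .
    qed
    have "L / \<epsilon> = 54 * (L / (54 * \<epsilon>))" by simp
    then have "L / \<epsilon> \<le> 512 * real T" using log by linarith
    then have "sqrt (real d) / sqrt (\<epsilon> * L) + L / \<epsilon> \<le> 1024 * real T" using sq by linarith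
    then have "1 / 1024 * (sqrt (real d) / sqrt (\<epsilon> * L) + L / \<epsilon>) \<le> 1 / 1024 * (1024 * real T)"
      by (rule mult_left_mono) simp
    then show "1 / 1024 * (sqrt (real d) / sqrt (\<epsilon> * ln (real d)) + ln (real d) / \<epsilon>) \<le> real T"
      unfolding L_def by simp
  qed
qed

end
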